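(* Let $n\geq3$ and let $S_n$ act on $V=\mathbb{C}^n$ by the natural permutation representation $\sigma e_i=e_{\sigma(i)}$. For $a,b,c\in\mathbb{C}$ and $1\leq i<j\leq n$ let $$\kappa^L(e_i,e_j)=\sum_{k\neq i,j}\big(a\,e_{\{i,j,k\}}+b\,e^{\perp}_{\{i,j,k\}}\big)\otimes\big((ijk)-(kji)\big),$$ $$\kappa^C(e_i,e_j)=c\sum_{k\neq i,j}\big((ijk)-(kji)\big)+(a-b)^2\Big(\sum_{\substack{\sigma\text{ a }5\text{-cycle}\\ \sigma^2(i)=j}}2(\sigma-\sigma^{-1})-\sum_{\substack{\sigma\text{ a }5\text{-cycle}\\ \sigma(i)=j}}(\sigma-\sigma^{-1})\Big).$$ Then $$\mathcal{H}_{\kappa,t}=T(V)\#S_n[t]\big/\langle e_ie_j-e_je_i-\kappa^L(e_i,e_j)t-\kappa^C(e_i,e_j)t^2\mid 1\leq i<j\leq n\rangle$$ is a Drinfeld orbifold algebra over $\mathbb{C}[t]$. Further, the algebras $\mathcal{H}_{\kappa,1}$ are precisely the Drinfeld orbifold algebras $\mathcal H_\kappa$ for this action such that $\operatorname{im}\kappa^L_g\subseteq V^g$ for each $g\in S_n$ and $\kappa^L$ is supported only off the identity.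
   Context: Notation: $e_1,\dots,e_n$ is the standard basis; for $I\subseteq\{1,\dots,n\}$, $e_I=\sum_{i\in I}e_i$ and $e_I^\perp=e_{\{1,\dots,n\}}-e_I$; $(ijk)$ denotes a 3-cycle; $V^g$ is the fixed-point space of $g$. The maps $\kappa^L,\kappa^C$ are extended to alternating bilinear maps on $V$. For a finite group $G$ acting linearly on $V$, the skew group algebra $R\#G$ ($R=T(V)$ or $S(V)$) is $R\otimes\mathbb{C}G$ with $(r\otimes g)(s\otimes h)=r(g\cdot s)\otimes gh$. A linear (resp. constant) $2$-cochain is $\alpha=\sum_g\alpha_g g$ with $\alpha_g:\bigwedge^2V\to V$ (resp. $\to\mathbb{C}$); $\alpha(v,w)=\sum_g\alpha_g(v,w)\otimes g$; its support is $\{g:\alpha_g\ne0\}$. For $\kappa=\kappa^L+\kappa^C$, $\mathcal{H}_\kappa=T(V)\#G/\langle vw-wv-\kappa^L(v,w)-\kappa^C(v,w)\mid v,w\in V\rangle$, filtered with $V$ in degree one and $G$ in degree zero; it is a Drinfeld orbifold algebra if its associated graded algebra is isomorphic to $S(V)\#G$. When $\mathcal{H}_\kappa$ is a Drinfeld orbifold algebra, $\mathcal{H}_{\kappa,t}=T(V)\#G[t]/\langle vw-wv-\kappa^L(v,w)t-\kappa^C(v,w)t^2\rangle$ is called a Drinfeld orbifold algebra over $\mathbb{C}[t]$. *)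

theory Defs
  imports Complex_Main "HOL-Combinatorics.Cycles"
begin

text \<open>The symmetric group S_n, realised as permutations of {0..n-1}
  (indices shifted by one). Group product is composition g o h.\<close>
definition Sym :: "nat \<Rightarrow> (nat \<Rightarrow> nat) set" where
  "Sym n = {p. p permutes {..<n}}"

text \<open>sigma is a k-cycle in S_n (cycle_of_list [x1,...,xk] maps x1 to x2 to ... to xk to x1).\<close>
definition is_kcycle :: "nat \<Rightarrow> nat \<Rightarrow> (nat \<Rightarrow> nat) \<Rightarrow> bool" where
  "is_kcycle n k \<sigma> \<longleftrightarrow> (\<exists>xs. length xs = k \<and> distinct xs \<and> set xs \<subseteq> {..<n} \<and> \<sigma> = cycle_of_list xs)"

definition cyc3 :: "nat \<Rightarrow> nat \<Rightarrow> nat \<Rightarrow> (nat \<Rightarrow> nat)" where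
  "cyc3 i j k = cycle_of_list [i, j, k]"

text \<open>Elements of T(V)#S_n, V = C^n: finitely supported complex functions on the basis
  of pairs (w, g), where w is a word in e_0..e_(n-1) (the tensor e_w1 ... e_wm) and g in S_n
  (the element e_w tensor g).\<close>
type_synonym basis = "nat list \<times> (nat \<Rightarrow> nat)"
type_synonym elt = "basis \<Rightarrow> complex"

definition supp :: "elt \<Rightarrow> basis set" where
  "supp f = {x. f x \<noteq> 0}"

definition valid_basis :: "nat \<Rightarrow> basis \<Rightarrow> bool" where
  "valid_basis n x \<longleftrightarrow> set (fst x) \<subseteq> {..<n} \<and> snd x \<in> Sym n"

definition bv :: "nat list \<Rightarrow> (nat \<Rightarrow> nat) \<Rightarrow> elt" where
  "bv w g = (\<lambda>x. if x = (w, g) then 1 else 0)"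

text \<open>Product of basis elements: (e_u tensor g)(e_v tensor h) = e_u (g . e_v) tensor gh, with
  g . e_v = e_(map g v) since sigma e_i = e_(sigma i).\<close>
definition bmult :: "basis \<Rightarrow> basis \<Rightarrow> basis" where
  "bmult x y = (fst x @ map (snd x) (fst y), snd x \<circ> snd y)"

definition emult :: "elt \<Rightarrow> elt \<Rightarrow> elt" (infixl "\<star>" 70) where
  "emult f h = (\<lambda>z. \<Sum>x\<in>supp f. \<Sum>y\<in>supp h. if bmult x y = z then f x * h y else 0)"

definition cspan :: "elt set \<Rightarrow> elt set" where
  "cspan S = {f. \<exists>F c. finite F \<and> F \<subseteq> S \<and> f = (\<lambda>z. \<Sum>v\<in>F. c v * v z)}"

definition ideal_gen :: "nat \<Rightarrow> elt set \<Rightarrow> elt set" where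
  "ideal_gen n R = cspan {bv (fst x) (snd x) \<star> r \<star> bv (fst y) (snd y) | x y r.
      valid_basis n x \<and> valid_basis n y \<and> r \<in> R}"

definition fdeg :: "elt \<Rightarrow> nat" where
  "fdeg f = Max {length (fst x) | x. f x \<noteq> 0}"

definition top :: "elt \<Rightarrow> elt" where
  "top f = (\<lambda>x. if length (fst x) = fdeg f then f x else 0)"

text \<open>A linear 2-cochain kL: kL g i j = vector kappa^L_g(e_i,e_j) (as coordinate function k to C);
  a constant one kC: kC g i j = kappa^C_g(e_i,e_j); only i < j < n, g in S_n matter.
  The defining relation e_i e_j - e_j e_i - kappa^L(e_i,e_j) - kappa^C(e_i,e_j).\<close>
definition rel :: "nat \<Rightarrow> ((nat \<Rightarrow> nat) \<Rightarrow> nat \<Rightarrow> nat \<Rightarrow> nat \<Rightarrow> complex)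
    \<Rightarrow> ((nat \<Rightarrow> nat) \<Rightarrow> nat \<Rightarrow> nat \<Rightarrow> complex) \<Rightarrow> nat \<Rightarrow> nat \<Rightarrow> elt" where
  "rel n kL kC i j = (\<lambda>z. bv [i, j] id z - bv [j, i] id z
      - (\<Sum>g\<in>Sym n. \<Sum>k<n. kL g i j k * bv [k] g z)
      - (\<Sum>g\<in>Sym n. kC g i j * bv [] g z))"

definition rel_ideal :: "nat \<Rightarrow> ((nat \<Rightarrow> nat) \<Rightarrow> nat \<Rightarrow> nat \<Rightarrow> nat \<Rightarrow> complex)
    \<Rightarrow> ((nat \<Rightarrow> nat) \<Rightarrow> nat \<Rightarrow> nat \<Rightarrow> complex) \<Rightarrow> elt set" where
  "rel_ideal n kL kC = ideal_gen n {rel n kL kC i j | i j. i < j \<and> j < n}"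

text \<open>The kernel of T(V)#G to S(V)#G.\<close>
definition comm_ideal :: "nat \<Rightarrow> elt set" where
  "comm_ideal n = ideal_gen n {(\<lambda>z. bv [i, j] id z - bv [j, i] id z) | i j. i < j \<and> j < n}"

text \<open>H_kappa is a Drinfeld orbifold algebra: its associated graded algebra
  gr(T(V)#G / I) = T(V)#G / gr I, with gr I spanned by top components of elements of I,
  equals S(V)#G = T(V)#G / (vw - wv).\<close>
definition DOA :: "nat \<Rightarrow> ((nat \<Rightarrow> nat) \<Rightarrow> nat \<Rightarrow> nat \<Rightarrow> nat \<Rightarrow> complex)
    \<Rightarrow> ((nat \<Rightarrow> nat) \<Rightarrow> nat \<Rightarrow> nat \<Rightarrow> complex) \<Rightarrow> bool" where
  "DOA n kL kC \<longleftrightarrow> cspan (top ` rel_ideal n kL kC) = comm_ideal n"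

definition ind :: "(nat \<Rightarrow> nat) \<Rightarrow> (nat \<Rightarrow> nat) \<Rightarrow> complex" where
  "ind g h = (if g = h then 1 else 0)"

text \<open>The family of the theorem (coefficient of e_k tensor g in kappa^L(e_i,e_j)).\<close>
definition kapL :: "nat \<Rightarrow> complex \<Rightarrow> complex \<Rightarrow> (nat \<Rightarrow> nat) \<Rightarrow> nat \<Rightarrow> nat \<Rightarrow> nat \<Rightarrow> complex" where
  "kapL n a b g i j k = (\<Sum>k'\<in>{..<n} - {i, j}.
      (if k \<in> {i, j, k'} then a else b) * (ind g (cyc3 i j k') - ind g (cyc3 k' j i)))"

definition kapC :: "nat \<Rightarrow> complex \<Rightarrow> complex \<Rightarrow> complex \<Rightarrow> (nat \<Rightarrow> nat) \<Rightarrow> nat \<Rightarrow> nat \<Rightarrow> complex" where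
  "kapC n a b c g i j =
     c * (\<Sum>k'\<in>{..<n} - {i, j}. ind g (cyc3 i j k') - ind g (cyc3 k' j i))
     + (a - b)^2 * ((\<Sum>\<sigma>\<in>{\<sigma>\<in>Sym n. is_kcycle n 5 \<sigma> \<and> \<sigma> (\<sigma> i) = j}. 2 * (ind g \<sigma> - ind g (inv \<sigma>)))
                   - (\<Sum>\<sigma>\<in>{\<sigma>\<in>Sym n. is_kcycle n 5 \<sigma> \<and> \<sigma> i = j}. ind g \<sigma> - ind g (inv \<sigma>)))"

definition fixed_image :: "nat \<Rightarrow> ((nat \<Rightarrow> nat) \<Rightarrow> nat \<Rightarrow> nat \<Rightarrow> nat \<Rightarrow> complex) \<Rightarrow> bool" where
  "fixed_image n kL \<longleftrightarrow> (\<forall>g\<in>Sym n. \<forall>i j. i < j \<and> j < n \<longrightarrow> (\<forall>k<n. kL g i j (g k) = kL g i j k))"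

definition off_identity :: "nat \<Rightarrow> ((nat \<Rightarrow> nat) \<Rightarrow> nat \<Rightarrow> nat \<Rightarrow> nat \<Rightarrow> complex) \<Rightarrow> bool" where
  "off_identity n kL \<longleftrightarrow> (\<forall>i j k. i < j \<and> j < n \<and> k < n \<longrightarrow> kL id i j k = 0)"

end

theory Submission
  imports Defs "HOL-Library.Function_Algebras"
begin

text \<open>
  Write \<open>\<kappa>\<close> for the alternating extension of the two cochains. Moving the group elements to the right
  turns the relations into the rewriting rules
  \<open>u e\<^sub>i e\<^sub>j v g \<rightarrow> u e\<^sub>j e\<^sub>i v g + u \<kappa>(e\<^sub>i, e\<^sub>j) v g\<close> for \<open>i > j\<close>. By the diamond lemma the PBW property
  is equivalent to invariance of \<open>\<kappa>\<close> together with the Jacobi identity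
  \<open>[\<kappa>(e\<^sub>i, e\<^sub>j), e\<^sub>k] + [\<kappa>(e\<^sub>j, e\<^sub>k), e\<^sub>i] + [\<kappa>(e\<^sub>k, e\<^sub>i), e\<^sub>j] = 0\<close>, which splits by degree into a quadratic, a
  linear and a constant condition.

  For the family of the theorem only pairs of 3-cycles whose product is a 5-cycle contribute to the
  linear condition, and a 5-cycle has exactly five factorizations into 3-cycles, so this condition
  is a finite check. The constant condition comes for free from a representation: let \<open>T\<^sub>i\<close> be the
  sum of all 3-cycles moving \<open>i\<close>. With \<open>d = a - b\<close> and a suitable scalar \<open>z\<close>, the elements
  \<open>X\<^sub>i = z + d T\<^sub>i\<close> of the group algebra satisfy the relations for \<open>b = 0\<close>, and the Jacobi identity for
  the \<open>X\<^sub>i\<close> kills the constant obstruction.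

  Conversely, the quadratic condition, together with \<open>g\<close> fixing the image of \<open>\<kappa>\<^sup>L\<^sub>g\<close>, forces
  \<open>\<kappa>\<^sup>L\<^sub>g(e\<^sub>i, e\<^sub>j) \<otimes> (g e\<^sub>k - e\<^sub>k)\<close> to have cyclic sum zero, so \<open>g\<close> moves at most four points if \<open>\<kappa>\<^sup>L\<^sub>g \<noteq> 0\<close>.
  Invariance then leaves only the 3-cycles. By the linear condition the difference of two admissible
  \<open>\<kappa>\<^sup>C\<close> for the same \<open>\<kappa>\<^sup>L\<close> satisfies the same equation, whence the single parameter \<open>c\<close>.
\<close>

section \<open>Symmetric groups\<close>

lemma finite_Sym [simp]: "finite (Sym n)"
  by (simp add: Sym_def finite_permutations)

lemma Sym_id [simp]: "id \<in> Sym n"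
  by (simp add: Sym_def permutes_id)

lemma Sym_comp [simp]: "g \<in> Sym n \<Longrightarrow> h \<in> Sym n \<Longrightarrow> g \<circ> h \<in> Sym n"
  by (simp add: Sym_def permutes_compose)

lemma Sym_inv [simp]: "g \<in> Sym n \<Longrightarrow> inv g \<in> Sym n"
  by (simp add: Sym_def permutes_inv)

lemma Sym_transpose: "x < n \<Longrightarrow> y < n \<Longrightarrow> transpose x y \<in> Sym n"
  by (simp add: Sym_def permutes_swap_id)

lemma Sym_bij: "g \<in> Sym n \<Longrightarrow> bij g"
  by (simp add: Sym_def permutes_bij)

lemma Sym_less_iff [simp]: "g \<in> Sym n \<Longrightarrow> g x < n \<longleftrightarrow> x < n"
  using permutes_in_image[of g "{..<n}" x] by (simp add: Sym_def)

lemma Sym_image_subset_iff [simp]: "g \<in> Sym n \<Longrightarrow> g ` X \<subseteq> {..<n} \<longleftrightarrow> X \<subseteq> {..<n}"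
  by (auto simp: image_subset_iff subset_iff)

lemma Sym_inv_apply [simp]: "g \<in> Sym n \<Longrightarrow> inv g (g x) = x" "g \<in> Sym n \<Longrightarrow> g (inv g x) = x"
  by (auto simp: Sym_def permutes_inverses)

lemma Sym_eq_iff [simp]: "g \<in> Sym n \<Longrightarrow> g x = g y \<longleftrightarrow> x = y"
  by (metis Sym_inv_apply(1))

lemma Sym_inv_comp [simp]: "g \<in> Sym n \<Longrightarrow> inv g \<circ> g = id" "g \<in> Sym n \<Longrightarrow> g \<circ> inv g = id"
  by (auto simp: fun_eq_iff)

lemma Sym_comp_inv_cancel [simp]:
  "g \<in> Sym n \<Longrightarrow> f \<circ> inv g \<circ> g = f" "g \<in> Sym n \<Longrightarrow> f \<circ> g \<circ> inv g = f"
  by (simp_all add: comp_assoc)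

lemma Sym_inv_inv [simp]: "g \<in> Sym n \<Longrightarrow> inv (inv g) = g"
  by (simp add: Sym_bij inv_inv_eq)

lemma Sym_inv_eq_iff: "g \<in> Sym n \<Longrightarrow> inv g x = y \<longleftrightarrow> x = g y"
  by auto

lemma Sym_inv_of_comp: "g \<in> Sym n \<Longrightarrow> h \<in> Sym n \<Longrightarrow> inv (g \<circ> h) = inv h \<circ> inv g"
  by (simp add: o_inv_distrib Sym_bij)

lemma Sym_unconjugate:
  "p \<in> Sym n \<Longrightarrow> inv p \<circ> (p \<circ> h \<circ> inv p) \<circ> p = h"
  "p \<in> Sym n \<Longrightarrow> p \<circ> (inv p \<circ> h \<circ> p) \<circ> inv p = h"
  by (simp_all add: fun_eq_iff)

lemma Sym_funpow: "g \<in> Sym n \<Longrightarrow> g ^^ t \<in> Sym n"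
  by (induction t) (simp_all add: id_def[symmetric])

lemma ex_Sym_map:
  assumes "length xs = length ys" "distinct xs" "distinct ys" "set xs \<subseteq> {..<n}" "set ys \<subseteq> {..<n}"
  shows "\<exists>p\<in>Sym n. map p xs = ys"
  using assms
proof (induction xs ys rule: list_induct2)
  case Nil
  show ?case by (auto intro: Sym_id)
next
  case (Cons x xs y ys)
  then obtain p where p: "p \<in> Sym n" "map p xs = ys" by auto
  let ?q = "transpose (p x) y \<circ> p"
  have "p z \<noteq> p x" "p z \<noteq> y" if "z \<in> set xs" for z
    using that Cons.prems p by auto
  then have "map ?q (x # xs) = y # ys"
    using p by auto
  moreover have "?q \<in> Sym n"
    using p Cons.prems by (intro Sym_comp Sym_transpose) auto
  ultimately show ?case by (rule bexI)
qed

lemma sum_Sym_comp_right: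
  "p \<in> Sym n \<Longrightarrow> (\<Sum>h\<in>Sym n. F h) = (\<Sum>h\<in>Sym n. F (h \<circ> p))"
  unfolding Sym_def by (rule sum_permutations_compose_right) simp

lemma sum_Sym_conjugate:
  assumes "p \<in> Sym n"
  shows "(\<Sum>h\<in>Sym n. F h) = (\<Sum>h\<in>Sym n. F (p \<circ> h \<circ> inv p))"
  by (rule sum.reindex_bij_witness[of _ "\<lambda>h. p \<circ> h \<circ> inv p" "\<lambda>h. inv p \<circ> h \<circ> p"])
     (use assms in \<open>simp_all add: Sym_unconjugate\<close>)

lemma sum_lessThan_permute: "p \<in> Sym n \<Longrightarrow> (\<Sum>k<n. F k) = (\<Sum>k<n. F (p k))"
  using sum.permute[of p "{..<n}" F] by (simp add: Sym_def comp_def)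

lemma sum_Sym_by_product:
  "(\<Sum>h\<in>Sym n. \<Sum>g\<in>Sym n. F g h) = (\<Sum>f\<in>Sym n. \<Sum>h\<in>Sym n. F (f \<circ> inv h) h)"
proof -
  have "(\<Sum>g\<in>Sym n. F g h) = (\<Sum>f\<in>Sym n. F (f \<circ> inv h) h)" if "h \<in> Sym n" for h
    using that by (intro sum_Sym_comp_right) simp
  then have "(\<Sum>h\<in>Sym n. \<Sum>g\<in>Sym n. F g h) = (\<Sum>h\<in>Sym n. \<Sum>f\<in>Sym n. F (f \<circ> inv h) h)"
    by simp
  also have "\<dots> = (\<Sum>f\<in>Sym n. \<Sum>h\<in>Sym n. F (f \<circ> inv h) h)"
    by (rule sum.swap)
  finally show ?thesis .
qed

section \<open>Cochains and the Jacobi identity\<close>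

lemma sum_of_bool_delta:
  "finite A \<Longrightarrow> x \<in> A \<Longrightarrow> (\<Sum>y\<in>A. of_bool (y = x) * F y) = (F x :: 'a :: semiring_1)"
  by (simp add: sum_of_bool_mult_eq Int_def conj_commute[of "_ \<in> A"] cong: conj_cong)

lemma sum_antisymmetric:
  fixes Q :: "'a \<Rightarrow> 'a \<Rightarrow> 'b :: comm_ring_1"
  assumes "\<And>x y. x \<in> A \<Longrightarrow> y \<in> A \<Longrightarrow> Q x y + Q y x = 0"
  shows "(\<Sum>x\<in>A. \<Sum>y\<in>A. Q x y * (F x y - F y x)) = 2 * (\<Sum>x\<in>A. \<Sum>y\<in>A. Q x y * F x y)"
proof -
  have "(\<Sum>x\<in>A. \<Sum>y\<in>A. Q x y * F y x) = (\<Sum>y\<in>A. \<Sum>x\<in>A. Q x y * F y x)"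
    by (rule sum.swap)
  also have "\<dots> = (\<Sum>y\<in>A. \<Sum>x\<in>A. - (Q y x * F y x))"
    by (intro sum.cong refl) (metis assms add_eq_0_iff2 minus_mult_left)
  finally show ?thesis
    by (simp add: right_diff_distrib sum_subtractf sum_negf)
qed

abbreviation cyclic_sum :: "(nat \<Rightarrow> nat \<Rightarrow> nat \<Rightarrow> 'a::plus) \<Rightarrow> nat \<Rightarrow> nat \<Rightarrow> nat \<Rightarrow> 'a" where
  "cyclic_sum F i j k \<equiv> F i j k + F j k i + F k i j"

definition short_words :: "nat \<Rightarrow> nat list set" where
  "short_words n = {w. set w \<subseteq> {..<n} \<and> length w \<le> 1}"

lemma short_words_eq: "short_words n = insert [] ((\<lambda>k. [k]) ` {..<n})"
  by (auto simp: short_words_def length_Suc_conv le_Suc_eq)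

lemma finite_short_words [simp]: "finite (short_words n)"
  by (simp add: short_words_eq)

lemma short_words_simps [simp]: "[] \<in> short_words n" "[k] \<in> short_words n \<longleftrightarrow> k < n"
  by (auto simp: short_words_def)

lemma sum_short_words: "(\<Sum>w\<in>short_words n. F w) = F [] + (\<Sum>k<n. F [k])"
  unfolding short_words_eq by (subst sum.insert) (auto simp: sum.reindex inj_on_def)

lemma sum_short_words_map:
  assumes "p \<in> Sym n"
  shows "(\<Sum>w\<in>short_words n. F w) = (\<Sum>w\<in>short_words n. F (map p w))"
  using sum_lessThan_permute[OF assms, of "\<lambda>k. F [k]"] by (simp add: sum_short_words)

text \<open>A functional on the skew group algebra is given by its values \<open>P w g\<close> on the basis \<open>e\<^sub>w \<otimes> g\<close>.
  A cochain \<open>\<kappa>\<close> is given by the coefficients \<open>\<kappa> g i j w\<close> of \<open>e\<^sub>w \<otimes> g\<close> in \<open>\<kappa>(e\<^sub>i, e\<^sub>j)\<close>; words \<open>w\<close> of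
  length one describe its linear part and the empty word its constant part. Below, \<open>bracket P u i j v g\<close>
  is the value of \<open>P\<close> on \<open>e\<^sub>u \<kappa>(e\<^sub>i, e\<^sub>j) e\<^sub>v g\<close> and \<open>jacobiator P\<close> is its value on the cyclic sum of the
  commutators \<open>[\<kappa>(e\<^sub>i, e\<^sub>j), e\<^sub>k]\<close>.\<close>

type_synonym functional = "nat list \<Rightarrow> (nat \<Rightarrow> nat) \<Rightarrow> complex"
type_synonym cochain = "(nat \<Rightarrow> nat) \<Rightarrow> nat \<Rightarrow> nat \<Rightarrow> nat list \<Rightarrow> complex"

locale alternating_cochain =
  fixes n :: nat and \<kappa> :: cochain
  assumes alternating: "\<kappa> g j i w = - \<kappa> g i j w"
begin

definition bracket :: "functional \<Rightarrow> nat list \<Rightarrow> nat \<Rightarrow> nat \<Rightarrow> nat list \<Rightarrow> (nat \<Rightarrow> nat) \<Rightarrow> complex" where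
  "bracket P u i j v g = (\<Sum>h\<in>Sym n. \<Sum>w\<in>short_words n. \<kappa> h i j w * P (u @ w @ map h v) (h \<circ> g))"

definition jacobiator :: "functional \<Rightarrow> nat \<Rightarrow> nat \<Rightarrow> nat \<Rightarrow> complex" where
  "jacobiator P = cyclic_sum (\<lambda>i j k. bracket P [] i j [k] id - bracket P [k] i j [] id)"

text \<open>\<open>jacobi_quadratic i j k h m l\<close> is the coefficient of \<open>e\<^sub>m e\<^sub>l h\<close> in the same cyclic sum. If these
  coefficients are antisymmetric in \<open>m\<close> and \<open>l\<close>, then the quadratic part can be reduced with the
  relations, and \<open>jacobi_lower i j k f w\<close> is twice the coefficient of \<open>e\<^sub>w f\<close> in the result.\<close>

definition jacobi_quadratic :: "nat \<Rightarrow> nat \<Rightarrow> nat \<Rightarrow> (nat \<Rightarrow> nat) \<Rightarrow> nat \<Rightarrow> nat \<Rightarrow> complex" where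
  "jacobi_quadratic i j k h m l =
     cyclic_sum (\<lambda>i j k. \<kappa> h i j [m] * of_bool (l = h k) - of_bool (m = k) * \<kappa> h i j [l]) i j k"

definition jacobi_lower :: "nat \<Rightarrow> nat \<Rightarrow> nat \<Rightarrow> (nat \<Rightarrow> nat) \<Rightarrow> nat list \<Rightarrow> complex" where
  "jacobi_lower i j k f w = cyclic_sum (\<lambda>i j k.
       (\<Sum>h\<in>Sym n. \<Sum>m<n. \<kappa> h i j [m] * (\<kappa> (f \<circ> inv h) m (h k) w + \<kappa> (f \<circ> inv h) m k w))
     + 2 * \<kappa> f i j [] * (of_bool (w = [f k]) - of_bool (w = [k]))) i j k"

lemma bracket_alternating: "bracket P u j i v g = - bracket P u i j v g"
  unfolding bracket_def by (subst alternating) (simp add: sum_negf)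

lemma bracket_commutator:
  "bracket P [] i j [k] id - bracket P [k] i j [] id =
     (\<Sum>h\<in>Sym n. \<Sum>m<n. \<kappa> h i j [m] * (P [m, h k] h - P [k, m] h))
   + (\<Sum>h\<in>Sym n. \<kappa> h i j [] * (P [h k] h - P [k] h))"
  by (simp add: bracket_def sum_short_words sum.distrib sum_subtractf right_diff_distrib)

lemma sum_jacobi_quadratic:
  assumes "h \<in> Sym n" "i < n" "j < n" "k < n"
  shows "(\<Sum>m<n. \<Sum>l<n. jacobi_quadratic i j k h m l * F m l) =
    cyclic_sum (\<lambda>i j k. \<Sum>m<n. \<kappa> h i j [m] * (F m (h k) - F k m)) i j k"
proof -
  have "(\<Sum>m<n. \<Sum>l<n. (\<kappa> h i j [m] * of_bool (l = h k) - of_bool (m = k) * \<kappa> h i j [l]) * F m l)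
      = (\<Sum>m<n. \<kappa> h i j [m] * (F m (h k) - F k m))" if "k < n" for i j k
  proof -
    have "(\<Sum>m<n. \<Sum>l<n. \<kappa> h i j [m] * of_bool (l = h k) * F m l) = (\<Sum>m<n. \<kappa> h i j [m] * F m (h k))"
      using assms(1) that by (simp add: mult.assoc sum_distrib_left[symmetric] sum_of_bool_delta)
    moreover have "(\<Sum>m<n. \<Sum>l<n. of_bool (m = k) * \<kappa> h i j [l] * F m l) = (\<Sum>l<n. \<kappa> h i j [l] * F k l)"
      using that by (simp add: mult.assoc sum_distrib_left[symmetric] sum_of_bool_delta)
    ultimately show ?thesis
      by (simp add: left_diff_distrib right_diff_distrib sum_subtractf)
  qed
  from this[of k i j] this[of i j k] this[of j k i] show ?thesis
    using assms(2-4) by (simp add: jacobi_quadratic_def distrib_right sum.distrib)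
qed

lemma jacobiator_eq:
  assumes "i < n" "j < n" "k < n"
  shows "jacobiator P i j k = (\<Sum>h\<in>Sym n. \<Sum>m<n. \<Sum>l<n. jacobi_quadratic i j k h m l * P [m, l] h)
    + cyclic_sum (\<lambda>i j k. \<Sum>h\<in>Sym n. \<kappa> h i j [] * (P [h k] h - P [k] h)) i j k"
proof -
  have "(\<Sum>h\<in>Sym n. \<Sum>m<n. \<Sum>l<n. jacobi_quadratic i j k h m l * P [m, l] h)
      = (\<Sum>h\<in>Sym n. cyclic_sum (\<lambda>i j k. \<Sum>m<n. \<kappa> h i j [m] * (P [m, h k] h - P [k, m] h)) i j k)"
    using assms by (intro sum.cong refl sum_jacobi_quadratic)
  then show ?thesis
    by (simp add: jacobiator_def bracket_commutator sum.distrib)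
qed

lemma sum_bracket_difference:
  "(\<Sum>h\<in>Sym n. \<Sum>m<n. \<kappa> h i j [m] * (bracket P [] m (h k) [] h - bracket P [] k m [] h)) =
   (\<Sum>f\<in>Sym n. \<Sum>w\<in>short_words n.
      (\<Sum>h\<in>Sym n. \<Sum>m<n. \<kappa> h i j [m] * (\<kappa> (f \<circ> inv h) m (h k) w + \<kappa> (f \<circ> inv h) m k w)) * P w f)"
proof -
  define A where "A g h w = (\<Sum>m<n. \<kappa> h i j [m] * (\<kappa> g m (h k) w + \<kappa> g m k w))" for g h w
  have "(\<Sum>m<n. \<kappa> h i j [m] * (bracket P [] m (h k) [] h - bracket P [] k m [] h))
      = (\<Sum>g\<in>Sym n. \<Sum>w\<in>short_words n. A g h w * P w (g \<circ> h))" for h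
  proof -
    have "bracket P [] m (h k) [] h - bracket P [] k m [] h
        = (\<Sum>g\<in>Sym n. \<Sum>w\<in>short_words n. (\<kappa> g m (h k) w + \<kappa> g m k w) * P w (g \<circ> h))" for m
      by (subst bracket_alternating) (simp add: bracket_def sum.distrib distrib_right)
    then show ?thesis
      by (simp add: A_def sum_distrib_left sum_distrib_right mult.assoc
          sum.swap[of _ "{..<n}" "Sym n"] sum.swap[of _ "{..<n}" "short_words n"])
  qed
  then have "(\<Sum>h\<in>Sym n. \<Sum>m<n. \<kappa> h i j [m] * (bracket P [] m (h k) [] h - bracket P [] k m [] h))
      = (\<Sum>h\<in>Sym n. \<Sum>g\<in>Sym n. \<Sum>w\<in>short_words n. A g h w * P w (g \<circ> h))" by simp
  also have "\<dots> = (\<Sum>f\<in>Sym n. \<Sum>h\<in>Sym n. \<Sum>w\<in>short_words n. A (f \<circ> inv h) h w * P w (f \<circ> inv h \<circ> h))"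
    by (rule sum_Sym_by_product)
  also have "\<dots> = (\<Sum>f\<in>Sym n. \<Sum>w\<in>short_words n. (\<Sum>h\<in>Sym n. A (f \<circ> inv h) h w) * P w f)"
    by (simp add: sum_distrib_right sum.swap[of _ "Sym n" "short_words n"] cong: sum.cong)
  finally show ?thesis by (simp only: A_def)
qed

lemma sum_constant_difference:
  assumes "k < n"
  shows "(\<Sum>h\<in>Sym n. \<kappa> h i j [] * (P [h k] h - P [k] h)) =
    (\<Sum>f\<in>Sym n. \<Sum>w\<in>short_words n. \<kappa> f i j [] * (of_bool (w = [f k]) - of_bool (w = [k])) * P w f)"
proof (intro sum.cong refl)
  fix f assume "f \<in> Sym n"
  then have "(\<Sum>w\<in>short_words n. of_bool (w = [f k]) * P w f) = P [f k] f"
    and "(\<Sum>w\<in>short_words n. of_bool (w = [k]) * P w f) = P [k] f"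
    using assms by (simp_all add: sum_of_bool_delta)
  then show "\<kappa> f i j [] * (P [f k] f - P [k] f) =
      (\<Sum>w\<in>short_words n. \<kappa> f i j [] * (of_bool (w = [f k]) - of_bool (w = [k])) * P w f)"
    by (simp add: mult.assoc left_diff_distrib sum_distrib_left[symmetric] sum_subtractf)
qed

lemma jacobi_identity:
  assumes antisym: "\<And>h m l. h \<in> Sym n \<Longrightarrow> m < n \<Longrightarrow> l < n \<Longrightarrow>
      jacobi_quadratic i j k h m l + jacobi_quadratic i j k h l m = 0"
    and ijk: "i < n" "j < n" "k < n"
  shows "2 * jacobiator P i j k =
      (\<Sum>h\<in>Sym n. \<Sum>m<n. \<Sum>l<n. jacobi_quadratic i j k h m l *
        (P [m, l] h - P [l, m] h - bracket P [] m l [] h))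
    + (\<Sum>f\<in>Sym n. \<Sum>w\<in>short_words n. jacobi_lower i j k f w * P w f)"
proof -
  let ?Q = "jacobi_quadratic i j k"
  define A where "A = (\<Sum>h\<in>Sym n. \<Sum>m<n. \<Sum>l<n. ?Q h m l * P [m, l] h)"
  define B where "B = (\<Sum>h\<in>Sym n. \<Sum>m<n. \<Sum>l<n. ?Q h m l * bracket P [] m l [] h)"
  define C where "C = cyclic_sum (\<lambda>i j k. \<Sum>h\<in>Sym n. \<kappa> h i j [] * (P [h k] h - P [k] h)) i j k"
  have "(\<Sum>m<n. \<Sum>l<n. ?Q h m l * (P [m, l] h - P [l, m] h)) = 2 * (\<Sum>m<n. \<Sum>l<n. ?Q h m l * P [m, l] h)"
    if "h \<in> Sym n" for h
    using antisym[OF that] by (intro sum_antisymmetric) simp_all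
  then have "2 * A = (\<Sum>h\<in>Sym n. \<Sum>m<n. \<Sum>l<n. ?Q h m l * (P [m, l] h - P [l, m] h))"
    by (simp add: A_def sum_distrib_left)
  then have "(\<Sum>h\<in>Sym n. \<Sum>m<n. \<Sum>l<n. ?Q h m l * (P [m, l] h - P [l, m] h - bracket P [] m l [] h))
      = 2 * A - B"
    by (simp add: B_def sum_subtractf right_diff_distrib)
  moreover have "jacobiator P i j k = A + C"
    unfolding A_def C_def using ijk by (rule jacobiator_eq)
  moreover have "(\<Sum>f\<in>Sym n. \<Sum>w\<in>short_words n. jacobi_lower i j k f w * P w f) = B + 2 * C"
  proof -
    have "B = cyclic_sum (\<lambda>i j k. \<Sum>h\<in>Sym n. \<Sum>m<n. \<kappa> h i j [m] *
        (bracket P [] m (h k) [] h - bracket P [] k m [] h)) i j k"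
      unfolding B_def using sum_jacobi_quadratic[of _ i j k "\<lambda>m l. bracket P [] m l [] _"] ijk
      by (simp add: sum.distrib)
    then show ?thesis
      unfolding C_def sum_bracket_difference jacobi_lower_def
      by (simp add: sum_constant_difference ijk sum.distrib distrib_right distrib_left
          sum_distrib_left mult.assoc)
  qed
  ultimately show ?thesis by simp
qed

definition exchanges :: "functional \<Rightarrow> nat list \<Rightarrow> nat \<Rightarrow> nat \<Rightarrow> nat list \<Rightarrow> (nat \<Rightarrow> nat) \<Rightarrow> bool" where
  "exchanges P u i j v g \<longleftrightarrow> P (u @ i # j # v) g - P (u @ j # i # v) g = bracket P u i j v g"

lemma exchanges_commute: "exchanges P u i j v g \<longleftrightarrow> exchanges P u j i v g"
  unfolding exchanges_def bracket_alternating[of P u i j] by (auto simp: algebra_simps)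

lemma exchanges_refl: "exchanges P u i i v g"
  using bracket_alternating[of P u i i v g] by (simp add: exchanges_def)

lemma jacobiator_eq_0_if_exchanges:
  assumes "\<And>u i j v. set (u @ i # j # v) \<subseteq> {..<n} \<Longrightarrow> exchanges P u i j v id" and "i < n" "j < n" "k < n"
  shows "jacobiator P i j k = 0"
proof -
  have "bracket P [] i j [k] id - bracket P [k] i j [] id
      = P [i, j, k] id - P [j, i, k] id - (P [k, i, j] id - P [k, j, i] id)"
    if "i < n" "j < n" "k < n" for i j k
    using assms(1)[of "[]" i j "[k]"] assms(1)[of "[k]" i j "[]"] that by (simp add: exchanges_def)
  then show ?thesis using assms(2-4) by (simp add: jacobiator_def)
qed

end

section \<open>Normal forms and the diamond lemma\<close>

fun inversions :: "nat list \<Rightarrow> nat" where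
  "inversions [] = 0"
| "inversions (x # xs) = length (filter (\<lambda>y. y < x) xs) + inversions xs"

lemma inversions_swap: "j < i \<Longrightarrow> inversions (u @ j # i # v) < inversions (u @ i # j # v)"
  by (induction u) auto

fun first_descent :: "nat list \<Rightarrow> (nat list \<times> nat \<times> nat \<times> nat list) option" where
  "first_descent (x # y # w) = (if y < x then Some ([], x, y, w)
     else map_option (\<lambda>(u, i, j, v). (x # u, i, j, v)) (first_descent (y # w)))"
| "first_descent _ = None"

lemma first_descent_None: "first_descent w = None \<longleftrightarrow> sorted w"
proof (induction w rule: first_descent.induct)
  case (1 x y w)
  then show ?case by (auto simp: sorted2 split: if_splits)
qed auto

lemma first_descent_Some:
  "first_descent w = Some (u, i, j, v) \<Longrightarrow> w = u @ i # j # v \<and> j < i \<and> sorted (u @ [i])"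
proof (induction w arbitrary: u rule: first_descent.induct)
  case (1 x y w)
  show ?case
  proof (cases "y < x")
    case True
    with 1 show ?thesis by simp
  next
    case False
    with "1.prems" obtain u' where u': "u = x # u'" "first_descent (y # w) = Some (u', i, j, v)"
      by auto
    from "1.IH"[OF False this(2)] False u' show ?thesis
      by (cases u') auto
  qed
qed auto

lemma first_descent_least:
  assumes "first_descent (u @ i # j # v) = Some (u', i', j', v')" "j < i"
  shows "(u' = u \<and> i' = i \<and> j' = j \<and> v' = v) \<or> (u = u' @ [i'] \<and> i = j' \<and> v' = j # v)
     \<or> (\<exists>t. u = u' @ i' # j' # t \<and> v' = t @ i # j # v)"
proof -
  from first_descent_Some[OF assms(1)]
  have eq: "u @ i # j # v = u' @ i' # j' # v'" and "j' < i'" and sorted: "sorted (u' @ [i'])" by auto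
  have "\<not> length u < length u'"
  proof
    assume less: "length u < length u'"
    have "(u' @ [i']) ! length u = i" "(u' @ [i']) ! Suc (length u) = j"
    proof -
      have "(u' @ i' # j' # v') ! length u = i" "(u' @ i' # j' # v') ! Suc (length u) = j"
        unfolding eq[symmetric] by (auto simp: nth_append)
      then show "(u' @ [i']) ! length u = i" "(u' @ [i']) ! Suc (length u) = j"
        using less by (auto simp: nth_append less_Suc_eq split: if_splits)
    qed
    moreover have "(u' @ [i']) ! length u \<le> (u' @ [i']) ! Suc (length u)"
      by (rule sorted_nth_mono[OF sorted]) (use less in auto)
    ultimately show False using assms(2) by simp
  qed
  then obtain s where s: "u = u' @ s" "s @ i # j # v = i' # j' # v'"
    using eq by (metis append_eq_append_conv_if append_take_drop_id linorder_not_less)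
  then show ?thesis
    by (cases s rule: first_descent.cases) auto
qed

lemma sort_swap: "sort (u @ j # i # v) = sort (u @ i # j # (v::nat list))"
  by (rule properties_for_sort) (auto simp: ac_simps)

context alternating_cochain
begin

text \<open>The coefficient of the basis element \<open>z\<close> in the normal form of \<open>e\<^sub>w \<otimes> g\<close>.\<close>

function normal_coeff :: "basis \<Rightarrow> functional" where
  "normal_coeff z w g = (case first_descent w of None \<Rightarrow> of_bool (z = (w, g))
     | Some (u, i, j, v) \<Rightarrow> normal_coeff z (u @ j # i # v) g +
         (\<Sum>h\<in>Sym n. \<Sum>s\<in>short_words n. \<kappa> h i j s * normal_coeff z (u @ s @ map h v) (h \<circ> g)))"
  by pat_completeness auto
termination
  by (relation "measures [\<lambda>(z, w, g). length w, \<lambda>(z, w, g). inversions w]")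
     (auto dest!: first_descent_Some simp: inversions_swap short_words_def)

declare normal_coeff.simps [simp del]

lemma normal_coeff_sorted: "sorted w \<Longrightarrow> normal_coeff z w g = of_bool (z = (w, g))"
  by (subst normal_coeff.simps) (use first_descent_None[of w] in auto)

lemma normal_coeff_descent:
  "first_descent w = Some (u, i, j, v) \<Longrightarrow>
     normal_coeff z w g = normal_coeff z (u @ j # i # v) g + bracket (normal_coeff z) u i j v g"
  by (subst normal_coeff.simps) (simp add: bracket_def)

lemma bracket_eq_0_if_short:
  assumes "\<And>w g. length w \<le> length u + length v + 1 \<Longrightarrow> P w g = 0"
  shows "bracket P u i j v g = 0"
  unfolding bracket_def by (intro sum.neutral ballI) (auto simp: short_words_def intro!: assms)

lemma normal_coeff_longer: "length w < length (fst z) \<Longrightarrow> normal_coeff z w g = 0"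
proof (induction w arbitrary: g
    rule: wf_induct[OF wf_measures[of "[length, inversions]"], case_names less])
  case (less w)
  show ?case
  proof (cases "first_descent w")
    case None
    with less show ?thesis by (auto simp: normal_coeff_sorted first_descent_None)
  next
    case (Some d)
    obtain u i j v where d: "d = (u, i, j, v)" by (cases d)
    with Some first_descent_Some have w: "w = u @ i # j # v" and ji: "j < i" by blast+
    have "normal_coeff z (u @ j # i # v) g = 0"
      using less ji w by (simp add: inversions_swap)
    moreover have "bracket (normal_coeff z) u i j v g = 0"
      using less w by (intro bracket_eq_0_if_short) simp
    ultimately show ?thesis
      using normal_coeff_descent[OF Some[unfolded d], of z g] by simp
  qed
qed

lemma normal_coeff_same_length:
  "length w = length (fst z) \<Longrightarrow> normal_coeff z w g = of_bool (z = (sort w, g))"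
proof (induction w rule: measure_induct_rule[of inversions])
  case (less w)
  show ?case
  proof (cases "first_descent w")
    case None
    then have "sorted w" by (simp add: first_descent_None)
    then show ?thesis by (simp add: normal_coeff_sorted sorted_sort_id)
  next
    case (Some d)
    obtain u i j v where d: "d = (u, i, j, v)" by (cases d)
    with Some first_descent_Some have w: "w = u @ i # j # v" and ji: "j < i" by blast+
    have "normal_coeff z (u @ j # i # v) g = of_bool (z = (sort w, g))"
      using less ji by (simp add: w inversions_swap sort_swap[of u j i v])
    moreover have "bracket (normal_coeff z) u i j v g = 0"
      using less.prems w by (intro bracket_eq_0_if_short normal_coeff_longer) simp
    ultimately show ?thesis
      using normal_coeff_descent[OF Some[unfolded d], of z g] by simp
  qed
qed

end

locale pbw_cochain = alternating_cochain +
  assumes invariant: "\<lbrakk>p \<in> Sym n; h \<in> Sym n; i < n; j < n; w \<in> short_words n\<rbrakk>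
      \<Longrightarrow> \<kappa> (p \<circ> h \<circ> inv p) (p i) (p j) (map p w) = \<kappa> h i j w"
    and jacobi_quadratic_antisym: "\<lbrakk>i < n; j < n; k < n; distinct [i, j, k]; h \<in> Sym n; m < n; l < n\<rbrakk>
      \<Longrightarrow> jacobi_quadratic i j k h m l + jacobi_quadratic i j k h l m = 0"
    and jacobi_lower_eq_0: "\<lbrakk>i < n; j < n; k < n; distinct [i, j, k]; f \<in> Sym n; w \<in> short_words n\<rbrakk>
      \<Longrightarrow> jacobi_lower i j k f w = 0"
begin

lemma bracket_permute:
  assumes p: "p \<in> Sym n" and "i < n" "j < n"
  shows "bracket P u (p i) (p j) (map p v) (p \<circ> g) =
    (\<Sum>h\<in>Sym n. \<Sum>w\<in>short_words n. \<kappa> h i j w * P (u @ map p w @ map p (map h v)) (p \<circ> (h \<circ> g)))"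
proof -
  define E where "E h w = \<kappa> h (p i) (p j) w * P (u @ w @ map h (map p v)) (h \<circ> (p \<circ> g))" for h w
  have "bracket P u (p i) (p j) (map p v) (p \<circ> g) = (\<Sum>h\<in>Sym n. \<Sum>w\<in>short_words n. E h w)"
    by (simp add: bracket_def E_def)
  also have "\<dots> = (\<Sum>h\<in>Sym n. \<Sum>w\<in>short_words n. E (p \<circ> h \<circ> inv p) w)"
    by (rule sum_Sym_conjugate[OF p])
  also have "\<dots> = (\<Sum>h\<in>Sym n. \<Sum>w\<in>short_words n. E (p \<circ> h \<circ> inv p) (map p w))"
    by (intro sum.cong refl sum_short_words_map[OF p])
  also have "\<dots> = (\<Sum>h\<in>Sym n. \<Sum>w\<in>short_words n. \<kappa> h i j w *
      P (u @ map p w @ map p (map h v)) (p \<circ> (h \<circ> g)))"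
  proof (intro sum.cong refl)
    fix h w assume "h \<in> Sym n" "w \<in> short_words n"
    then have "\<kappa> (p \<circ> h \<circ> inv p) (p i) (p j) (map p w) = \<kappa> h i j w"
      by (intro invariant assms)
    moreover have "p \<circ> h \<circ> inv p \<circ> (p \<circ> g) = p \<circ> (h \<circ> g)"
      "map (p \<circ> h \<circ> inv p) (map p v) = map p (map h v)"
      using p by (auto simp: fun_eq_iff)
    ultimately show "E (p \<circ> h \<circ> inv p) (map p w)
        = \<kappa> h i j w * P (u @ map p w @ map p (map h v)) (p \<circ> (h \<circ> g))"
      by (simp only: E_def)
  qed
  finally show ?thesis .
qed

lemma bracket_disjoint:
  assumes left: "\<And>h s. h \<in> Sym n \<Longrightarrow> s \<in> short_words n \<Longrightarrow>
      exchanges P (u @ s @ map h t) (h i) (h j) (map h v) (h \<circ> g)"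
    and right: "\<And>h s. h \<in> Sym n \<Longrightarrow> s \<in> short_words n \<Longrightarrow> exchanges P u i' j' (t @ s @ map h v) (h \<circ> g)"
    and ij: "i < n" "j < n"
  shows "bracket P u i' j' (t @ i # j # v) g - bracket P u i' j' (t @ j # i # v) g =
     bracket P (u @ i' # j' # t) i j v g - bracket P (u @ j' # i' # t) i j v g"
proof -
  let ?W = "short_words n"
  define E where "E h s h' s' = \<kappa> h i' j' s * \<kappa> h' i j s' *
      P (u @ s @ map h t @ map h s' @ map h (map h' v)) (h \<circ> (h' \<circ> g))" for h s h' s'
  have "bracket P u i' j' (t @ i # j # v) g - bracket P u i' j' (t @ j # i # v) g
    = (\<Sum>h\<in>Sym n. \<Sum>s\<in>?W. \<kappa> h i' j' s * bracket P (u @ s @ map h t) (h i) (h j) (map h v) (h \<circ> g))"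
    unfolding bracket_def[of P u i' j'] sum_subtractf[symmetric] right_diff_distrib[symmetric]
    using left by (intro sum.cong refl) (simp add: exchanges_def)
  also have "\<dots> = (\<Sum>h\<in>Sym n. \<Sum>s\<in>?W. \<Sum>h'\<in>Sym n. \<Sum>s'\<in>?W. E h s h' s')"
    using ij by (intro sum.cong refl) (simp add: E_def bracket_permute sum_distrib_left mult.assoc)
  also have "\<dots> = (\<Sum>x\<in>Sym n \<times> ?W. \<Sum>y\<in>Sym n \<times> ?W. E (fst x) (snd x) (fst y) (snd y))"
    by (simp add: sum.cartesian_product')
  also have "\<dots> = (\<Sum>y\<in>Sym n \<times> ?W. \<Sum>x\<in>Sym n \<times> ?W. E (fst x) (snd x) (fst y) (snd y))"
    by (rule sum.swap)
  also have "\<dots> = (\<Sum>h'\<in>Sym n. \<Sum>s'\<in>?W. \<Sum>h\<in>Sym n. \<Sum>s\<in>?W. E h s h' s')"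
    by (simp add: sum.cartesian_product')
  also have "\<dots> = (\<Sum>h'\<in>Sym n. \<Sum>s'\<in>?W. \<kappa> h' i j s' * bracket P u i' j' (t @ s' @ map h' v) (h' \<circ> g))"
    unfolding bracket_def[of P u i' j'] E_def by (simp add: sum_distrib_left mult_ac)
  also have "\<dots> = bracket P (u @ i' # j' # t) i j v g - bracket P (u @ j' # i' # t) i j v g"
    unfolding bracket_def[of P "u @ i' # j' # t"] bracket_def[of P "u @ j' # i' # t"]
      sum_subtractf[symmetric] right_diff_distrib[symmetric]
    using right by (intro sum.cong refl) (simp add: exchanges_def)
  finally show ?thesis .
qed

lemma bracket_overlap:
  assumes exch: "\<And>h m l. h \<in> Sym n \<Longrightarrow> m < n \<Longrightarrow> l < n \<Longrightarrow> exchanges P u m l (map h v) (h \<circ> g)"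
    and ijk: "i < n" "j < n" "k < n" "distinct [i, j, k]"
  shows "cyclic_sum (\<lambda>i j k. bracket P u i j (k # v) g - bracket P (u @ [k]) i j v g) i j k = 0"
proof -
  define P' where "P' w h = P (u @ w @ map h v) (h \<circ> g)" for w h
  have "bracket P' [] m l [] h = bracket P u m l (map h v) (h \<circ> g)" for m l h
    by (simp add: bracket_def P'_def comp_assoc)
  then have "P' [m, l] h - P' [l, m] h - bracket P' [] m l [] h = 0"
    if "h \<in> Sym n" "m < n" "l < n" for h m l
    using exch[OF that] by (simp add: exchanges_def P'_def)
  then have "2 * jacobiator P' i j k = 0"
    using jacobi_identity[of i j k P'] ijk jacobi_quadratic_antisym jacobi_lower_eq_0 by simp
  then have "jacobiator P' i j k = 0" by simp
  then show ?thesis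
    by (simp add: jacobiator_def bracket_def P'_def)
qed

text \<open>Five sides of the hexagon of rearrangements of \<open>e\<^sub>i e\<^sub>j e\<^sub>k\<close> imply the sixth.\<close>

lemma exchanges_hexagon:
  assumes "exchanges P u i j (k # v) g" "exchanges P (u @ [j]) i k v g" "exchanges P u j k (i # v) g"
    and "exchanges P u i k (j # v) g" "exchanges P (u @ [k]) i j v g"
    and "\<And>h m l. h \<in> Sym n \<Longrightarrow> m < n \<Longrightarrow> l < n \<Longrightarrow> exchanges P u m l (map h v) (h \<circ> g)"
    and "i < n" "j < n" "k < n" "distinct [i, j, k]"
  shows "exchanges P (u @ [i]) j k v g"
  using assms(1-5) bracket_overlap[OF assms(6-10)]
    bracket_alternating[of P u k i "j # v" g] bracket_alternating[of P "u @ [j]" k i v g]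
  by (simp add: exchanges_def) (simp add: algebra_simps add_eq_0_iff)

text \<open>Three sides of the square of two commuting exchanges imply the fourth.\<close>

lemma exchanges_square:
  assumes "exchanges P u i' j' (t @ i # j # v) g" "exchanges P u i' j' (t @ j # i # v) g"
    and "exchanges P (u @ j' # i' # t) i j v g"
    and "\<And>h s. h \<in> Sym n \<Longrightarrow> s \<in> short_words n
        \<Longrightarrow> exchanges P (u @ s @ map h t) (h i) (h j) (map h v) (h \<circ> g)"
    and "\<And>h s. h \<in> Sym n \<Longrightarrow> s \<in> short_words n \<Longrightarrow> exchanges P u i' j' (t @ s @ map h v) (h \<circ> g)"
    and "i < n" "j < n"
  shows "exchanges P (u @ i' # j' # t) i j v g"
  using assms(1-3) bracket_disjoint[OF assms(4-7)]
  by (simp add: exchanges_def) (simp add: algebra_simps)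

definition exchanges_below :: "functional \<Rightarrow> nat list \<Rightarrow> bool" where
  "exchanges_below P w \<longleftrightarrow> (\<forall>u i j v g. j < i \<and> set (u @ i # j # v) \<subseteq> {..<n} \<and> g \<in> Sym n \<and>
     (u @ i # j # v, w) \<in> measures [length, inversions] \<longrightarrow> exchanges P u i j v g)"

lemma exchanges_below_same_length:
  assumes "exchanges_below P w"
    and "length (u @ i # j # v) = length w" "inversions (u @ i # j # v) < inversions w"
    and "j < i" "set (u @ i # j # v) \<subseteq> {..<n}" "g \<in> Sym n"
  shows "exchanges P u i j v g"
  using assms by (simp add: exchanges_below_def)

lemma exchanges_below_shorter:
  assumes below: "exchanges_below P w" and length: "length (u @ i # j # v) < length w"
    and valid: "set (u @ i # j # v) \<subseteq> {..<n}" "g \<in> Sym n"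
  shows "exchanges P u i j v g"
proof -
  have "exchanges P u i j v g"
    if "j < i" "set (u @ i # j # v) \<subseteq> {..<n}" "length (u @ i # j # v) < length w" for i j
    using below valid(2) that by (simp add: exchanges_below_def)
  from this[of j i] this[of i j] length valid(1) show ?thesis
    by (cases i j rule: linorder_cases) (auto simp: exchanges_refl exchanges_commute[of P u i j])
qed

lemma exchanges_overlap:
  assumes below: "exchanges_below P (u @ i # j # k # v)" and first: "exchanges P u i j (k # v) g"
    and less: "k < j" "j < i" and valid: "set (u @ i # j # k # v) \<subseteq> {..<n}" "g \<in> Sym n"
  shows "exchanges P (u @ [i]) j k v g"
proof (rule exchanges_hexagon[OF first])
  have "inversions (u @ j # i # k # v) < inversions (u @ i # j # k # v)"
    "inversions (u @ j # k # i # v) < inversions (u @ j # i # k # v)"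
    "inversions (u @ i # k # j # v) < inversions (u @ i # j # k # v)"
    "inversions (u @ k # i # j # v) < inversions (u @ i # k # j # v)"
    using less inversions_swap[of j i u "k # v"] inversions_swap[of k i "u @ [j]" v]
      inversions_swap[of k j "u @ [i]" v] inversions_swap[of k i u "j # v"] by simp_all
  then show "exchanges P (u @ [j]) i k v g" "exchanges P u j k (i # v) g"
    "exchanges P u i k (j # v) g" "exchanges P (u @ [k]) i j v g"
    using less valid by (auto intro!: exchanges_below_same_length[OF below])
  show "exchanges P u m l (map h v) (h \<circ> g)" if "h \<in> Sym n" "m < n" "l < n" for h m l
    using that valid by (intro exchanges_below_shorter[OF below]) auto
qed (use less valid in auto)

lemma exchanges_disjoint:
  assumes below: "exchanges_below P (u @ i' # j' # t @ i # j # v)"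
    and first: "exchanges P u i' j' (t @ i # j # v) g"
    and less: "j' < i'" "j < i" and valid: "set (u @ i' # j' # t @ i # j # v) \<subseteq> {..<n}" "g \<in> Sym n"
  shows "exchanges P (u @ i' # j' # t) i j v g"
proof (rule exchanges_square[OF first])
  have "inversions (u @ j' # i' # t @ i # j # v) < inversions (u @ i' # j' # t @ i # j # v)"
    "inversions (u @ i' # j' # t @ j # i # v) < inversions (u @ i' # j' # t @ i # j # v)"
    using less inversions_swap[of j' i' u "t @ i # j # v"] inversions_swap[of j i "u @ i' # j' # t" v]
    by simp_all
  then show "exchanges P u i' j' (t @ j # i # v) g" "exchanges P (u @ j' # i' # t) i j v g"
    using less valid by (auto intro!: exchanges_below_same_length[OF below])
  fix h s assume "h \<in> Sym n" "s \<in> short_words n"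
  then show "exchanges P (u @ s @ map h t) (h i) (h j) (map h v) (h \<circ> g)"
    and "exchanges P u i' j' (t @ s @ map h v) (h \<circ> g)"
    using valid by (simp_all add: exchanges_below_shorter[OF below] short_words_def)
qed (use valid in auto)

lemma normal_coeff_exchanges_descending:
  assumes "j < i" "set (u @ i # j # v) \<subseteq> {..<n}" "g \<in> Sym n"
  shows "exchanges (normal_coeff z) u i j v g"
  using assms
proof (induction "u @ i # j # v" arbitrary: u i j v g
    rule: wf_induct_rule[OF wf_measures[of "[length, inversions]"], case_names less])
  case (less u i j v g)
  let ?w = "u @ i # j # v" and ?N = "normal_coeff z"
  have below: "exchanges_below ?N ?w"
    using less.hyps by (simp add: exchanges_below_def)
  from \<open>j < i\<close> have "\<not> sorted ?w" by (auto simp: sorted_append)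
  then obtain u' i' j' v' where descent: "first_descent ?w = Some (u', i', j', v')"
    using first_descent_None[of ?w] by (cases "first_descent ?w") auto
  have "j' < i'" using first_descent_Some[OF descent] by simp
  have first: "exchanges ?N u' i' j' v' g"
    using first_descent_Some[OF descent] normal_coeff_descent[OF descent, of z g]
    by (simp add: exchanges_def)
  from first_descent_least[OF descent \<open>j < i\<close>]
  consider (same) "u' = u" "i' = i" "j' = j" "v' = v"
    | (overlap) "u = u' @ [i']" "i = j'" "v' = j # v"
    | (disjoint) t where "u = u' @ i' # j' # t" "v' = t @ i # j # v" by blast
  then show ?case
  proof cases
    case same
    with first show ?thesis by simp
  next
    case overlap
    then have "exchanges ?N (u' @ [i']) i j v g"
      using below first less.prems \<open>j' < i'\<close> by (intro exchanges_overlap) simp_all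
    then show ?thesis by (simp add: overlap)
  next
    case disjoint
    then have "exchanges ?N (u' @ i' # j' # t) i j v g"
      using below first less.prems \<open>j' < i'\<close> by (intro exchanges_disjoint) simp_all
    then show ?thesis by (simp add: disjoint)
  qed
qed

theorem normal_coeff_exchanges:
  assumes "set (u @ i # j # v) \<subseteq> {..<n}" "g \<in> Sym n"
  shows "exchanges (normal_coeff z) u i j v g"
  using assms normal_coeff_exchanges_descending[of j i u v g z]
    normal_coeff_exchanges_descending[of i j u v g z]
  by (cases i j rule: linorder_cases) (auto simp: exchanges_refl exchanges_commute[of _ u i j])

end

section \<open>Ideals of the skew group algebra\<close>

interpretation elt: vector_space "\<lambda>c (f :: elt) z. c * f z"
  by unfold_locales (auto simp: fun_eq_iff algebra_simps)

lemma sum_fun_apply: "(\<Sum>x\<in>A. F x) z = (\<Sum>x\<in>A. F x z)"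
  by (induction A rule: infinite_finite_induct) auto

lemma cspan_eq_span: "cspan S = elt.span S"
  by (auto simp: cspan_def elt.span_explicit fun_eq_iff sum_fun_apply)

lemma supp_bv [simp]: "supp (bv w g) = {(w, g)}"
  by (auto simp: supp_def bv_def)

lemma bv_apply: "bv w g z = of_bool (z = (w, g))"
  by (simp add: bv_def)

definition lin_ext :: "functional \<Rightarrow> elt \<Rightarrow> complex" where
  "lin_ext P f = (\<Sum>x\<in>supp f. f x * P (fst x) (snd x))"

lemma lin_ext_superset:
  "finite S \<Longrightarrow> supp f \<subseteq> S \<Longrightarrow> lin_ext P f = (\<Sum>x\<in>S. f x * P (fst x) (snd x))"
  unfolding lin_ext_def by (rule sum.mono_neutral_left) (auto simp: supp_def)

lemma lin_ext_bv [simp]: "lin_ext P (bv w g) = P w g"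
  by (simp add: lin_ext_def bv_apply)

lemma subspace_finite_supp: "elt.subspace {f. finite (supp f)}"
proof (rule elt.subspaceI)
  fix f h :: elt and c
  show "0 \<in> {f :: elt. finite (supp f)}" by (simp add: supp_def)
  assume "f \<in> {f. finite (supp f)}" "h \<in> {f. finite (supp f)}"
  moreover have "supp (f + h) \<subseteq> supp f \<union> supp h" "supp (\<lambda>z. c * f z) \<subseteq> supp f"
    by (auto simp: supp_def)
  ultimately show "f + h \<in> {f. finite (supp f)}" "(\<lambda>z. c * f z) \<in> {f. finite (supp f)}"
    by (auto intro: finite_subset)
qed

lemma finite_supp_diff: "finite (supp f) \<Longrightarrow> finite (supp h) \<Longrightarrow> finite (supp (f - h))"
  using elt.subspace_diff[OF subspace_finite_supp, of f h] by simp

lemma finite_supp_scale: "finite (supp f) \<Longrightarrow> finite (supp (\<lambda>z. c * f z))"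
  using elt.subspace_scale[OF subspace_finite_supp, of f c] by simp

lemma finite_supp_sum: "(\<And>t. t \<in> A \<Longrightarrow> finite (supp (F t))) \<Longrightarrow> finite (supp (\<Sum>t\<in>A. F t))"
  using elt.subspace_sum[OF subspace_finite_supp, of A F] by simp

lemmas finite_supp_intros = finite_supp_diff finite_supp_scale finite_supp_sum

lemma lin_ext_add:
  assumes "finite (supp f)" "finite (supp h)"
  shows "lin_ext P (f + h) = lin_ext P f + lin_ext P h"
proof -
  let ?S = "supp f \<union> supp h"
  have "lin_ext P (f + h) = (\<Sum>x\<in>?S. (f + h) x * P (fst x) (snd x))"
    by (rule lin_ext_superset) (use assms in \<open>auto simp: supp_def\<close>)
  also have "\<dots> = lin_ext P f + lin_ext P h"
    using assms by (simp add: lin_ext_superset[of ?S] distrib_right sum.distrib)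
  finally show ?thesis .
qed

lemma lin_ext_scale: "finite (supp f) \<Longrightarrow> lin_ext P (\<lambda>z. c * f z) = c * lin_ext P f"
  by (subst lin_ext_superset[of "supp f"]) (auto simp: supp_def lin_ext_def sum_distrib_left mult.assoc)

lemma lin_ext_diff:
  assumes "finite (supp f)" "finite (supp h)"
  shows "lin_ext P (f - h) = lin_ext P f - lin_ext P h"
  using lin_ext_add[of "f - h" h P] assms by (simp add: finite_supp_diff)

lemma lin_ext_sum:
  "(\<And>t. t \<in> A \<Longrightarrow> finite (supp (F t))) \<Longrightarrow> lin_ext P (\<Sum>t\<in>A. F t) = (\<Sum>t\<in>A. lin_ext P (F t))"
proof (induction A rule: infinite_finite_induct)
  case (insert x A)
  then show "lin_ext P (\<Sum>t\<in>insert x A. F t) = (\<Sum>t\<in>insert x A. lin_ext P (F t))"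
    by (simp add: lin_ext_add finite_supp_sum)
qed (simp_all add: supp_def lin_ext_def)

definition sandwich :: "nat list \<Rightarrow> (nat \<Rightarrow> nat) \<Rightarrow> nat list \<Rightarrow> (nat \<Rightarrow> nat) \<Rightarrow> elt \<Rightarrow> elt" where
  "sandwich u p v q f = bv u p \<star> f \<star> bv v q"

lemma emult_bv_left:
  "bv u p \<star> f = (\<lambda>x. \<Sum>y\<in>supp f. if bmult (u, p) y = x then f y else 0)"
  unfolding emult_def supp_bv by (simp add: bv_apply cong: if_cong)

lemma emult_bv_right:
  assumes "finite S" "supp f \<subseteq> S"
  shows "f \<star> bv v q = (\<lambda>z. \<Sum>x\<in>S. if bmult x (v, q) = z then f x else 0)"
proof
  fix z
  have "(f \<star> bv v q) z = (\<Sum>x\<in>supp f. if bmult x (v, q) = z then f x else 0)"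
    unfolding emult_def supp_bv by (simp add: bv_apply cong: if_cong)
  also have "\<dots> = (\<Sum>x\<in>S. if bmult x (v, q) = z then f x else 0)"
    by (rule sum.mono_neutral_left) (use assms in \<open>auto simp: supp_def\<close>)
  finally show "(f \<star> bv v q) z = (\<Sum>x\<in>S. if bmult x (v, q) = z then f x else 0)" .
qed

lemma supp_emult_bv_left: "supp (bv u p \<star> f) \<subseteq> bmult (u, p) ` supp f"
proof
  fix x assume "x \<in> supp (bv u p \<star> f)"
  then have "(\<Sum>y\<in>supp f. if bmult (u, p) y = x then f y else 0) \<noteq> 0"
    by (simp add: supp_def emult_bv_left)
  then obtain y where "y \<in> supp f" "(if bmult (u, p) y = x then f y else 0) \<noteq> 0"
    by (rule sum.not_neutral_contains_not_neutral)
  then show "x \<in> bmult (u, p) ` supp f" by (auto split: if_splits)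
qed

lemma sandwich_eq:
  assumes "finite (supp f)"
  shows "sandwich u p v q f
      = (\<Sum>y\<in>supp f. (\<lambda>z. f y * bv (u @ map p (fst y) @ map (p \<circ> snd y) v) (p \<circ> snd y \<circ> q) z))"
proof
  fix z
  let ?S = "bmult (u, p) ` supp f"
  have "sandwich u p v q f z = (\<Sum>x\<in>?S. if bmult x (v, q) = z then (bv u p \<star> f) x else 0)"
    unfolding sandwich_def using assms by (subst emult_bv_right[OF _ supp_emult_bv_left]) simp_all
  also have "\<dots> = (\<Sum>x\<in>?S. \<Sum>y\<in>supp f.
      if bmult (u, p) y = x then (if bmult x (v, q) = z then f y else 0) else 0)"
    by (intro sum.cong refl) (simp add: emult_bv_left cong: if_cong)
  also have "\<dots> = (\<Sum>y\<in>supp f. \<Sum>x\<in>?S.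
      if bmult (u, p) y = x then (if bmult x (v, q) = z then f y else 0) else 0)"
    by (rule sum.swap)
  also have "\<dots> = (\<Sum>y\<in>supp f. if bmult (bmult (u, p) y) (v, q) = z then f y else 0)"
    using assms by (intro sum.cong refl) simp
  also have "\<dots> = (\<Sum>y\<in>supp f. f y * bv (u @ map p (fst y) @ map (p \<circ> snd y) v) (p \<circ> snd y \<circ> q) z)"
    by (intro sum.cong refl) (auto simp: bmult_def bv_def)
  finally show "sandwich u p v q f z =
      (\<Sum>y\<in>supp f. (\<lambda>z. f y * bv (u @ map p (fst y) @ map (p \<circ> snd y) v) (p \<circ> snd y \<circ> q) z)) z"
    by (simp add: sum_fun_apply)
qed

lemma finite_supp_sandwich: "finite (supp f) \<Longrightarrow> finite (supp (sandwich u p v q f))"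
  by (simp add: sandwich_eq finite_supp_sum finite_supp_scale)

lemma lin_ext_sandwich:
  "finite (supp f) \<Longrightarrow>
     lin_ext P (sandwich u p v q f) = lin_ext (\<lambda>w g. P (u @ map p w @ map (p \<circ> g) v) (p \<circ> g \<circ> q)) f"
  by (simp add: sandwich_eq lin_ext_sum lin_ext_scale finite_supp_scale) (simp add: lin_ext_def)

lemma sandwich_apply:
  "finite (supp f) \<Longrightarrow>
     sandwich u p v q f z = lin_ext (\<lambda>w g. bv (u @ map p w @ map (p \<circ> g) v) (p \<circ> g \<circ> q) z) f"
  by (simp add: sandwich_eq sum_fun_apply lin_ext_def)

definition skew_algebra :: "nat \<Rightarrow> elt set" where
  "skew_algebra n = {f. finite (supp f) \<and> (\<forall>x\<in>supp f. valid_basis n x)}"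

lemma subspace_skew_algebra: "elt.subspace (skew_algebra n)"
proof (rule elt.subspaceI)
  fix f h :: elt and c
  show "0 \<in> skew_algebra n" by (simp add: skew_algebra_def supp_def)
  assume "f \<in> skew_algebra n" "h \<in> skew_algebra n"
  moreover have "supp (f + h) \<subseteq> supp f \<union> supp h" "supp (\<lambda>z. c * f z) \<subseteq> supp f"
    by (auto simp: supp_def)
  ultimately show "f + h \<in> skew_algebra n" "(\<lambda>z. c * f z) \<in> skew_algebra n"
    unfolding skew_algebra_def by (auto intro: finite_subset)
qed

lemma bv_in_skew_algebra: "valid_basis n (w, g) \<Longrightarrow> bv w g \<in> skew_algebra n"
  by (simp add: skew_algebra_def)

lemma sandwich_in_skew_algebra:
  assumes "f \<in> skew_algebra n" "valid_basis n (u, p)" "valid_basis n (v, q)"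
  shows "sandwich u p v q f \<in> skew_algebra n"
proof -
  have "(\<lambda>z. f y * bv (u @ map p (fst y) @ map (p \<circ> snd y) v) (p \<circ> snd y \<circ> q) z) \<in> skew_algebra n"
    if "y \<in> supp f" for y
    using assms that by (intro elt.subspace_scale subspace_skew_algebra bv_in_skew_algebra)
      (auto simp: skew_algebra_def valid_basis_def subset_iff)
  then have "(\<Sum>y\<in>supp f.
      (\<lambda>z. f y * bv (u @ map p (fst y) @ map (p \<circ> snd y) v) (p \<circ> snd y \<circ> q) z)) \<in> skew_algebra n"
    by (intro elt.subspace_sum subspace_skew_algebra)
  then show ?thesis
    using assms(1) by (simp add: sandwich_eq skew_algebra_def)
qed

lemma subspace_lin_ext_kernel: "elt.subspace {f \<in> skew_algebra n. lin_ext P f = 0}"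
proof (rule elt.subspaceI)
  fix f h c
  show "0 \<in> {f \<in> skew_algebra n. lin_ext P f = 0}"
    using elt.subspace_0[OF subspace_skew_algebra] by (simp add: lin_ext_def)
  assume "f \<in> {f \<in> skew_algebra n. lin_ext P f = 0}" "h \<in> {f \<in> skew_algebra n. lin_ext P f = 0}"
  then show "f + h \<in> {f \<in> skew_algebra n. lin_ext P f = 0}"
    "(\<lambda>z. c * f z) \<in> {f \<in> skew_algebra n. lin_ext P f = 0}"
    using elt.subspace_add[OF subspace_skew_algebra, of f n h]
      elt.subspace_scale[OF subspace_skew_algebra, of f n c]
    by (auto simp: skew_algebra_def lin_ext_add lin_ext_scale)
qed

definition relator :: "nat \<Rightarrow> cochain \<Rightarrow> nat \<Rightarrow> nat \<Rightarrow> elt" where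
  "relator n \<kappa> = rel n (\<lambda>g i j k. \<kappa> g i j [k]) (\<lambda>g i j. \<kappa> g i j [])"

definition relation_ideal :: "nat \<Rightarrow> cochain \<Rightarrow> elt set" where
  "relation_ideal n \<kappa> = rel_ideal n (\<lambda>g i j k. \<kappa> g i j [k]) (\<lambda>g i j. \<kappa> g i j [])"

lemma relator_eq:
  "relator n \<kappa> i j = bv [i, j] id - bv [j, i] id
     - (\<Sum>h\<in>Sym n. \<Sum>w\<in>short_words n. (\<lambda>z. \<kappa> h i j w * bv w h z))"
  by (simp add: fun_eq_iff relator_def rel_def sum_fun_apply sum_short_words sum.distrib)

lemma relator_in_skew_algebra: "i < n \<Longrightarrow> j < n \<Longrightarrow> relator n \<kappa> i j \<in> skew_algebra n"
  unfolding relator_eq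
  by (intro elt.subspace_diff elt.subspace_sum elt.subspace_scale subspace_skew_algebra
    bv_in_skew_algebra)
     (auto simp: valid_basis_def short_words_def)

lemma finite_supp_relator [simp]: "finite (supp (relator n \<kappa> i j))"
  unfolding relator_eq by (intro finite_supp_intros) auto

lemma lin_ext_relator:
  "lin_ext P (relator n \<kappa> i j) = P [i, j] id - P [j, i] id
     - (\<Sum>h\<in>Sym n. \<Sum>w\<in>short_words n. \<kappa> h i j w * P w h)"
  by (simp add: relator_eq lin_ext_diff lin_ext_sum lin_ext_scale finite_supp_intros)

lemma sandwich_relator:
  "sandwich u p v q (relator n \<kappa> i j) z =
     bv (u @ p i # p j # map p v) (p \<circ> q) z - bv (u @ p j # p i # map p v) (p \<circ> q) z
     - (\<Sum>h\<in>Sym n. \<Sum>w\<in>short_words n. \<kappa> h i j w * bv (u @ map p w @ map (p \<circ> h) v) (p \<circ> h \<circ> q) z)"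
  by (simp add: sandwich_apply lin_ext_relator)

lemma ideal_gen_eq_span:
  "ideal_gen n R = elt.span {sandwich u p v q r | u p v q r.
      valid_basis n (u, p) \<and> valid_basis n (v, q) \<and> r \<in> R}"
  unfolding ideal_gen_def cspan_eq_span sandwich_def by (rule arg_cong[of _ _ elt.span]) force

lemma relation_ideal_eq_span:
  "relation_ideal n \<kappa> = elt.span {sandwich u p v q (relator n \<kappa> i j) | u p v q i j.
      valid_basis n (u, p) \<and> valid_basis n (v, q) \<and> i < j \<and> j < n}"
  unfolding relation_ideal_def rel_ideal_def relator_def ideal_gen_eq_span
  by (rule arg_cong[of _ _ elt.span]) blast

lemma relation_ideal_sandwich:
  "\<lbrakk>valid_basis n (u, p); valid_basis n (v, q); i < j; j < n\<rbrakk>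
     \<Longrightarrow> sandwich u p v q (relator n \<kappa> i j) \<in> relation_ideal n \<kappa>"
  unfolding relation_ideal_eq_span by (intro elt.span_base) blast

lemma subspace_relation_ideal: "elt.subspace (relation_ideal n \<kappa>)"
  unfolding relation_ideal_eq_span by (rule elt.subspace_span)

lemma relation_ideal_least:
  assumes "elt.subspace S"
    and "\<And>u p v q i j. \<lbrakk>valid_basis n (u, p); valid_basis n (v, q); i < j; j < n\<rbrakk>
      \<Longrightarrow> sandwich u p v q (relator n \<kappa> i j) \<in> S"
  shows "relation_ideal n \<kappa> \<subseteq> S"
  unfolding relation_ideal_eq_span using assms by (intro elt.span_minimal) blast+

lemma relation_ideal_subset_skew_algebra: "relation_ideal n \<kappa> \<subseteq> skew_algebra n"
  by (intro relation_ideal_least subspace_skew_algebra sandwich_in_skew_algebra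
    relator_in_skew_algebra) auto

lemma comm_ideal_eq: "comm_ideal n = relation_ideal n 0"
  by (simp add: comm_ideal_def relation_ideal_def rel_ideal_def rel_def)

lemma comm_ideal_swap:
  assumes "set (u @ i # j # v) \<subseteq> {..<n}" "g \<in> Sym n" "j < i"
  shows "bv (u @ i # j # v) g - bv (u @ j # i # v) g \<in> comm_ideal n"
proof -
  have "sandwich u id v g (relator n 0 j i) \<in> comm_ideal n"
    unfolding comm_ideal_eq using assms
    by (intro relation_ideal_sandwich) (auto simp: valid_basis_def id_def[symmetric])
  then have "- sandwich u id v g (relator n 0 j i) \<in> comm_ideal n"
    unfolding comm_ideal_eq by (rule elt.subspace_neg[OF subspace_relation_ideal])
  also have "- sandwich u id v g (relator n 0 j i) = bv (u @ i # j # v) g - bv (u @ j # i # v) g"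
    by (simp add: fun_eq_iff sandwich_relator)
  finally show ?thesis .
qed

lemma comm_ideal_sort:
  assumes "set w \<subseteq> {..<n}" "g \<in> Sym n"
  shows "bv w g - bv (sort w) g \<in> comm_ideal n"
  using assms(1)
proof (induction w rule: measure_induct_rule[of inversions])
  case (less w)
  show "bv w g - bv (sort w) g \<in> comm_ideal n"
  proof (cases "first_descent w")
    case None
    then have "sort w = w" by (simp add: first_descent_None sorted_sort_id)
    then show ?thesis
      using elt.subspace_0[OF subspace_relation_ideal] by (simp add: comm_ideal_eq)
  next
    case (Some d)
    obtain u i j v where "d = (u, i, j, v)" by (cases d)
    with Some first_descent_Some have w: "w = u @ i # j # v" and ji: "j < i" by blast+
    have "bv (u @ j # i # v) g - bv (sort (u @ j # i # v)) g \<in> comm_ideal n"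
      by (rule less.IH) (use ji w less.prems in \<open>auto intro: inversions_swap\<close>)
    moreover have "bv (u @ i # j # v) g - bv (u @ j # i # v) g \<in> comm_ideal n"
      by (rule comm_ideal_swap) (use ji w less.prems assms in auto)
    ultimately have "(bv (u @ i # j # v) g - bv (u @ j # i # v) g)
        + (bv (u @ j # i # v) g - bv (sort (u @ j # i # v)) g) \<in> comm_ideal n"
      unfolding comm_ideal_eq by (intro elt.subspace_add subspace_relation_ideal)
    then show ?thesis by (simp add: w sort_swap[of u j i v])
  qed
qed

lemma comm_ideal_low_degree:
  assumes "f \<in> comm_ideal n"
  shows "length w < 2 \<Longrightarrow> f (w, g) = 0" "f ([m, l], h) + f ([l, m], h) = 0"
proof -
  let ?S = "{f :: elt. (\<forall>w g. length w < 2 \<longrightarrow> f (w, g) = 0) \<and> (\<forall>m l h. f ([m, l], h) + f ([l, m], h) = 0)}"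
  have "comm_ideal n \<subseteq> ?S"
    unfolding comm_ideal_eq
  proof (rule relation_ideal_least)
    show "elt.subspace ?S"
    proof (rule elt.subspaceI)
      fix f h :: elt and c
      assume "f \<in> ?S" "h \<in> ?S"
      moreover have "(f + h) x + (f + h) y = (f x + f y) + (h x + h y)"
        "c * f x + c * f y = c * (f x + f y)" for x y
        by (simp_all add: distrib_left)
      moreover have "(f + h) x = 0" if "f x = 0" "h x = 0" for x
        using that by simp
      ultimately show "f + h \<in> ?S" "(\<lambda>z. c * f z) \<in> ?S" by (simp_all del: plus_fun_apply)
    qed simp
    fix u v :: "nat list" and p q :: "nat \<Rightarrow> nat" and i j
    have swap: "([l, m], h) = (u @ a # b # map p v, g) \<longleftrightarrow> ([m, l], h) = (u @ b # a # map p v, g)"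
      for l m a b h g
      by (cases u) (auto simp: Cons_eq_append_conv append_eq_Cons_conv)
    have "sandwich u p v q (relator n 0 i j) ([m, l], h)
        + sandwich u p v q (relator n 0 i j) ([l, m], h) = 0" for m l h
      unfolding sandwich_relator bv_apply swap[of l m] by simp
    then show "sandwich u p v q (relator n 0 i j) \<in> ?S"
      by (auto simp: sandwich_relator bv_apply)
  qed
  then show "length w < 2 \<Longrightarrow> f (w, g) = 0" "f ([m, l], h) + f ([l, m], h) = 0"
    using assms by blast+
qed

section \<open>The PBW criterion\<close>

lemma fdeg_eq_Max: "fdeg f = Max ((\<lambda>x. length (fst x)) ` supp f)"
  unfolding fdeg_def supp_def setcompr_eq_image ..

lemma fdeg_ge: "finite (supp f) \<Longrightarrow> f x \<noteq> 0 \<Longrightarrow> length (fst x) \<le> fdeg f"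
  unfolding fdeg_eq_Max by (rule Max_ge) (simp_all add: supp_def)

lemma fdeg_attained:
  assumes "finite (supp f)" "f x \<noteq> 0"
  obtains y where "f y \<noteq> 0" "length (fst y) = fdeg f"
proof -
  have "x \<in> supp f" using assms by (simp add: supp_def)
  then have "fdeg f \<in> (\<lambda>x. length (fst x)) ` supp f"
    unfolding fdeg_eq_Max using assms(1) by (intro Max_in) auto
  then show thesis using that unfolding supp_def by force
qed

lemma fdeg_eqI:
  assumes "finite (supp f)" "f x \<noteq> 0" "length (fst x) = d" "\<And>y. f y \<noteq> 0 \<Longrightarrow> length (fst y) \<le> d"
  shows "fdeg f = d"
  using fdeg_ge[OF assms(1,2)] fdeg_attained[OF assms(1,2)] assms(3,4) by (metis order_antisym)

lemma top_sandwich_relator: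
  assumes "i < j" "p \<in> Sym n"
  shows "top (sandwich u p v q (relator n \<kappa> i j)) = sandwich u p v q (relator n 0 i j)"
proof -
  let ?f = "sandwich u p v q (relator n \<kappa> i j)" and ?h = "sandwich u p v q (relator n 0 i j)"
  let ?d = "length u + length v + 2"
  have h: "?h x = bv (u @ p i # p j # map p v) (p \<circ> q) x - bv (u @ p j # p i # map p v) (p \<circ> q) x" for x
    by (simp add: sandwich_relator)
  have h_homogeneous: "?h x = 0" if "length (fst x) \<noteq> ?d" for x
    using that by (auto simp: h bv_apply)
  have agree: "?f x = ?h x" if "length (fst x) \<ge> ?d" for x
  proof -
    have "bv (u @ map p w @ map (p \<circ> h) v) (p \<circ> h \<circ> q) x = 0" if "w \<in> short_words n" for w h
      using that \<open>length (fst x) \<ge> ?d\<close> by (auto simp: bv_apply short_words_def)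
    then show ?thesis by (simp add: sandwich_relator)
  qed
  have "fdeg ?f = ?d"
  proof (rule fdeg_eqI)
    show "finite (supp ?f)" by (simp add: finite_supp_sandwich)
    show "?f (u @ p i # p j # map p v, p \<circ> q) \<noteq> 0"
      using assms by (subst agree) (auto simp: h bv_apply)
    show "length (fst x) \<le> ?d" if "?f x \<noteq> 0" for x
      using agree[of x] h_homogeneous[of x] that by (cases "length (fst x) \<le> ?d") auto
  qed simp
  then show ?thesis
    using agree h_homogeneous by (auto simp: top_def fun_eq_iff)
qed

lemma comm_ideal_subset_top: "comm_ideal n \<subseteq> cspan (top ` relation_ideal n \<kappa>)"
  unfolding cspan_eq_span comm_ideal_eq
proof (rule relation_ideal_least)
  fix u p v q i j
  assume valid: "valid_basis n (u, p)" "valid_basis n (v, q)" "i < j" "j < n"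
  then have "sandwich u p v q (relator n 0 i j) = top (sandwich u p v q (relator n \<kappa> i j))"
    by (simp add: top_sandwich_relator valid_basis_def)
  then show "sandwich u p v q (relator n 0 i j) \<in> elt.span (top ` relation_ideal n \<kappa>)"
    using relation_ideal_sandwich[OF valid] by (simp add: elt.span_base)
qed (rule elt.subspace_span)

context pbw_cochain
begin

lemma lin_ext_normal_coeff_eq_0:
  assumes "f \<in> relation_ideal n \<kappa>"
  shows "lin_ext (normal_coeff z) f = 0"
proof -
  let ?N = "normal_coeff z"
  have "relation_ideal n \<kappa> \<subseteq> {f \<in> skew_algebra n. lin_ext ?N f = 0}"
  proof (rule relation_ideal_least[OF subspace_lin_ext_kernel])
    fix u p v q i j
    assume valid: "valid_basis n (u, p)" "valid_basis n (v, q)" "i < j" "j < n"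
    then have "exchanges ?N u (p i) (p j) (map p v) (p \<circ> q)"
      by (intro normal_coeff_exchanges) (auto simp: valid_basis_def)
    then have "lin_ext ?N (sandwich u p v q (relator n \<kappa> i j)) = 0"
      using valid by (simp add: lin_ext_sandwich lin_ext_relator exchanges_def bracket_permute
        valid_basis_def comp_assoc)
    then show "sandwich u p v q (relator n \<kappa> i j) \<in> {f \<in> skew_algebra n. lin_ext ?N f = 0}"
      using valid by (simp add: sandwich_in_skew_algebra relator_in_skew_algebra)
  qed
  then show ?thesis using assms by blast
qed

lemma leading_normal_form_eq_0:
  assumes f: "f \<in> relation_ideal n \<kappa>"
  shows "(\<Sum>x | x \<in> supp f \<and> length (fst x) = fdeg f. f x * bv (sort (fst x)) (snd x) z) = 0"
    (is "sum _ ?S = 0")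
proof (cases "length (fst z) = fdeg f")
  case True
  have fin: "finite (supp f)"
    using f relation_ideal_subset_skew_algebra by (auto simp: skew_algebra_def)
  have "f x * normal_coeff z (fst x) (snd x) = 0" if "x \<in> supp f - ?S" for x
    using that fdeg_ge[OF fin, of x] True normal_coeff_longer[of "fst x" z] by (auto simp: supp_def)
  then have "lin_ext (normal_coeff z) f = (\<Sum>x\<in>?S. f x * normal_coeff z (fst x) (snd x))"
    unfolding lin_ext_def using fin by (intro sum.mono_neutral_right) auto
  also have "\<dots> = (\<Sum>x\<in>?S. f x * bv (sort (fst x)) (snd x) z)"
    using True by (intro sum.cong) (auto simp: normal_coeff_same_length bv_apply)
  finally show ?thesis
    using lin_ext_normal_coeff_eq_0[OF f] by simp
next
  case False
  then show ?thesis by (intro sum.neutral) (auto simp: bv_apply)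
qed

lemma top_in_comm_ideal:
  assumes f: "f \<in> relation_ideal n \<kappa>"
  shows "top f \<in> comm_ideal n"
proof -
  let ?S = "{x. x \<in> supp f \<and> length (fst x) = fdeg f}"
  have fin: "finite (supp f)" and valid: "\<And>x. x \<in> supp f \<Longrightarrow> valid_basis n x"
    using f relation_ideal_subset_skew_algebra by (auto simp: skew_algebra_def)
  have "top f z = (\<Sum>x\<in>?S. f x * (bv (fst x) (snd x) z - bv (sort (fst x)) (snd x) z))" for z
  proof -
    have "(\<Sum>x\<in>?S. f x * bv (fst x) (snd x) z) = (\<Sum>x\<in>?S. if x = z then f x else 0)"
      by (intro sum.cong) (auto simp: bv_apply)
    also have "\<dots> = top f z"
      using fin by (auto simp: top_def supp_def)
    finally show ?thesis
      using leading_normal_form_eq_0[OF f, of z] by (simp add: right_diff_distrib sum_subtractf)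
  qed
  then have "top f = (\<Sum>x\<in>?S. (\<lambda>z. f x * (bv (fst x) (snd x) - bv (sort (fst x)) (snd x)) z))"
    by (simp add: fun_eq_iff sum_fun_apply)
  also have "\<dots> \<in> comm_ideal n"
    unfolding comm_ideal_eq
  proof (intro elt.subspace_sum elt.subspace_scale subspace_relation_ideal)
    fix x assume "x \<in> ?S"
    then show "bv (fst x) (snd x) - bv (sort (fst x)) (snd x) \<in> relation_ideal n 0"
      unfolding comm_ideal_eq[symmetric] using valid[of x]
      by (intro comm_ideal_sort) (auto simp: valid_basis_def)
  qed
  finally show ?thesis .
qed

theorem DOA: "DOA n (\<lambda>g i j k. \<kappa> g i j [k]) (\<lambda>g i j. \<kappa> g i j [])"
  unfolding DOA_def relation_ideal_def[symmetric]
proof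
  show "comm_ideal n \<subseteq> cspan (top ` relation_ideal n \<kappa>)"
    by (rule comm_ideal_subset_top)
  show "cspan (top ` relation_ideal n \<kappa>) \<subseteq> comm_ideal n"
    unfolding cspan_eq_span using top_in_comm_ideal subspace_relation_ideal[of n 0]
    by (intro elt.span_minimal) (auto simp: comm_ideal_eq)
qed

end

locale drinfeld_cochain = alternating_cochain +
  assumes DOA: "DOA n (\<lambda>g i j k. \<kappa> g i j [k]) (\<lambda>g i j. \<kappa> g i j [])"
begin

lemma top_in_comm_ideal: "f \<in> relation_ideal n \<kappa> \<Longrightarrow> top f \<in> comm_ideal n"
  using DOA unfolding DOA_def relation_ideal_def cspan_eq_span by (blast intro: elt.span_base)

lemma finite_supp_ideal: "f \<in> relation_ideal n \<kappa> \<Longrightarrow> finite (supp f)"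
  using relation_ideal_subset_skew_algebra by (auto simp: skew_algebra_def)

lemma ideal_low_degree_eq_0:
  assumes "f \<in> relation_ideal n \<kappa>" "\<And>w g. f (w, g) \<noteq> 0 \<Longrightarrow> length w \<le> 1"
  shows "f x = 0"
proof (rule ccontr)
  assume "f x \<noteq> 0"
  then obtain w g where y: "f (w, g) \<noteq> 0" "length w = fdeg f"
    using fdeg_attained[OF finite_supp_ideal[OF assms(1)]] by (metis prod.collapse)
  then have "top f (w, g) = 0"
    using comm_ideal_low_degree(1)[OF top_in_comm_ideal[OF assms(1)]] assms(2)[of w g] by simp
  then show False using y by (simp add: top_def)
qed

lemma ideal_degree_two_antisym:
  assumes "f \<in> relation_ideal n \<kappa>" "\<And>w g. f (w, g) \<noteq> 0 \<Longrightarrow> length w \<le> 2"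
  shows "f ([m, l], h) + f ([l, m], h) = 0"
proof (cases "f ([m, l], h) = 0 \<and> f ([l, m], h) = 0")
  case False
  then obtain x where "f x \<noteq> 0" "length (fst x) = 2" by auto
  then have "fdeg f = 2"
    using finite_supp_ideal[OF assms(1)] assms(2) by (intro fdeg_eqI) (auto simp: prod.split_sel)
  moreover have "top f ([m, l], h) + top f ([l, m], h) = 0"
    by (rule comm_ideal_low_degree(2)[OF top_in_comm_ideal[OF assms(1)]])
  ultimately show ?thesis by (simp add: top_def)
qed simp

lemma sandwich_relator_in_ideal:
  assumes "valid_basis n (u, p)" "valid_basis n (v, q)" "i < n" "j < n"
  shows "sandwich u p v q (relator n \<kappa> i j) \<in> relation_ideal n \<kappa>"
proof -
  have swap: "sandwich u p v q (relator n \<kappa> i j) = - sandwich u p v q (relator n \<kappa> j i)" for i j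
    by (simp add: fun_eq_iff sandwich_relator alternating[of _ i j] sum_negf)
  consider (less) "i < j" | (equal) "i = j" | (greater) "j < i" by linarith
  then show ?thesis
  proof cases
    case less
    then show ?thesis using assms by (intro relation_ideal_sandwich)
  next
    case equal
    then have "sandwich u p v q (relator n \<kappa> i j) = 0"
      using swap[of i i] by (simp add: fun_eq_iff)
    then show ?thesis using elt.subspace_0[OF subspace_relation_ideal] by simp
  next
    case greater
    then have "sandwich u p v q (relator n \<kappa> j i) \<in> relation_ideal n \<kappa>"
      using assms by (intro relation_ideal_sandwich)
    then show ?thesis
      unfolding swap[of i j] by (rule elt.subspace_neg[OF subspace_relation_ideal])
  qed
qed

lemma ideal_short_coeff_eq_0:
  assumes "f \<in> relation_ideal n \<kappa>"
    and f: "\<And>z. f z = (\<Sum>h\<in>Sym n. \<Sum>w\<in>short_words n. A h w * bv w h z)"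
    and "g \<in> Sym n" "w \<in> short_words n"
  shows "A g w = 0"
proof -
  have "f (w, g) = 0"
  proof (rule ideal_low_degree_eq_0[OF assms(1)], rule ccontr)
    fix w g assume "f (w, g) \<noteq> 0" "\<not> length w \<le> 1"
    moreover from this have "bv s h (w, g) = 0" if "s \<in> short_words n" for s h
      using that by (auto simp: bv_apply short_words_def)
    ultimately show False by (simp add: f)
  qed
  moreover have "bv s h (w, g) = of_bool (h = g) * of_bool (s = w)" for s h
    by (auto simp: bv_apply)
  then have "f (w, g) = (\<Sum>h\<in>Sym n. of_bool (h = g) * (\<Sum>s\<in>short_words n. of_bool (s = w) * A h s))"
    by (simp add: f sum_distrib_left mult_ac del: sum_of_bool_mult_eq sum_mult_of_bool_eq)
  ultimately show ?thesis
    using assms(3,4) by (simp add: sum_of_bool_delta)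
qed

lemma invariant:
  assumes p: "p \<in> Sym n" and h: "h \<in> Sym n" and ij: "i < n" "j < n" and w: "w \<in> short_words n"
  shows "\<kappa> (p \<circ> h \<circ> inv p) (p i) (p j) (map p w) = \<kappa> h i j w"
proof -
  define A where "A g s = \<kappa> g (p i) (p j) s - \<kappa> (inv p \<circ> g \<circ> p) i j (map (inv p) s)" for g s
  define f where "f = sandwich [] p [] (inv p) (relator n \<kappa> i j)
      - sandwich [] id [] id (relator n \<kappa> (p i) (p j))"
  have "f \<in> relation_ideal n \<kappa>"
    unfolding f_def using p ij
    by (intro elt.subspace_diff subspace_relation_ideal sandwich_relator_in_ideal)
      (auto simp: valid_basis_def)
  moreover have "f z = (\<Sum>g\<in>Sym n. \<Sum>s\<in>short_words n. A g s * bv s g z)" for z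
  proof -
    define E where "E g s = \<kappa> (inv p \<circ> g \<circ> p) i j (map (inv p) s) * bv s g z" for g s
    have "(\<Sum>g\<in>Sym n. \<Sum>s\<in>short_words n. E g s) = (\<Sum>g\<in>Sym n. \<Sum>s\<in>short_words n. E (p \<circ> g \<circ> inv p) s)"
      by (rule sum_Sym_conjugate[OF p])
    also have "\<dots> = (\<Sum>g\<in>Sym n. \<Sum>s\<in>short_words n. E (p \<circ> g \<circ> inv p) (map p s))"
      by (intro sum.cong refl sum_short_words_map[OF p])
    also have "\<dots> = (\<Sum>g\<in>Sym n. \<Sum>s\<in>short_words n. \<kappa> g i j s * bv (map p s) (p \<circ> g \<circ> inv p) z)"
      using p by (simp add: E_def Sym_unconjugate)
    finally show ?thesis
      using p by (simp add: f_def A_def E_def sandwich_relator left_diff_distrib sum_subtractf)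
  qed
  ultimately have "A (p \<circ> h \<circ> inv p) (map p w) = 0"
    by (rule ideal_short_coeff_eq_0) (use p h w in \<open>auto simp: short_words_def\<close>)
  then show ?thesis using p by (simp add: A_def Sym_unconjugate)
qed

lemma jacobiator_in_ideal:
  assumes "i < n" "j < n" "k < n"
  shows "(\<lambda>z. jacobiator (\<lambda>w h. bv w h z) i j k) \<in> relation_ideal n \<kappa>"
proof -
  define X where
    "X i j k = sandwich [k] id [] id (relator n \<kappa> i j) - sandwich [] id [k] id (relator n \<kappa> i j)"
    for i j k
  have X: "X i j k \<in> relation_ideal n \<kappa>" if "i < n" "j < n" "k < n" for i j k
    unfolding X_def using that
    by (intro elt.subspace_diff subspace_relation_ideal sandwich_relator_in_ideal)
      (auto simp: valid_basis_def)
  have "X i j k z = (bv [k, i, j] id z - bv [k, j, i] id z) - (bv [i, j, k] id z - bv [j, i, k] id z)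
      + (bracket (\<lambda>w h. bv w h z) [] i j [k] id - bracket (\<lambda>w h. bv w h z) [k] i j [] id)" for i j k z
    by (simp add: X_def sandwich_relator bracket_def)
  then have "cyclic_sum X i j k = (\<lambda>z. jacobiator (\<lambda>w h. bv w h z) i j k)"
    by (simp add: jacobiator_def fun_eq_iff)
  moreover have "cyclic_sum X i j k \<in> relation_ideal n \<kappa>"
    using assms by (intro elt.subspace_add subspace_relation_ideal X)
  ultimately show ?thesis by simp
qed

lemma jacobi_quadratic_antisym:
  assumes ijk: "i < n" "j < n" "k < n" and h: "h \<in> Sym n" and ml: "m < n" "l < n"
  shows "jacobi_quadratic i j k h m l + jacobi_quadratic i j k h l m = 0"
proof -
  define f where "f z = jacobiator (\<lambda>w h. bv w h z) i j k" for z
  have f_eq: "f (w, g) = (\<Sum>h\<in>Sym n. \<Sum>m<n. \<Sum>l<n. jacobi_quadratic i j k h m l * bv [m, l] h (w, g))"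
    if "length w \<ge> 2" for w g
  proof -
    have "bv [x] h (w, g) = 0" for x h using that by (auto simp: bv_apply)
    then show ?thesis using ijk by (simp add: f_def jacobiator_eq)
  qed
  have coeff: "f ([m, l], h) = jacobi_quadratic i j k h m l" if "m < n" "l < n" for m l
  proof -
    have "bv [m', l'] h' ([m, l], h)
        = of_bool (h' = h) * (of_bool (m' = m) * of_bool (l' = l))" for m' l' h'
      by (auto simp: bv_apply)
    then have "f ([m, l], h) = (\<Sum>h'\<in>Sym n. of_bool (h' = h) * (\<Sum>m'<n. of_bool (m' = m) *
        (\<Sum>l'<n. of_bool (l' = l) * jacobi_quadratic i j k h' m' l')))"
      by (simp add: f_eq sum_distrib_left mult_ac del: sum_of_bool_mult_eq sum_mult_of_bool_eq)
    then show ?thesis using h that by (simp add: sum_of_bool_delta)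
  qed
  have "f ([m, l], h) + f ([l, m], h) = 0"
  proof (rule ideal_degree_two_antisym)
    show "f \<in> relation_ideal n \<kappa>"
      using jacobiator_in_ideal[OF ijk] by (simp add: f_def[abs_def])
    fix w g assume "f (w, g) \<noteq> 0"
    moreover have "f (w, g) = 0" if "length w > 2"
    proof -
      have "bv [m, l] h (w, g) = 0" for m l h using that by (auto simp: bv_apply)
      then show ?thesis using that by (simp add: f_eq)
    qed
    ultimately show "length w \<le> 2" by (meson not_le)
  qed
  then show ?thesis using ml by (simp add: coeff)
qed

lemma jacobi_lower_eq_0:
  assumes ijk: "i < n" "j < n" "k < n" and "f \<in> Sym n" "w \<in> short_words n"
  shows "jacobi_lower i j k f w = 0"
proof -
  let ?Q = "jacobi_quadratic i j k" and ?S = "\<lambda>h m l. sandwich [] id [] h (relator n \<kappa> m l)"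
  define F :: elt where "F = (\<lambda>z. 2 * jacobiator (\<lambda>w h. bv w h z) i j k)
    - (\<Sum>h\<in>Sym n. \<Sum>m<n. \<Sum>l<n. (\<lambda>z. ?Q h m l * ?S h m l z))"
  have "F \<in> relation_ideal n \<kappa>"
    unfolding F_def
    by (intro elt.subspace_diff elt.subspace_sum elt.subspace_scale subspace_relation_ideal
        jacobiator_in_ideal sandwich_relator_in_ideal ijk) (auto simp: valid_basis_def)
  moreover have "F z = (\<Sum>f\<in>Sym n. \<Sum>w\<in>short_words n. jacobi_lower i j k f w * bv w f z)" for z
  proof -
    have "?S h m l z = bv [m, l] h z - bv [l, m] h z - bracket (\<lambda>w h. bv w h z) [] m l [] h" for h m l
      by (simp add: sandwich_relator bracket_def)
    then show ?thesis
      using jacobi_identity[OF jacobi_quadratic_antisym[OF ijk] ijk, of "\<lambda>w h. bv w h z"]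
      by (simp add: F_def sum_fun_apply)
  qed
  ultimately show ?thesis
    by (rule ideal_short_coeff_eq_0) (use assms in auto)
qed

end

theorem (in alternating_cochain) DOA_iff_pbw_cochain:
  "DOA n (\<lambda>g i j k. \<kappa> g i j [k]) (\<lambda>g i j. \<kappa> g i j []) \<longleftrightarrow> pbw_cochain n \<kappa>"
proof
  assume "DOA n (\<lambda>g i j k. \<kappa> g i j [k]) (\<lambda>g i j. \<kappa> g i j [])"
  then interpret drinfeld_cochain n \<kappa> by unfold_locales
  show "pbw_cochain n \<kappa>"
    by unfold_locales (auto intro: invariant jacobi_quadratic_antisym jacobi_lower_eq_0)
qed (rule pbw_cochain.DOA)

section \<open>Representations in the group algebra\<close>

text \<open>An element of the group algebra \<open>\<complex>S\<^sub>n\<close> is given by its coefficients \<open>x\<close>. It acts on functions on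
  the group through right translations.\<close>

definition convolve ::
  "nat \<Rightarrow> ((nat \<Rightarrow> nat) \<Rightarrow> complex) \<Rightarrow> ((nat \<Rightarrow> nat) \<Rightarrow> complex) \<Rightarrow> (nat \<Rightarrow> nat) \<Rightarrow> complex" where
  "convolve n x y f = (\<Sum>h\<in>Sym n. x (f \<circ> inv h) * y h)"

definition act :: "nat \<Rightarrow> ((nat \<Rightarrow> nat) \<Rightarrow> complex) \<Rightarrow> ((nat \<Rightarrow> nat) \<Rightarrow> complex) \<Rightarrow> (nat \<Rightarrow> nat) \<Rightarrow> complex" where
  "act n x \<phi> q = (\<Sum>g\<in>Sym n. x g * \<phi> (q \<circ> g))"

definition word_act ::
  "nat \<Rightarrow> (nat \<Rightarrow> (nat \<Rightarrow> nat) \<Rightarrow> complex) \<Rightarrow> nat list \<Rightarrow> ((nat \<Rightarrow> nat) \<Rightarrow> complex) \<Rightarrow> (nat \<Rightarrow> nat) \<Rightarrow> complex" where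
  "word_act n x w = foldr (\<lambda>k. act n (x k)) w"

lemma act_act: "act n x (act n y \<phi>) q = act n (convolve n x y) \<phi> q"
proof -
  have "act n x (act n y \<phi>) q = (\<Sum>g\<in>Sym n. \<Sum>h\<in>Sym n. x g * y h * \<phi> (q \<circ> g \<circ> h))"
    by (simp add: act_def sum_distrib_left mult.assoc)
  also have "\<dots> = (\<Sum>h\<in>Sym n. \<Sum>g\<in>Sym n. x g * y h * \<phi> (q \<circ> g \<circ> h))"
    by (rule sum.swap)
  also have "\<dots> = (\<Sum>f\<in>Sym n. \<Sum>h\<in>Sym n. x (f \<circ> inv h) * y h * \<phi> (q \<circ> (f \<circ> inv h) \<circ> h))"
    by (rule sum_Sym_by_product)
  also have "\<dots> = act n (convolve n x y) \<phi> q"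
    unfolding act_def convolve_def sum_distrib_right by (intro sum.cong refl) (simp add: comp_assoc)
  finally show ?thesis .
qed

lemma act_linear:
  "act n x (\<lambda>q. \<Sum>t\<in>T. c t * \<phi> t q) = (\<lambda>q. \<Sum>t\<in>T. c t * act n x (\<phi> t) q)"
  by (simp add: fun_eq_iff act_def sum_distrib_left mult.left_commute sum.swap[of _ T])

lemma word_act_simps [simp]:
  "word_act n x [] \<phi> = \<phi>" "word_act n x (k # w) \<phi> = act n (x k) (word_act n x w \<phi>)"
  "word_act n x (u @ w) \<phi> = word_act n x u (word_act n x w \<phi>)"
  by (simp_all add: word_act_def)

lemma word_act_diff: "word_act n x w (\<phi> - \<psi>) q = word_act n x w \<phi> q - word_act n x w \<psi> q"
  by (induction w arbitrary: q) (simp_all add: act_def right_diff_distrib sum_subtractf)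

lemma word_act_linear:
  "word_act n x w (\<lambda>q. \<Sum>t\<in>T. c t * \<phi> t q) = (\<lambda>q. \<Sum>t\<in>T. c t * word_act n x w (\<phi> t) q)"
  by (induction w) (simp_all add: act_linear)

definition equivariant :: "nat \<Rightarrow> (nat \<Rightarrow> (nat \<Rightarrow> nat) \<Rightarrow> complex) \<Rightarrow> bool" where
  "equivariant n x \<longleftrightarrow> (\<forall>h\<in>Sym n. \<forall>g\<in>Sym n. \<forall>k<n. x (h k) (h \<circ> g \<circ> inv h) = x k g)"

lemma word_act_translate:
  assumes x: "equivariant n x" and h: "h \<in> Sym n" and "set w \<subseteq> {..<n}"
  shows "word_act n x (map h w) (\<lambda>q. \<phi> (q \<circ> h)) = (\<lambda>q. word_act n x w \<phi> (q \<circ> h))"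
  using assms(3)
proof (induction w)
  case (Cons k w)
  define \<psi> where "\<psi> = word_act n x w \<phi>"
  have "act n (x (h k)) (\<lambda>q. \<psi> (q \<circ> h)) = (\<lambda>q. act n (x k) \<psi> (q \<circ> h))"
  proof
    fix q
    have "act n (x (h k)) (\<lambda>q. \<psi> (q \<circ> h)) q
        = (\<Sum>g\<in>Sym n. x (h k) (h \<circ> g \<circ> inv h) * \<psi> (q \<circ> (h \<circ> g \<circ> inv h) \<circ> h))"
      unfolding act_def by (rule sum_Sym_conjugate[OF h])
    also have "\<dots> = act n (x k) \<psi> (q \<circ> h)"
      unfolding act_def using x h Cons.prems
      by (intro sum.cong refl) (simp add: equivariant_def comp_assoc)
    finally show "act n (x (h k)) (\<lambda>q. \<psi> (q \<circ> h)) q = act n (x k) \<psi> (q \<circ> h)" .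
  qed
  then show ?case using Cons by (simp add: \<psi>_def comp_def)
qed simp

context alternating_cochain
begin

definition represents :: "(nat \<Rightarrow> (nat \<Rightarrow> nat) \<Rightarrow> complex) \<Rightarrow> bool" where
  "represents x \<longleftrightarrow> equivariant n x \<and> (\<forall>i<n. \<forall>j<n. \<forall>f\<in>Sym n.
     convolve n (x i) (x j) f - convolve n (x j) (x i) f =
       (\<Sum>k<n. convolve n (x k) (\<lambda>h. \<kappa> h i j [k]) f) + \<kappa> f i j [])"

lemma represents_commutator:
  assumes "represents x" "i < n" "j < n"
  shows "act n (x i) (act n (x j) \<phi>) q - act n (x j) (act n (x i) \<phi>) q =
    (\<Sum>h\<in>Sym n. \<Sum>w\<in>short_words n. \<kappa> h i j w * word_act n x w (\<lambda>q. \<phi> (q \<circ> h)) q)"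
proof -
  have linear_part: "act n (convolve n (x k) (\<lambda>h. \<kappa> h i j [k])) \<phi> q
      = (\<Sum>h\<in>Sym n. \<kappa> h i j [k] * act n (x k) (\<lambda>q. \<phi> (q \<circ> h)) q)" for k
  proof -
    have "act n (\<lambda>h. \<kappa> h i j [k]) \<phi> = (\<lambda>q. \<Sum>h\<in>Sym n. \<kappa> h i j [k] * \<phi> (q \<circ> h))"
      by (simp add: fun_eq_iff act_def)
    then show ?thesis unfolding act_act[symmetric] by (simp only: act_linear)
  qed
  have "act n (x i) (act n (x j) \<phi>) q - act n (x j) (act n (x i) \<phi>) q
      = (\<Sum>f\<in>Sym n. (convolve n (x i) (x j) f - convolve n (x j) (x i) f) * \<phi> (q \<circ> f))"
    unfolding act_act by (simp add: act_def left_diff_distrib sum_subtractf)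
  also have "\<dots> = (\<Sum>f\<in>Sym n. ((\<Sum>k<n. convolve n (x k) (\<lambda>h. \<kappa> h i j [k]) f) + \<kappa> f i j []) * \<phi> (q \<circ> f))"
    using assms by (simp add: represents_def)
  also have "\<dots> = (\<Sum>k<n. act n (convolve n (x k) (\<lambda>h. \<kappa> h i j [k])) \<phi> q)
      + (\<Sum>f\<in>Sym n. \<kappa> f i j [] * \<phi> (q \<circ> f))"
    by (simp add: act_def distrib_right sum.distrib sum_distrib_right sum.swap[of _ "{..<n}" "Sym n"])
  finally show ?thesis
    by (simp add: linear_part sum_short_words sum.distrib sum.swap[of _ "{..<n}" "Sym n"])
qed

lemma represents_exchanges:
  assumes x: "represents x" and word: "set (u @ i # j # v) \<subseteq> {..<n}" and g: "g \<in> Sym n"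
  shows "exchanges (\<lambda>w g. word_act n x w (\<lambda>q. \<phi> (q \<circ> g)) id) u i j v g"
proof -
  define P where "P w g = word_act n x w (\<lambda>q. \<phi> (q \<circ> g)) id" for w g
  define \<psi> where "\<psi> = word_act n x v (\<lambda>q. \<phi> (q \<circ> g))"
  define D where "D = act n (x i) (act n (x j) \<psi>) - act n (x j) (act n (x i) \<psi>)"
  have "D = (\<lambda>q. \<Sum>t\<in>Sym n \<times> short_words n. \<kappa> (fst t) i j (snd t) *
      word_act n x (snd t) (\<lambda>q. \<psi> (q \<circ> fst t)) q)"
    using represents_commutator[OF x] word by (simp add: D_def fun_eq_iff sum.cartesian_product')
  then have "word_act n x u D = (\<lambda>q. \<Sum>t\<in>Sym n \<times> short_words n. \<kappa> (fst t) i j (snd t) *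
      word_act n x u (word_act n x (snd t) (\<lambda>q. \<psi> (q \<circ> fst t))) q)"
    by (simp only: word_act_linear)
  then have "word_act n x u D id
      = (\<Sum>h\<in>Sym n. \<Sum>w\<in>short_words n. \<kappa> h i j w * word_act n x (u @ w) (\<lambda>q. \<psi> (q \<circ> h)) id)"
    by (simp add: sum.cartesian_product')
  also have "\<dots> = bracket P u i j v g"
  proof -
    have "word_act n x (u @ w) (\<lambda>q. \<psi> (q \<circ> h)) id = P (u @ w @ map h v) (h \<circ> g)" if "h \<in> Sym n" for h w
      using word_act_translate[of n x h v "\<lambda>q. \<phi> (q \<circ> g)"] x word that
      by (simp add: represents_def P_def \<psi>_def comp_assoc)
    then show ?thesis unfolding bracket_def by (intro sum.cong refl) simp
  qed
  also have "word_act n x u D id = P (u @ i # j # v) g - P (u @ j # i # v) g"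
    by (simp add: D_def P_def \<psi>_def word_act_diff)
  finally show ?thesis by (simp add: exchanges_def P_def[abs_def])
qed

lemma represents_jacobi_lower_constant:
  assumes x: "represents x"
    and quadratic: "\<And>h m l. h \<in> Sym n \<Longrightarrow> m < n \<Longrightarrow> l < n \<Longrightarrow>
      jacobi_quadratic i j k h m l + jacobi_quadratic i j k h l m = 0"
    and linear: "\<And>f l. f \<in> Sym n \<Longrightarrow> l < n \<Longrightarrow> jacobi_lower i j k f [l] = 0"
    and ijk: "i < n" "j < n" "k < n" and f: "f \<in> Sym n"
  shows "jacobi_lower i j k f [] = 0"
proof -
  define P where "P w g = word_act n x w (\<lambda>q. of_bool (q \<circ> g = f)) id" for w g
  have exch: "exchanges P u i j v g" if "set (u @ i # j # v) \<subseteq> {..<n}" "g \<in> Sym n" for u i j v g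
    unfolding P_def[abs_def] using represents_exchanges[OF x that, of "\<lambda>q. of_bool (q = f)"] .
  have "0 = 2 * jacobiator P i j k"
    using jacobiator_eq_0_if_exchanges[OF exch ijk] by simp
  also have "\<dots> = (\<Sum>q\<in>Sym n. jacobi_lower i j k q [] * P [] q)"
    using jacobi_identity[OF quadratic ijk, of P] exch[of "[]" _ _ "[]"] linear
    by (simp add: exchanges_def sum_short_words)
  also have "\<dots> = (\<Sum>q\<in>Sym n. of_bool (q = f) * jacobi_lower i j k q [])"
    by (intro sum.cong refl) (simp add: P_def)
  also have "\<dots> = jacobi_lower i j k f []"
    using f by (simp add: sum_of_bool_delta)
  finally show ?thesis by simp
qed

end

section \<open>Three-cycles and five-cycles\<close>

abbreviation three_cycle :: "nat \<Rightarrow> (nat \<Rightarrow> nat) \<Rightarrow> bool" where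
  "three_cycle n \<equiv> is_kcycle n 3"

abbreviation five_cycle :: "nat \<Rightarrow> (nat \<Rightarrow> nat) \<Rightarrow> bool" where
  "five_cycle n \<equiv> is_kcycle n 5"

definition cyc5 :: "nat \<Rightarrow> nat \<Rightarrow> nat \<Rightarrow> nat \<Rightarrow> nat \<Rightarrow> (nat \<Rightarrow> nat)" where
  "cyc5 p q r s t = cycle_of_list [p, q, r, s, t]"

lemma cyc3_apply:
  "distinct [p, q, r] \<Longrightarrow> cyc3 p q r x = (if x = p then q else if x = q then r else if x = r then p else x)"
  by (auto simp: cyc3_def transpose_def)

lemma cyc5_apply:
  "distinct [p, q, r, s, t] \<Longrightarrow> cyc5 p q r s t x = (if x = p then q else if x = q then r
     else if x = r then s else if x = s then t else if x = t then p else x)"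
  by (auto simp: cyc5_def transpose_def)

lemma cyc5_simps:
  assumes "distinct [p, q, r, s, t]"
  shows "cyc5 p q r s t p = q" "cyc5 p q r s t q = r" "cyc5 p q r s t r = s" "cyc5 p q r s t s = t"
    "cyc5 p q r s t t = p"
  using assms by (auto simp: cyc5_apply)

lemma cyc5_moved_iff:
  "distinct [p, q, r, s, t] \<Longrightarrow> cyc5 p q r s t x \<noteq> x \<longleftrightarrow> x \<in> {p, q, r, s, t}"
  by (auto simp: cyc5_apply)

lemma cyc3_rotate: "distinct [p, q, r] \<Longrightarrow> cyc3 q r p = cyc3 p q r"
  by (auto simp: fun_eq_iff cyc3_apply)

lemma cyc3_inv:
  assumes "distinct [p, q, r]"
  shows "inv (cyc3 p q r) = cyc3 p r q"
  by (rule inv_equality) (use assms in \<open>auto simp: cyc3_apply\<close>)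

lemma kcycle_Sym: "is_kcycle n k g \<Longrightarrow> g \<in> Sym n"
  unfolding is_kcycle_def Sym_def using permutes_subset[OF cycle_permutes] by blast

lemma kcycle_conj:
  assumes "p \<in> Sym n" "is_kcycle n k g"
  shows "is_kcycle n k (p \<circ> g \<circ> inv p)"
proof -
  obtain xs where xs: "length xs = k" "distinct xs" "set xs \<subseteq> {..<n}" "g = cycle_of_list xs"
    using assms(2) unfolding is_kcycle_def by blast
  have "p \<circ> g \<circ> inv p = cycle_of_list (map p xs)"
    unfolding xs(4) using xs(2) Sym_bij[OF assms(1)] by (rule conjugation_of_cycle)
  moreover have "distinct (map p xs)"
    using xs(2) assms(1) by (simp add: distinct_map inj_on_def)
  ultimately show ?thesis
    unfolding is_kcycle_def using xs assms(1) by (intro exI[of _ "map p xs"]) simp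
qed

lemma kcycle_conj_iff:
  assumes "p \<in> Sym n"
  shows "is_kcycle n k (p \<circ> g \<circ> inv p) \<longleftrightarrow> is_kcycle n k g"
  using kcycle_conj[OF assms, of k g] kcycle_conj[OF Sym_inv[OF assms], of k "p \<circ> g \<circ> inv p"] assms
  by (auto simp: Sym_unconjugate)

lemma cycle_of_list_rev:
  assumes "distinct xs"
  shows "cycle_of_list (rev xs) (cycle_of_list xs x) = x"
proof (cases "x \<in> set xs")
  case True
  let ?m = "length xs - 1 mod length xs"
  have "map (cycle_of_list xs) xs = rotate 1 (rev (rev xs))"
    using cyclic_rotation[OF assms, of 1] by simp
  also have "\<dots> = rev (rotate ?m (rev xs))"
    by (simp only: rotate_rev length_rev)
  finally have "map (cycle_of_list (rev xs)) (map (cycle_of_list xs) xs)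
      = rev (rotate ?m (map (cycle_of_list (rev xs)) (rev xs)))"
    by (simp only: rev_map rotate_map)
  also have "map (cycle_of_list (rev xs)) (rev xs) = rotate 1 (rev xs)"
    using cyclic_rotation[of "rev xs" 1] assms by simp
  also have "rotate ?m (rotate 1 (rev xs)) = rev xs"
  proof (cases "length xs \<le> 1")
    case True
    then show ?thesis by (cases xs) auto
  next
    case False
    then have "?m + 1 = length (rev xs)" by simp
    then show ?thesis unfolding rotate_rotate by (simp add: rotate_id)
  qed
  finally have "map (cycle_of_list (rev xs) \<circ> cycle_of_list xs) xs = map id xs" by simp
  then show ?thesis using True by (simp only: map_eq_conv) simp
next
  case False
  then show ?thesis using id_outside_supp[of x xs] id_outside_supp[of x "rev xs"] by simp
qed

lemma kcycle_inv:
  assumes "is_kcycle n k g"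
  shows "is_kcycle n k (inv g)"
proof -
  obtain xs where xs: "length xs = k" "distinct xs" "set xs \<subseteq> {..<n}" "g = cycle_of_list xs"
    using assms unfolding is_kcycle_def by blast
  then have "inv g = cycle_of_list (rev xs)"
    using cycle_of_list_rev[OF xs(2)] Sym_bij[OF kcycle_Sym[OF assms]]
    by (intro surj_imp_inv_eq) (auto simp: bij_def)
  then show ?thesis
    unfolding is_kcycle_def using xs by (intro exI[of _ "rev xs"]) simp
qed

lemma kcycle_inv_iff: "g \<in> Sym n \<Longrightarrow> is_kcycle n k (inv g) \<longleftrightarrow> is_kcycle n k g"
  using kcycle_inv[of n k g] kcycle_inv[of n k "inv g"] by auto

lemma kcycle_from:
  assumes "is_kcycle n k g" "g p \<noteq> p"
  obtains xs where "Suc (length xs) = k" "distinct (p # xs)" "set (p # xs) \<subseteq> {..<n}"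
    "g = cycle_of_list (p # xs)"
proof -
  obtain ys where ys: "length ys = k" "distinct ys" "set ys \<subseteq> {..<n}" "g = cycle_of_list ys"
    using assms(1) unfolding is_kcycle_def by blast
  then have "p \<in> set ys" using id_outside_supp[of p ys] assms(2) by blast
  then obtain us vs where split: "ys = us @ p # vs" by (auto dest: split_list)
  have "rotate (length us) ys = p # vs @ us" by (simp add: split rotate_append)
  then have "g = cycle_of_list (p # vs @ us)"
    using cycle_of_list_rotate_independent[OF ys(2), of "length us"] ys(4) by simp
  then show thesis using that[of "vs @ us"] ys split by auto
qed

lemma three_cycle_cyc3: "distinct [p, q, r] \<Longrightarrow> p < n \<Longrightarrow> q < n \<Longrightarrow> r < n \<Longrightarrow> three_cycle n (cyc3 p q r)"
  unfolding is_kcycle_def cyc3_def by (intro exI[of _ "[p, q, r]"]) simp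

lemma five_cycle_cyc5:
  "\<lbrakk>distinct [p, q, r, s, t]; p < n; q < n; r < n; s < n; t < n\<rbrakk> \<Longrightarrow> five_cycle n (cyc5 p q r s t)"
  unfolding is_kcycle_def cyc5_def by (intro exI[of _ "[p, q, r, s, t]"]) simp

lemma three_cycle_from:
  assumes "three_cycle n g" "g p \<noteq> p"
  obtains q r where "distinct [p, q, r]" "p < n" "q < n" "r < n" "g = cyc3 p q r"
proof -
  obtain xs where xs: "Suc (length xs) = 3" "distinct (p # xs)" "set (p # xs) \<subseteq> {..<n}"
    "g = cycle_of_list (p # xs)"
    using kcycle_from[OF assms] .
  from xs(1) obtain q r where "xs = [q, r]"
    by (auto simp: numeral_3_eq_3 length_Suc_conv)
  then show thesis using that[of q r] xs by (simp add: cyc3_def)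
qed

lemma five_cycle_from:
  assumes "five_cycle n g" "g p \<noteq> p"
  obtains q r s t where "distinct [p, q, r, s, t]" "p < n" "q < n" "r < n" "s < n" "t < n"
    "g = cyc5 p q r s t"
proof -
  obtain xs where xs: "Suc (length xs) = 5" "distinct (p # xs)" "set (p # xs) \<subseteq> {..<n}"
    "g = cycle_of_list (p # xs)"
    using kcycle_from[OF assms] .
  from xs(1) obtain q r s t where "xs = [q, r, s, t]"
    by (auto simp: eval_nat_numeral length_Suc_conv)
  then show thesis using that[of q r s t] xs by (simp add: cyc5_def)
qed

lemma kcycle_moves:
  assumes "is_kcycle n k g" "k > 1"
  obtains p where "g p \<noteq> p"
proof -
  obtain xs where xs: "length xs = k" "distinct xs" "g = cycle_of_list xs"
    using assms(1) unfolding is_kcycle_def by blast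
  then have "\<exists>p q ys. xs = p # q # ys"
    using assms(2) by (cases xs; cases "tl xs") auto
  then obtain p q ys where "xs = p # q # ys" by blast
  moreover have "map g xs = rotate1 xs"
    using cyclic_rotation[OF xs(2), of 1] xs(3) by simp
  ultimately have "g p \<noteq> p" using xs(2) by auto
  then show thesis by (rule that)
qed

lemma three_cycle_orbit:
  assumes "three_cycle n g" "g p \<noteq> p"
  shows "g = cyc3 p (g p) (g (g p))" "distinct [p, g p, g (g p)]" "p < n" "g (g (g p)) = p"
proof -
  obtain q r where "distinct [p, q, r]" "p < n" and g: "g = cyc3 p q r"
    using three_cycle_from[OF assms] .
  moreover from this have "g p = q" "g q = r" "g r = p" by (simp_all add: cyc3_apply)
  ultimately show "g = cyc3 p (g p) (g (g p))" "distinct [p, g p, g (g p)]" "p < n" "g (g (g p)) = p"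
    by (simp_all only:)
qed

lemma three_cycle_step:
  assumes g: "three_cycle n g" and step: "g p = q" "p \<noteq> q"
  shows "g = cyc3 p q (g q)" "distinct [p, q, g q]" "p < n" "q < n" "g q < n"
proof -
  have "g p \<noteq> p" using step by simp
  note orbit = three_cycle_orbit[OF g this]
  show "g = cyc3 p q (g q)" using orbit(1) unfolding step(1) .
  show "distinct [p, q, g q]" using orbit(2) unfolding step(1) .
  show "p < n" by (rule orbit(3))
  then show "q < n" "g q < n" using kcycle_Sym[OF g] step(1) by auto
qed

lemma three_cycle_moved_iff:
  assumes "three_cycle n g" "g p \<noteq> p"
  shows "g t \<noteq> t \<longleftrightarrow> t \<in> {p, g p, g (g p)}"
  using three_cycle_orbit(2)[OF assms] by (subst three_cycle_orbit(1)[OF assms]) (auto simp: cyc3_apply)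

lemma three_cycle_cube:
  assumes "three_cycle n g"
  shows "g (g (g t)) = t"
  using three_cycle_orbit(4)[OF assms, of t] by (cases "g t = t") simp_all

lemma three_cycle_inv:
  assumes "three_cycle n g"
  shows "inv g = g \<circ> g"
  by (rule inv_equality) (simp_all add: three_cycle_cube[OF assms])

lemma three_cycle_moved_pair:
  assumes "three_cycle n g" "g p \<noteq> p" "g q \<noteq> q" "p \<noteq> q"
  shows "g p = q \<or> g q = p"
  using three_cycle_moved_iff[OF assms(1,2), of q] three_cycle_cube[OF assms(1), of p] assms by auto

lemma three_cycles_conjugate:
  assumes f: "three_cycle n f" "f x \<noteq> x" and g: "three_cycle n g" "g y \<noteq> y"
    and fixed: "length us = length vs" "distinct us" "distinct vs"
      "\<And>u. u \<in> set us \<Longrightarrow> u < n \<and> f u = u" "\<And>v. v \<in> set vs \<Longrightarrow> v < n \<and> g v = v"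
  obtains p where "p \<in> Sym n" "p \<circ> f \<circ> inv p = g" "p x = y" "map p us = vs"
proof -
  note orbit_f = three_cycle_orbit[OF f] and orbit_g = three_cycle_orbit[OF g]
  have "f u \<noteq> u" if "u \<in> {x, f x, f (f x)}" for u using that three_cycle_moved_iff[OF f] by blast
  then have xs: "distinct ([x, f x, f (f x)] @ us)" "set ([x, f x, f (f x)] @ us) \<subseteq> {..<n}"
    using orbit_f(2,3) fixed(2,4) kcycle_Sym[OF f(1)] by (auto simp: disjoint_iff)
  have "g v \<noteq> v" if "v \<in> {y, g y, g (g y)}" for v using that three_cycle_moved_iff[OF g] by blast
  then have ys: "distinct ([y, g y, g (g y)] @ vs)" "set ([y, g y, g (g y)] @ vs) \<subseteq> {..<n}"
    using orbit_g(2,3) fixed(3,5) kcycle_Sym[OF g(1)] by (auto simp: disjoint_iff)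
  have "\<exists>p\<in>Sym n. map p ([x, f x, f (f x)] @ us) = [y, g y, g (g y)] @ vs"
    using fixed(1) by (intro ex_Sym_map xs ys) simp
  then obtain p where p: "p \<in> Sym n" "map p ([x, f x, f (f x)] @ us) = [y, g y, g (g y)] @ vs" ..
  then have "p \<circ> cyc3 x (f x) (f (f x)) \<circ> inv p = cyc3 y (g y) (g (g y))"
    unfolding cyc3_def using conjugation_of_cycle[OF orbit_f(2) Sym_bij[OF p(1)]] by simp
  then have "p \<circ> f \<circ> inv p = g"
    unfolding orbit_f(1)[symmetric] orbit_g(1)[symmetric] .
  then show thesis using that p by simp
qed

lemma five_cycle_not_three_cycle:
  assumes "five_cycle n f"
  shows "\<not> three_cycle n f"
proof
  assume three: "three_cycle n f"
  obtain p where "f p \<noteq> p" using kcycle_moves[OF assms] by auto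
  then obtain q r s t where "distinct [p, q, r, s, t]" "f = cyc5 p q r s t"
    using five_cycle_from[OF assms] by metis
  then show False using three_cycle_cube[OF three, of p] by (auto simp: cyc5_apply)
qed

lemma five_cycle_not_involution:
  assumes "five_cycle n f"
  shows "f \<circ> f \<noteq> id"
proof
  assume "f \<circ> f = id"
  obtain p where "f p \<noteq> p" using kcycle_moves[OF assms] by auto
  then obtain q r s t where "distinct [p, q, r, s, t]" "f = cyc5 p q r s t"
    using five_cycle_from[OF assms] by metis
  then show False using fun_cong[OF \<open>f \<circ> f = id\<close>, of p] by (auto simp: cyc5_apply)
qed

section \<open>Products of two three-cycles\<close>

lemma cyc3_comp_cyc3:
  assumes "distinct [p, q, r, s, t]"
  shows "cyc3 p s t \<circ> cyc3 p q r = cyc5 p q r s t"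
proof
  fix x
  consider "x = p" | "x = q" | "x = r" | "x = s" | "x = t" | "x \<notin> {p, q, r, s, t}" by blast
  then show "(cyc3 p s t \<circ> cyc3 p q r) x = cyc5 p q r s t x"
    by cases (use assms distinct_rev[THEN iffD2, OF assms] in \<open>simp_all add: cyc5_apply cyc3_apply\<close>)
qed

lemma three_cycle_comp_one_shared:
  assumes g: "three_cycle n g" and h: "three_cycle n h" and p: "g p \<noteq> p" "h p \<noteq> p"
    and shared: "\<forall>t. g t \<noteq> t \<and> h t \<noteq> t \<longrightarrow> t = p"
  shows "g \<circ> h = cyc5 p (h p) (h (h p)) (g p) (g (g p))"
    and "distinct [p, h p, h (h p), g p, g (g p)]"
    and "five_cycle n (g \<circ> h)"
proof -
  note orbit_g = three_cycle_orbit[OF g p(1)] and orbit_h = three_cycle_orbit[OF h p(2)]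
  have "h (g p) = g p" "h (g (g p)) = g (g p)"
    using spec[OF shared, of "g p"] spec[OF shared, of "g (g p)"] orbit_g(2,4) by auto
  then have "g p \<notin> {p, h p, h (h p)}" "g (g p) \<notin> {p, h p, h (h p)}"
    unfolding three_cycle_moved_iff[OF h p(2), symmetric] by simp_all
  then have "{p, h p, h (h p)} \<inter> {g p, g (g p)} = {}" by (simp add: disjoint_iff)
  then show distinct: "distinct [p, h p, h (h p), g p, g (g p)]"
    using orbit_g(2) orbit_h(2) distinct_append[of "[p, h p, h (h p)]" "[g p, g (g p)]"] by simp
  show product: "g \<circ> h = cyc5 p (h p) (h (h p)) (g p) (g (g p))"
    unfolding cyc3_comp_cyc3[OF distinct, symmetric] orbit_g(1)[symmetric] orbit_h(1)[symmetric] ..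
  show "five_cycle n (g \<circ> h)"
    unfolding product using distinct orbit_g(3) kcycle_Sym[OF g] kcycle_Sym[OF h]
    by (intro five_cycle_cyc5) simp_all
qed

lemma cyc3_comp_parallel:
  assumes "distinct [p, q, r, s]"
  shows "cyc3 p q s \<circ> cyc3 p q r = transpose p s \<circ> transpose q r"
proof
  fix x
  consider "x = p" | "x = q" | "x = r" | "x = s" | "x \<notin> {p, q, r, s}" by blast
  then show "(cyc3 p q s \<circ> cyc3 p q r) x = (transpose p s \<circ> transpose q r) x"
    by cases (use assms distinct_rev[THEN iffD2, OF assms] in \<open>simp_all add: cyc3_apply transpose_def\<close>)
qed

lemma cyc3_comp_antiparallel:
  assumes "distinct [p, q, r, s]"
  shows "cyc3 q p s \<circ> cyc3 p q r = cyc3 q r s"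
proof
  fix x
  consider "x = p" | "x = q" | "x = r" | "x = s" | "x \<notin> {p, q, r, s}" by blast
  then show "(cyc3 q p s \<circ> cyc3 p q r) x = cyc3 q r s x"
    by cases (use assms distinct_rev[THEN iffD2, OF assms] in \<open>simp_all add: cyc3_apply\<close>)
qed

lemma three_cycle_comp_parallel:
  assumes g: "three_cycle n g" "g p = q" and h: "three_cycle n h" "h p = q" and "p \<noteq> q"
  shows "three_cycle n (g \<circ> h) \<or> (g \<circ> h) \<circ> (g \<circ> h) = id"
proof -
  obtain r where r: "h = cyc3 p q r" "distinct [p, q, r]"
    using three_cycle_step[OF h \<open>p \<noteq> q\<close>] by blast
  obtain s where s: "g = cyc3 p q s" "distinct [p, q, s]"
    using three_cycle_step[OF g \<open>p \<noteq> q\<close>] by blast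
  show ?thesis
  proof (cases "r = s")
    case True
    then have "g \<circ> h = inv h" using three_cycle_inv[OF h(1)] by (simp only: r(1) s(1))
    then show ?thesis using kcycle_inv[OF h(1)] by simp
  next
    case False
    then have "g \<circ> h = transpose p s \<circ> transpose q r"
      unfolding r(1) s(1) using r(2) s(2) by (intro cyc3_comp_parallel) simp
    moreover have "transpose p s (transpose q r x) = transpose q r (transpose p s x)" for x
      using False r(2) s(2) by (auto simp: transpose_def)
    ultimately show ?thesis by (simp add: fun_eq_iff)
  qed
qed

lemma three_cycle_comp_antiparallel:
  assumes g: "three_cycle n g" "g q = p" and h: "three_cycle n h" "h p = q" and "p \<noteq> q"
  shows "three_cycle n (g \<circ> h) \<or> g \<circ> h = id"
proof -
  obtain r where r: "h = cyc3 p q r" "distinct [p, q, r]" "q < n" "r < n"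
    using three_cycle_step[OF h \<open>p \<noteq> q\<close>] by blast
  obtain s where s: "g = cyc3 q p s" "distinct [q, p, s]" "s < n"
    using three_cycle_step[OF g \<open>p \<noteq> q\<close>[symmetric]] by blast
  show ?thesis
  proof (cases "r = s")
    case True
    then have "g = inv h"
      using r(2) s(2) cyc3_rotate[of q p r] by (simp add: r(1) s(1) cyc3_inv)
    then show ?thesis using kcycle_Sym[OF h(1)] by simp
  next
    case False
    then have "g \<circ> h = cyc3 q r s"
      unfolding r(1) s(1) using r(2) s(2) by (intro cyc3_comp_antiparallel) simp
    moreover have "three_cycle n (cyc3 q r s)"
      using False r s by (intro three_cycle_cyc3) auto
    ultimately show ?thesis by simp
  qed
qed

lemma three_cycle_comp_two_shared:
  assumes g: "three_cycle n g" and h: "three_cycle n h"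
    and shared: "g p \<noteq> p" "h p \<noteq> p" "g q \<noteq> q" "h q \<noteq> q" "p \<noteq> q"
  shows "three_cycle n (g \<circ> h) \<or> (g \<circ> h) \<circ> (g \<circ> h) = id"
proof -
  have "g p = q \<or> g q = p" "h p = q \<or> h q = p"
    using three_cycle_moved_pair[OF g] three_cycle_moved_pair[OF h] shared by blast+
  then consider (parallel) x y where "g x = y" "h x = y" "x \<noteq> y"
    | (antiparallel) x y where "g y = x" "h x = y" "x \<noteq> y"
    using shared(5) by metis
  then show ?thesis
  proof cases
    case parallel
    then show ?thesis using three_cycle_comp_parallel[OF g _ h] by blast
  next
    case antiparallel
    then show ?thesis using three_cycle_comp_antiparallel[OF g _ h] by fastforce
  qed
qed

lemma three_cycle_comp_overlapping:
  assumes g: "three_cycle n g" and h: "three_cycle n h" and p: "g p \<noteq> p" "h p \<noteq> p"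
  shows "five_cycle n (g \<circ> h) \<or> three_cycle n (g \<circ> h) \<or> (g \<circ> h) \<circ> (g \<circ> h) = id"
proof (cases "\<exists>q. q \<noteq> p \<and> g q \<noteq> q \<and> h q \<noteq> q")
  case True
  then show ?thesis using three_cycle_comp_two_shared[OF g h p] by blast
next
  case False
  then have "\<forall>t. g t \<noteq> t \<and> h t \<noteq> t \<longrightarrow> t = p" by blast
  then show ?thesis using three_cycle_comp_one_shared(3)[OF g h p] by blast
qed

definition factorizations :: "nat \<Rightarrow> (nat \<Rightarrow> nat) \<Rightarrow> ((nat \<Rightarrow> nat) \<times> (nat \<Rightarrow> nat)) set" where
  "factorizations n f = {(g, h). three_cycle n g \<and> three_cycle n h \<and> g \<circ> h = f}"

lemma factorizationsI:
  "three_cycle n g \<Longrightarrow> three_cycle n h \<Longrightarrow> g \<circ> h = f \<Longrightarrow> (g, h) \<in> factorizations n f"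
  by (simp add: factorizations_def)

lemma factorizationsD:
  assumes "(g, h) \<in> factorizations n f"
  shows "three_cycle n g \<and> three_cycle n h \<and> g \<circ> h = f \<and> g \<in> Sym n \<and> h \<in> Sym n"
  using assms by (auto simp: factorizations_def kcycle_Sym)

lemma sum_Sym_factorizations:
  "(\<Sum>h\<in>Sym n. if three_cycle n h \<and> three_cycle n (f \<circ> inv h) then F (f \<circ> inv h) h else 0)
     = (\<Sum>(g, h)\<in>factorizations n f. F g h)"
proof -
  have "(\<Sum>h\<in>Sym n. if three_cycle n h \<and> three_cycle n (f \<circ> inv h) then F (f \<circ> inv h) h else 0)
      = (\<Sum>h\<in>{h \<in> Sym n. three_cycle n h \<and> three_cycle n (f \<circ> inv h)}. F (f \<circ> inv h) h)"
    by (simp add: sum.inter_filter)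
  also have "\<dots> = (\<Sum>(g, h)\<in>factorizations n f. F g h)"
    by (rule sum.reindex_bij_witness[of _ snd "\<lambda>h. (f \<circ> inv h, h)"])
       (auto intro: factorizationsI dest!: factorizationsD)
  finally show ?thesis .
qed

lemma sum_factorizations_rotate:
  "(\<Sum>(g, h)\<in>factorizations n f. F g h) = (\<Sum>(g, h)\<in>factorizations n f. F (g \<circ> h \<circ> inv g) g)"
proof -
  have "three_cycle n (inv h \<circ> g \<circ> h)" "h \<circ> (inv h \<circ> g \<circ> h) = g \<circ> h"
    if "h \<in> Sym n" "three_cycle n g" for g h
    using kcycle_conj[OF Sym_inv[OF that(1)] that(2)] that(1) by (simp_all add: fun_eq_iff)
  then show ?thesis
    by (intro sum.reindex_bij_witness[of _ "\<lambda>(g, h). (g \<circ> h \<circ> inv g, g)" "\<lambda>(g, h). (h, inv h \<circ> g \<circ> h)"])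
       (auto intro!: factorizationsI kcycle_conj dest!: factorizationsD simp: Sym_unconjugate)
qed

lemma sum_factorizations_inv:
  assumes "f \<in> Sym n"
  shows "(\<Sum>(g, h)\<in>factorizations n (inv f). F g h) = (\<Sum>(g, h)\<in>factorizations n f. F (inv h) (inv g))"
proof -
  define T where "T = (\<lambda>(g :: nat \<Rightarrow> nat, h :: nat \<Rightarrow> nat). (inv h, inv g))"
  have T: "T x \<in> factorizations n (inv f)" "T (T x) = x" if x: "x \<in> factorizations n f" for f x
  proof -
    obtain g h where gh: "x = (g, h)" by (cases x)
    then show "T x \<in> factorizations n (inv f)" "T (T x) = x"
      using factorizationsD[OF x[unfolded gh]] Sym_inv_of_comp[of g n h]
      by (auto simp: T_def intro!: factorizationsI kcycle_inv)
  qed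
  have "T x \<in> factorizations n f" if "x \<in> factorizations n (inv f)" for x
    using T(1)[OF that] assms by simp
  then have "(\<Sum>x\<in>factorizations n (inv f). case_prod F x) = (\<Sum>x\<in>factorizations n f. case_prod F (T x))"
    by (intro sum.reindex_bij_witness[of _ T T]) (simp_all add: T)
  then show ?thesis by (simp add: T_def split_def)
qed

lemma sum_factorizations_conj:
  assumes p: "p \<in> Sym n"
  shows "(\<Sum>(g, h)\<in>factorizations n (p \<circ> f \<circ> inv p). F g h)
    = (\<Sum>(g, h)\<in>factorizations n f. F (p \<circ> g \<circ> inv p) (p \<circ> h \<circ> inv p))"
proof -
  have "(p \<circ> g \<circ> inv p, p \<circ> h \<circ> inv p) \<in> factorizations n (p \<circ> f \<circ> inv p)"
    if "(g, h) \<in> factorizations n f" "p \<in> Sym n" for p f g h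
    using factorizationsD[OF that(1)] that(2)
    by (intro factorizationsI kcycle_conj) (auto simp: fun_eq_iff)
  from this[OF _ p] this[OF _ Sym_inv[OF p], of _ _ "p \<circ> f \<circ> inv p"] show ?thesis
    by (intro sum.reindex_bij_witness[of _ "\<lambda>(g, h). (p \<circ> g \<circ> inv p, p \<circ> h \<circ> inv p)"
          "\<lambda>(g, h). (inv p \<circ> g \<circ> p, inv p \<circ> h \<circ> p)"])
       (use p in \<open>auto simp: Sym_unconjugate\<close>)
qed

lemma five_cycle_factors_meet:
  assumes g: "three_cycle n g" and h: "three_cycle n h" and five: "five_cycle n (g \<circ> h)"
  shows "\<exists>p. g p \<noteq> p \<and> h p \<noteq> p"
proof (rule ccontr)
  let ?f = "g \<circ> h"
  assume "\<nexists>p. g p \<noteq> p \<and> h p \<noteq> p"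
  then have "g (h x) = h (g x)" for x
    by (metis three_cycle_cube[OF g] three_cycle_cube[OF h])
  then have cube: "?f (?f (?f x)) = x" for x
    by (simp add: three_cycle_cube[OF g] three_cycle_cube[OF h])
  obtain p where "?f p \<noteq> p" using kcycle_moves[OF five] by auto
  then obtain q r s t where "distinct [p, q, r, s, t]" "?f = cyc5 p q r s t"
    using five_cycle_from[OF five] by metis
  then show False using cube[of p] cyc5_simps[of p q r s t] by auto
qed

abbreviation factors_at :: "(nat \<Rightarrow> nat) \<Rightarrow> nat \<Rightarrow> (nat \<Rightarrow> nat) \<times> (nat \<Rightarrow> nat)" where
  "factors_at f x \<equiv> (cyc3 x (f (f (f x))) (f (f (f (f x)))), cyc3 x (f x) (f (f x)))"

lemma five_cycle_factorizations:
  assumes f: "five_cycle n f"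
  shows "factorizations n f = factors_at f ` {x. f x \<noteq> x}"
proof (intro subset_antisym subsetI)
  fix y assume "y \<in> factorizations n f"
  then obtain g h where g: "three_cycle n g" and h: "three_cycle n h" and gh: "g \<circ> h = f"
    and y: "y = (g, h)"
    by (auto simp: factorizations_def)
  have "five_cycle n (g \<circ> h)" using f gh by simp
  then obtain p where p: "g p \<noteq> p" "h p \<noteq> p"
    using five_cycle_factors_meet[OF g h] by blast
  have shared: "\<forall>t. g t \<noteq> t \<and> h t \<noteq> t \<longrightarrow> t = p"
    using three_cycle_comp_two_shared[OF g h p] gh
      five_cycle_not_three_cycle[OF f] five_cycle_not_involution[OF f] by blast
  note product = three_cycle_comp_one_shared[OF g h p shared]
  have f_orbit: "f p = h p" "f (h p) = h (h p)" "f (h (h p)) = g p" "f (g p) = g (g p)"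
    by (rule cyc5_simps[OF product(2), folded product(1), unfolded gh])+
  then have "factors_at f p = (cyc3 p (g p) (g (g p)), cyc3 p (h p) (h (h p)))" by simp
  also have "\<dots> = y"
    unfolding y three_cycle_orbit(1)[OF g p(1), symmetric] three_cycle_orbit(1)[OF h p(2), symmetric] ..
  finally show "y \<in> factors_at f ` {x. f x \<noteq> x}"
    using f_orbit(1) p(2) by (intro image_eqI[of _ _ p]) simp_all
next
  fix y assume "y \<in> factors_at f ` {x. f x \<noteq> x}"
  then obtain x where x: "f x \<noteq> x" "y = factors_at f x" by blast
  obtain q r s t where d: "distinct [x, q, r, s, t]"
    and "x < n" "q < n" "r < n" "s < n" "t < n" "f = cyc5 x q r s t"
    using five_cycle_from[OF f x(1)] .
  moreover from this have "y = (cyc3 x s t, cyc3 x q r)" by (simp add: x(2) cyc5_simps[OF d])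
  ultimately show "y \<in> factorizations n f"
    unfolding factorizations_def by (simp add: three_cycle_cyc3 cyc3_comp_cyc3[OF d])
qed

lemma sum_five_cycle_factorizations:
  assumes f: "five_cycle n f"
  shows "(\<Sum>(g, h)\<in>factorizations n f. F g h) =
    (\<Sum>x | f x \<noteq> x. case_prod F (factors_at f x))"
proof -
  have "inj_on (factors_at f) {x. f x \<noteq> x}"
  proof (rule inj_onI)
    fix x y
    assume "x \<in> {x. f x \<noteq> x}" "y \<in> {x. f x \<noteq> x}"
    then have x: "f x \<noteq> x" and y: "f y \<noteq> y" by auto
    assume eq: "factors_at f x = factors_at f y"
    obtain q r s t where x': "distinct [x, q, r, s, t]" "f = cyc5 x q r s t"
      using five_cycle_from[OF f x] by metis
    obtain q' r' s' t' where y': "distinct [y, q', r', s', t']" "f = cyc5 y q' r' s' t'"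
      using five_cycle_from[OF f y] by metis
    have "f x = q" "f q = r" "f r = s" "f s = t" "f y = q'" "f q' = r'" "f r' = s'" "f s' = t'"
      by (rule cyc5_simps[OF x'(1), folded x'(2)] cyc5_simps[OF y'(1), folded y'(2)])+
    then have "cyc3 x s t = cyc3 y s' t'" "cyc3 x q r = cyc3 y q' r'"
      using eq by simp_all
    then have "cyc3 x s t y \<noteq> y" "cyc3 x q r y \<noteq> y"
      using y'(1) by (auto simp: cyc3_apply)
    then show "x = y" using x'(1) by (auto simp: cyc3_apply split: if_splits)
  qed
  then show ?thesis
    unfolding five_cycle_factorizations[OF f] by (simp add: sum.reindex)
qed

lemma sum_factorizations_cyc5:
  assumes d: "distinct [p, q, r, s, t]" and less: "p < n" "q < n" "r < n" "s < n" "t < n"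
  shows "(\<Sum>(g, h)\<in>factorizations n (cyc5 p q r s t). F g h) =
     F (cyc3 p s t) (cyc3 p q r) + F (cyc3 q t p) (cyc3 q r s) + F (cyc3 r p q) (cyc3 r s t)
   + F (cyc3 s q r) (cyc3 s t p) + F (cyc3 t r s) (cyc3 t p q)"
proof -
  have moved: "{x. cyc5 p q r s t x \<noteq> x} = {p, q, r, s, t}"
    using cyc5_moved_iff[OF d] by blast
  show ?thesis
    unfolding sum_five_cycle_factorizations[OF five_cycle_cyc5[OF d less]] moved
    using d by (simp add: cyc5_simps[OF d] add.assoc)
qed

lemma five_cycle_factors_fixed:
  assumes f: "five_cycle n f" and gh: "(g, h) \<in> factorizations n f" and fixed: "f x = x"
  shows "h x = x" "g x = x"
proof -
  obtain p where p: "f p \<noteq> p" "g = cyc3 p (f (f (f p))) (f (f (f (f p))))" "h = cyc3 p (f p) (f (f p))"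
    using gh unfolding five_cycle_factorizations[OF f] by blast
  obtain q r s t where d: "distinct [p, q, r, s, t]" and f_eq: "f = cyc5 p q r s t"
    using five_cycle_from[OF f p(1)] .
  then have gh_eq: "g = cyc3 p s t" "h = cyc3 p q r"
    using p(2,3) by (simp_all add: cyc5_simps[OF d])
  have "x \<notin> {p, q, r, s, t}"
    using fixed cyc5_moved_iff[OF d, of x] unfolding f_eq by blast
  then show "h x = x" "g x = x"
    using d by (simp_all add: gh_eq cyc3_apply)
qed

section \<open>The family of cochains\<close>

text \<open>The 2-form \<open>\<omega>\<^sub>g = \<Sum> e\<^sub>i\<^sup>* \<and> e\<^sub>g\<^sub>i\<^sup>*\<close>.\<close>

definition perm_form :: "(nat \<Rightarrow> nat) \<Rightarrow> nat \<Rightarrow> nat \<Rightarrow> complex" where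
  "perm_form g i j = of_bool (g i = j) - of_bool (g j = i)"

definition moved :: "(nat \<Rightarrow> nat) \<Rightarrow> nat \<Rightarrow> complex" where
  "moved g k = of_bool (g k \<noteq> k)"

definition five_form :: "(nat \<Rightarrow> nat) \<Rightarrow> nat \<Rightarrow> nat \<Rightarrow> complex" where
  "five_form g i j = 2 * perm_form (g \<circ> g) i j - perm_form g i j"

definition family_linear :: "nat \<Rightarrow> complex \<Rightarrow> complex \<Rightarrow> (nat \<Rightarrow> nat) \<Rightarrow> nat \<Rightarrow> nat \<Rightarrow> nat \<Rightarrow> complex" where
  "family_linear n a b g i j k
      = (if three_cycle n g then perm_form g i j * (if g k \<noteq> k then a else b) else 0)"

definition family_const :: "nat \<Rightarrow> complex \<Rightarrow> complex \<Rightarrow> complex \<Rightarrow> (nat \<Rightarrow> nat) \<Rightarrow> nat \<Rightarrow> nat \<Rightarrow> complex" where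
  "family_const n a b c g i j = (if three_cycle n g then c * perm_form g i j
     else if five_cycle n g then (a - b)^2 * five_form g i j else 0)"

definition family :: "nat \<Rightarrow> complex \<Rightarrow> complex \<Rightarrow> complex \<Rightarrow> cochain" where
  "family n a b c g i j w
      = (case w of [] \<Rightarrow> family_const n a b c g i j | k # _ \<Rightarrow> family_linear n a b g i j k)"

lemma family_simps [simp]:
  "family n a b c g i j [] = family_const n a b c g i j"
  "family n a b c g i j [k] = family_linear n a b g i j k"
  by (simp_all add: family_def)

lemma perm_form_alternating: "perm_form g j i = - perm_form g i j"
  by (simp add: perm_form_def)

lemma perm_form_fixed:
  assumes "g \<in> Sym n" "g i = i \<or> g j = j"
  shows "perm_form g i j = 0"
  using assms Sym_eq_iff[OF assms(1), of i j] by (auto simp: perm_form_def)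

lemma perm_form_conj: "p \<in> Sym n \<Longrightarrow> perm_form (p \<circ> g \<circ> inv p) (p i) (p j) = perm_form g i j"
  by (simp add: perm_form_def)

lemma perm_form_inv: "g \<in> Sym n \<Longrightarrow> perm_form (inv g) i j = - perm_form g i j"
  using Sym_inv_eq_iff[of g n i j] Sym_inv_eq_iff[of g n j i] by (auto simp: perm_form_def)

lemma five_form_alternating: "five_form g j i = - five_form g i j"
  unfolding five_form_def perm_form_alternating[of _ j i] by simp

lemma five_form_fixed: "g \<in> Sym n \<Longrightarrow> g i = i \<or> g j = j \<Longrightarrow> five_form g i j = 0"
  using perm_form_fixed[of g n i j] perm_form_fixed[of "g \<circ> g" n i j] by (auto simp: five_form_def)

lemma five_form_conj: "p \<in> Sym n \<Longrightarrow> five_form (p \<circ> g \<circ> inv p) (p i) (p j) = five_form g i j"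
  by (simp add: five_form_def perm_form_def)

lemma moved_conj: "p \<in> Sym n \<Longrightarrow> moved (p \<circ> g \<circ> inv p) k = moved g (inv p k)"
  using Sym_inv_eq_iff[of p n k "g (inv p k)"] by (auto simp: moved_def)

lemma moved_inv: "g \<in> Sym n \<Longrightarrow> moved (inv g) k = moved g k"
  using Sym_inv_eq_iff[of g n k k] by (auto simp: moved_def)

interpretation family: alternating_cochain n "family n a b c" for n a b c
proof
  fix g i j w
  show "family n a b c g j i w = - family n a b c g i j w"
    unfolding family_def family_const_def family_linear_def perm_form_alternating[of g j i]
      five_form_alternating[of g j i]
    by (simp split: list.split)
qed

lemma family_invariant:
  assumes "p \<in> Sym n"
  shows "family n a b c (p \<circ> h \<circ> inv p) (p i) (p j) (map p w) = family n a b c h i j w"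
proof -
  have "(p \<circ> h \<circ> inv p) (p k) \<noteq> p k \<longleftrightarrow> h k \<noteq> k" for k using assms by simp
  then show ?thesis
    unfolding family_def family_const_def family_linear_def kcycle_conj_iff[OF assms]
      perm_form_conj[OF assms] five_form_conj[OF assms]
    by (simp only: list.case_eq_if map_is_Nil_conv) (auto simp: hd_map)
qed

lemma three_cycle_form_eq:
  assumes g: "three_cycle n g" and alternating: "B j i = - B i j"
    and fixed: "g i = i \<or> g j = j \<Longrightarrow> B i j = 0"
    and step: "\<And>x. x \<in> {i, j} \<Longrightarrow> g x \<noteq> x \<Longrightarrow> B x (g x) = (c :: complex)"
  shows "B i j = c * perm_form g i j"
proof (cases "g i = i \<or> g j = j \<or> i = j")
  case True
  then have "B i j = 0" using alternating fixed by auto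
  moreover have "perm_form g i j = 0"
    using True perm_form_fixed[OF kcycle_Sym[OF g], of i j] by (auto simp: perm_form_def)
  ultimately show ?thesis by simp
next
  case False
  then consider (forward) "g i = j" | (backward) "g j = i" using three_cycle_moved_pair[OF g] by blast
  then show ?thesis
  proof cases
    case forward
    then have "perm_form g i j = 1" using three_cycle_step(2)[OF g forward] False
      by (auto simp: perm_form_def)
    then show ?thesis using step[of i] forward False by simp
  next
    case backward
    then have "perm_form g i j = - 1" using three_cycle_step(2)[OF g backward] False
      by (auto simp: perm_form_def)
    moreover have "B i j = - B j i" using alternating by simp
    ultimately show ?thesis using step[of j] backward False by simp
  qed
qed

text \<open>The coefficient of \<open>e\<^sub>l\<close> in \<open>g e\<^sub>k - e\<^sub>k\<close>.\<close>

abbreviation displacement :: "(nat \<Rightarrow> nat) \<Rightarrow> nat \<Rightarrow> nat \<Rightarrow> complex" where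
  "displacement g l k \<equiv> of_bool (l = g k) - of_bool (l = k)"

text \<open>The vector identity \<open>\<Sum> \<omega>\<^sub>h(e\<^sub>i, e\<^sub>j) (h e\<^sub>k - e\<^sub>k) = 0\<close>, tested against a linear functional \<open>S\<close>.\<close>

lemma three_cycle_form_translation:
  fixes S :: "nat \<Rightarrow> complex"
  assumes h: "three_cycle n h"
  shows "cyclic_sum (\<lambda>i j k. perm_form h i j * (S (h k) - S k)) i j k = 0"
proof (cases "h i = i \<or> h j = j \<or> h k = k")
  case True
  then show ?thesis
    using perm_form_fixed[OF kcycle_Sym[OF h]] by auto
next
  case False
  then have i: "h i \<noteq> i" and "j \<in> {i, h i, h (h i)}" "k \<in> {i, h i, h (h i)}"
    using three_cycle_moved_iff[OF h, of i] by auto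
  moreover have "h i \<noteq> i" "h (h i) \<noteq> i" "h (h i) \<noteq> h i" "h (h (h i)) = i"
    using three_cycle_orbit(2,4)[OF h i] by auto
  ultimately show ?thesis
    by (elim insertE) (auto simp: perm_form_def)
qed

lemma sum_perm_form:
  assumes "g \<in> Sym n" "x < n"
  shows "(\<Sum>m<n. F m * perm_form g m x) = F (inv g x) - F (g x)"
proof -
  have "g m = x \<longleftrightarrow> m = inv g x" for m using assms by auto
  then have "F m * perm_form g m x = of_bool (m = inv g x) * F m - of_bool (m = g x) * F m" for m
    by (simp add: perm_form_def right_diff_distrib eq_commute[of "g x"] mult.commute)
  then show ?thesis
    using assms by (simp add: sum_subtractf sum_of_bool_delta del: sum_of_bool_mult_eq)
qed

lemma sum_perm_form_eq_0: "g \<in> Sym n \<Longrightarrow> x < n \<Longrightarrow> (\<Sum>m<n. perm_form g m x) = 0"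
  using sum_perm_form[of g n x "\<lambda>_. 1"] by simp

lemma sum_five_form_eq_0: "g \<in> Sym n \<Longrightarrow> x < n \<Longrightarrow> (\<Sum>m<n. five_form g m x) = 0"
  using sum_perm_form_eq_0[of g n x] sum_perm_form_eq_0[of "g \<circ> g" n x]
  by (simp add: five_form_def sum_subtractf sum_distrib_left[symmetric])

lemma sum_family_const_eq_0:
  assumes "g \<in> Sym n" "x < n"
  shows "(\<Sum>m<n. family_const n a b c g m x) = 0"
  using sum_perm_form_eq_0[OF assms] sum_five_form_eq_0[OF assms]
  unfolding family_const_def
  by (cases "three_cycle n g"; cases "five_cycle n g") (simp_all add: sum_distrib_left[symmetric])

lemma family_quadratic_antisym:
  assumes "h \<in> Sym n"
  shows "family.jacobi_quadratic n a b c i j k h m l + family.jacobi_quadratic n a b c i j k h l m = 0"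
proof (cases "three_cycle n h")
  case True
  define u where "u t = (if h t \<noteq> t then a else b)" for t
  have translation: "cyclic_sum (\<lambda>i j k. perm_form h i j * displacement h l k) i j k = 0" for l
    by (rule three_cycle_form_translation[OF True])
  have "family.jacobi_quadratic n a b c i j k h m l + family.jacobi_quadratic n a b c i j k h l m =
     u m * cyclic_sum (\<lambda>i j k. perm_form h i j * displacement h l k) i j k
   + u l * cyclic_sum (\<lambda>i j k. perm_form h i j * displacement h m k) i j k"
    using True unfolding family.jacobi_quadratic_def family_simps family_linear_def u_def[symmetric]
    by (simp only: if_True) (simp add: algebra_simps)
  then show ?thesis by (simp only: translation) simp
next
  case False
  then show ?thesis by (simp add: family.jacobi_quadratic_def family_linear_def)
qed

section \<open>The linear obstruction\<close>

text \<open>The contraction of \<open>\<omega>\<^sub>g\<close> with the sum of the basis vectors moved by \<open>h\<close>.\<close>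

definition contraction :: "(nat \<Rightarrow> nat) \<Rightarrow> (nat \<Rightarrow> nat) \<Rightarrow> nat \<Rightarrow> complex" where
  "contraction g h x = moved h (inv g x) - moved h (g x)"

definition pair_obstruction :: "nat \<Rightarrow> nat \<Rightarrow> nat \<Rightarrow> (nat \<Rightarrow> nat) \<Rightarrow> (nat \<Rightarrow> nat) \<Rightarrow> complex" where
  "pair_obstruction i j k g h = cyclic_sum (\<lambda>i j k. perm_form h i j * contraction g h k) i j k"

lemma contraction_fixed: "g \<in> Sym n \<Longrightarrow> g x = x \<Longrightarrow> contraction g h x = 0"
  using Sym_inv_eq_iff[of g n x x] by (simp add: contraction_def)

lemma sum_family_linear_family_linear:
  assumes "x < n"
  shows "(\<Sum>m<n. family_linear n a b h i j m * family_linear n a b g m x l) =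
    (if three_cycle n h \<and> three_cycle n g
     then (a - b) * (b + (a - b) * moved g l) * (perm_form h i j * contraction g h x) else 0)"
proof (cases "three_cycle n h \<and> three_cycle n g")
  case True
  then have g: "g \<in> Sym n" using kcycle_Sym by blast
  let ?u = "b + (a - b) * moved g l"
  have "family_linear n a b h i j m * family_linear n a b g m x l =
      perm_form h i j * ?u * (b * perm_form g m x + (a - b) * (moved h m * perm_form g m x))" for m
    using True by (simp add: family_linear_def moved_def algebra_simps)
  then have "(\<Sum>m<n. family_linear n a b h i j m * family_linear n a b g m x l) =
      perm_form h i j * ?u * (b * (\<Sum>m<n. perm_form g m x)
        + (a - b) * (\<Sum>m<n. moved h m * perm_form g m x))"
    by (simp only: sum_distrib_left[symmetric] sum.distrib)
  then show ?thesis
    using True sum_perm_form_eq_0[OF g assms] sum_perm_form[OF g assms, of "moved h"]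
    by (simp add: contraction_def)
qed (auto simp: family_linear_def)

lemma family_lower_linear:
  assumes ijk: "i < n" "j < n" "k < n"
  shows "family.jacobi_lower n a b c i j k f [l] =
    2 * ((a - b) * (\<Sum>(g, h)\<in>factorizations n f. (b + (a - b) * moved g l) * pair_obstruction i j k g h)
       + cyclic_sum (\<lambda>i j k. family_const n a b c f i j * displacement f l k) i j k)"
proof -
  define K where "K h i j k = (\<Sum>m<n. family_linear n a b h i j m *
      (family_linear n a b (f \<circ> inv h) m (h k) l + family_linear n a b (f \<circ> inv h) m k l))" for h i j k
  define T where "T g h = (b + (a - b) * moved g l) * pair_obstruction i j k g h" for g h
  have "cyclic_sum (K h) i j k =
      2 * (a - b) * (if three_cycle n h \<and> three_cycle n (f \<circ> inv h) then T (f \<circ> inv h) h else 0)"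
    if h: "h \<in> Sym n" for h
  proof (cases "three_cycle n h \<and> three_cycle n (f \<circ> inv h)")
    case True
    let ?g = "f \<circ> inv h" and ?u = "(a - b) * (b + (a - b) * moved (f \<circ> inv h) l)"
    have K: "K h i j k = ?u * (perm_form h i j * (contraction ?g h (h k) + contraction ?g h k))"
      if "k < n" for i j k
      using h that True sum_family_linear_family_linear[of "h k" n a b h i j ?g l]
        sum_family_linear_family_linear[of k n a b h i j ?g l]
      by (simp add: K_def distrib_left sum.distrib)
    have "cyclic_sum (\<lambda>i j k. perm_form h i j * (contraction ?g h (h k) - contraction ?g h k)) i j k = 0"
      using True by (intro three_cycle_form_translation) blast
    then have "cyclic_sum (\<lambda>i j k. perm_form h i j * (contraction ?g h (h k) + contraction ?g h k)) i j k
        = 2 * pair_obstruction i j k ?g h"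
      unfolding pair_obstruction_def by (simp add: algebra_simps)
    then show ?thesis
      using True ijk by (simp add: K T_def distrib_left[symmetric])
  qed (use ijk h in \<open>auto simp: K_def distrib_left sum.distrib sum_family_linear_family_linear\<close>)
  then have "(\<Sum>h\<in>Sym n. cyclic_sum (K h) i j k) = 2 * (a - b) * (\<Sum>(g, h)\<in>factorizations n f. T g h)"
    by (simp add: sum_distrib_left[symmetric] sum_Sym_factorizations)
  moreover have "family.jacobi_lower n a b c i j k f [l] = (\<Sum>h\<in>Sym n. cyclic_sum (K h) i j k)
      + 2 * cyclic_sum (\<lambda>i j k. family_const n a b c f i j * displacement f l k) i j k"
    unfolding family.jacobi_lower_def K_def sum.distrib by (simp add: algebra_simps)
  ultimately show ?thesis by (simp add: T_def)
qed

lemma contraction_eq_0_if_fixed: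
  assumes g: "three_cycle n g" and h: "three_cycle n h" and not_five: "\<not> five_cycle n (g \<circ> h)"
    and k: "h k = k"
  shows "contraction g h k = 0"
proof (rule ccontr)
  assume nonzero: "contraction g h k \<noteq> 0"
  then have gk: "g k \<noteq> k" using contraction_fixed[OF kcycle_Sym[OF g]] by blast
  note orbit = three_cycle_orbit[OF g gk]
  have five: "five_cycle n (g \<circ> h)"
    if p: "p \<in> {g k, g (g k)}" "h p \<noteq> p" and other: "\<forall>t\<in>{g k, g (g k)}. h t \<noteq> t \<longrightarrow> t = p" for p
  proof (rule three_cycle_comp_one_shared(3)[OF g h _ p(2)])
    show "g p \<noteq> p" using p(1) orbit(2,4) by auto
    show "\<forall>t. g t \<noteq> t \<and> h t \<noteq> t \<longrightarrow> t = p"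
    proof (intro allI impI)
      fix t assume t: "g t \<noteq> t \<and> h t \<noteq> t"
      then have "t \<in> {k, g k, g (g k)}" using three_cycle_moved_iff[OF g gk, of t] by simp
      then have "t \<in> {g k, g (g k)}" using t k by auto
      then show "t = p" using other t by blast
    qed
  qed
  show False
  proof (cases "h (g k) = g k")
    case True
    then have "h (g (g k)) \<noteq> g (g k)"
      using nonzero by (simp add: contraction_def moved_def three_cycle_inv[OF g])
    then show False using five[of "g (g k)"] True not_five by simp
  next
    case False
    then have "h (g (g k)) = g (g k)"
      using nonzero by (simp add: contraction_def moved_def three_cycle_inv[OF g])
    then show False using five[of "g k"] False not_five by simp
  qed
qed

lemma sum_moved_contraction:
  assumes "g \<in> Sym n"
  shows "(\<Sum>t<n. moved h t * contraction g h t) = 0"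
proof -
  have "(\<Sum>t<n. moved h t * moved h (inv g t)) = (\<Sum>t<n. moved h (g t) * moved h t)"
    by (subst sum_lessThan_permute[OF assms]) (use assms in simp)
  then show ?thesis by (simp add: contraction_def right_diff_distrib sum_subtractf mult.commute)
qed

lemma pair_obstruction_eq_0:
  assumes g: "three_cycle n g" and h: "three_cycle n h" and not_five: "\<not> five_cycle n (g \<circ> h)"
    and ijk: "distinct [i, j, k]"
  shows "pair_obstruction i j k g h = 0"
proof (cases "h i = i \<or> h j = j \<or> h k = k")
  case True
  then show ?thesis
    using contraction_eq_0_if_fixed[OF g h not_five] perm_form_fixed[OF kcycle_Sym[OF h]]
    by (auto simp: pair_obstruction_def)
next
  case False
  then have i: "h i \<noteq> i" by simp
  note orbit = three_cycle_orbit[OF h i]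
  have jk: "j \<in> {i, h i, h (h i)}" "k \<in> {i, h i, h (h i)}"
    using three_cycle_moved_iff[OF h i] False by blast+
  have moved_points: "{t. t < n \<and> h t \<noteq> t} = {i, j, k}"
  proof -
    have "{i, h i, h (h i)} = {i, j, k}" using jk ijk by auto
    then have "h t \<noteq> t \<longleftrightarrow> t \<in> {i, j, k}" for t using three_cycle_moved_iff[OF h i] by simp
    moreover have "t < n" if "h t \<noteq> t" for t using three_cycle_orbit(3)[OF h that] .
    ultimately show ?thesis by blast
  qed
  have "(\<Sum>t<n. moved h t * contraction g h t) = (\<Sum>t\<in>{t. t < n \<and> h t \<noteq> t}. contraction g h t)"
    by (rule sum.mono_neutral_cong_right) (auto simp: moved_def)
  then have "contraction g h i + contraction g h j + contraction g h k = 0"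
    unfolding sum_moved_contraction[OF kcycle_Sym[OF g]] moved_points using ijk by (simp add: add.assoc)
  moreover have "perm_form h i j = perm_form h j k" "perm_form h k i = perm_form h j k"
    using jk ijk orbit(2,4) by (auto simp: perm_form_def)
  ultimately show ?thesis
    by (simp add: pair_obstruction_def distrib_left[symmetric] add.commute add.left_commute)
qed

lemma moved_cyc3:
  "distinct [p, q, r] \<Longrightarrow> moved (cyc3 p q r) l = of_bool (l = p) + of_bool (l = q) + of_bool (l = r)"
  by (auto simp: moved_def cyc3_apply)

lemma perm_form_cyc3:
  assumes "distinct [p, q, r]"
  shows "perm_form (cyc3 p q r) i j =
      of_bool (i = p \<and> j = q) + of_bool (i = q \<and> j = r) + of_bool (i = r \<and> j = p)
    - of_bool (j = p \<and> i = q) - of_bool (j = q \<and> i = r) - of_bool (j = r \<and> i = p)"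
proof -
  consider "i = p" | "i = q" | "i = r" | "i \<notin> {p, q, r}" by blast
  then show ?thesis
    unfolding perm_form_def cyc3_apply[OF assms] by cases (use assms in auto)
qed

lemma contraction_cyc3:
  assumes "distinct [p, q, r, s, t]"
  shows "contraction (cyc3 p s t) (cyc3 p q r) x = of_bool (x = s) - of_bool (x = t)"
proof -
  have d: "distinct [p, s, t]" "distinct [p, q, r]" using assms by auto
  have "three_cycle (p + s + t + 1) (cyc3 p s t)" by (rule three_cycle_cyc3) (use d in auto)
  from three_cycle_inv[OF this] have inv: "inv (cyc3 p s t) x = cyc3 p s t (cyc3 p s t x)" by simp
  consider "x = p" | "x = q" | "x = r" | "x = s" | "x = t" | "x \<notin> {p, q, r, s, t}" by blast
  then show ?thesis
    unfolding contraction_def inv moved_def cyc3_apply[OF d(1)] cyc3_apply[OF d(2)]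
    by cases (use assms in auto)
qed

lemma pair_obstruction_cyc3:
  assumes "distinct [p, q, r, s, t]"
  shows "pair_obstruction i j k (cyc3 p s t) (cyc3 p q r) = cyclic_sum (\<lambda>i j k.
      (of_bool (i = p \<and> j = q) + of_bool (i = q \<and> j = r) + of_bool (i = r \<and> j = p)
     - of_bool (j = p \<and> i = q) - of_bool (j = q \<and> i = r) - of_bool (j = r \<and> i = p))
     * (of_bool (k = s) - of_bool (k = t))) i j k"
proof -
  have "distinct [p, q, r]" using assms by auto
  then show ?thesis
    unfolding pair_obstruction_def by (simp only: perm_form_cyc3 contraction_cyc3[OF assms])
qed

lemma distinct_five_rotations:
  assumes "distinct [p, q, r, s, t]"
  shows "distinct [q, r, s, t, p]" "distinct [r, s, t, p, q]" "distinct [s, t, p, q, r]"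
    "distinct [t, p, q, r, s]"
  using assms by auto

lemma cyc5_obstruction:
  assumes d: "distinct [p, q, r, s, t]" and less: "p < n" "q < n" "r < n" "s < n" "t < n"
    and jk: "j \<in> {q, r, s, t}" "k \<in> {q, r, s, t}" "j \<noteq> k"
  defines "f \<equiv> cyc5 p q r s t"
  shows "(\<Sum>(g, h)\<in>factorizations n f. pair_obstruction p j k g h) = 0" (is ?unweighted)
    and "(\<Sum>(g, h)\<in>factorizations n f. moved g l * pair_obstruction p j k g h)
      + cyclic_sum (\<lambda>i j k. five_form f i j * displacement f l k) p j k = 0" (is ?weighted)
proof -
  note rotations = distinct_five_rotations[OF d]
  note obstructions = pair_obstruction_cyc3[OF d] rotations[THEN pair_obstruction_cyc3]
  have jk_cases: "(j, k) \<in> {(q, r), (q, s), (q, t), (r, q), (r, s), (r, t),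
      (s, q), (s, r), (s, t), (t, q), (t, r), (t, s)}"
    using jk by auto
  show ?unweighted
    unfolding f_def sum_factorizations_cyc5[OF d less] obstructions
    using jk_cases by (elim insertE) (use d distinct_rev[THEN iffD2, OF d] in simp_all)
  show ?weighted
    unfolding f_def sum_factorizations_cyc5[OF d less] obstructions five_form_def perm_form_def comp_apply
    using jk_cases
    by (elim insertE)
       (use d distinct_rev[THEN iffD2, OF d] in \<open>simp_all add: moved_cyc3 cyc5_simps[OF d]\<close>)
qed

lemma five_cycle_obstruction:
  assumes f: "five_cycle n f" and ijk: "distinct [i, j, k]"
  shows "(\<Sum>(g, h)\<in>factorizations n f. pair_obstruction i j k g h) = 0 \<and>
    (\<Sum>(g, h)\<in>factorizations n f. moved g l * pair_obstruction i j k g h)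
      + cyclic_sum (\<lambda>i j k. five_form f i j * displacement f l k) i j k = 0"
proof (cases "f i = i \<or> f j = j \<or> f k = k")
  case True
  have "pair_obstruction i j k g h = 0" if gh: "(g, h) \<in> factorizations n f" for g h
    using True five_cycle_factors_fixed[OF f gh] factorizationsD[OF gh]
      contraction_fixed[of g n] perm_form_fixed[of h n]
    by (auto simp: pair_obstruction_def)
  then have "(\<Sum>(g, h)\<in>factorizations n f. F g * pair_obstruction i j k g h) = 0" for F
    by (intro sum.neutral) auto
  moreover from this[of "\<lambda>_. 1"] have "(\<Sum>(g, h)\<in>factorizations n f. pair_obstruction i j k g h) = 0"
    by simp
  moreover have "cyclic_sum (\<lambda>i j k. five_form f i j * displacement f l k) i j k = 0"
    using True by (elim disjE) (simp_all add: five_form_fixed[OF kcycle_Sym[OF f]])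
  ultimately show ?thesis by simp
next
  case False
  then obtain q r s t where d: "distinct [i, q, r, s, t]"
    and less: "i < n" "q < n" "r < n" "s < n" "t < n"
    and f_eq: "f = cyc5 i q r s t"
    using five_cycle_from[OF f, of i] by blast
  have jk: "j \<in> {q, r, s, t}" "k \<in> {q, r, s, t}" "j \<noteq> k"
    using False ijk cyc5_moved_iff[OF d, of j] cyc5_moved_iff[OF d, of k] unfolding f_eq by auto
  show ?thesis
    unfolding f_eq by (intro conjI cyc5_obstruction[OF d less jk])
qed

lemma family_lower_linear_eq_0:
  assumes ijk: "i < n" "j < n" "k < n" "distinct [i, j, k]" and f: "f \<in> Sym n"
  shows "family.jacobi_lower n a b c i j k f [l] = 0"
proof -
  define C where "C = cyclic_sum (\<lambda>i j k. family_const n a b c f i j * displacement f l k) i j k"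
  define R where "R = (\<Sum>(g, h)\<in>factorizations n f.
      (b + (a - b) * moved g l) * pair_obstruction i j k g h)"
  have "(a - b) * R + C = 0"
  proof (cases "five_cycle n f")
    case False
    then have "R = 0"
      unfolding R_def by (intro sum.neutral)
        (auto simp: factorizations_def pair_obstruction_eq_0[OF _ _ _ ijk(4)])
    moreover have "C = 0"
      using False three_cycle_form_translation[of n f i j "\<lambda>t. of_bool (l = t)" k]
      by (cases "three_cycle n f")
        (simp_all add: C_def family_const_def mult.assoc distrib_left[symmetric])
    ultimately show ?thesis by simp
  next
    case True
    define W where "W = (\<Sum>(g, h)\<in>factorizations n f. moved g l * pair_obstruction i j k g h)"
    define F where "F = cyclic_sum (\<lambda>i j k. five_form f i j * displacement f l k) i j k"
    have "C = (a - b)^2 * F"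
      using five_cycle_not_three_cycle[OF True] True
      by (simp add: C_def F_def family_const_def mult.assoc distrib_left[symmetric])
    moreover have "R = b * (\<Sum>(g, h)\<in>factorizations n f. pair_obstruction i j k g h) + (a - b) * W"
      by (simp add: R_def W_def distrib_right mult.assoc sum.distrib sum_distrib_left split_def)
    moreover have "(\<Sum>(g, h)\<in>factorizations n f. pair_obstruction i j k g h) = 0" "W + F = 0"
      unfolding W_def F_def using five_cycle_obstruction[OF True ijk(4), of l] by blast+
    ultimately show ?thesis
      by (simp add: power2_eq_square mult.assoc distrib_left[symmetric])
  qed
  then show ?thesis unfolding family_lower_linear[OF ijk(1-3)] C_def R_def by simp
qed

section \<open>The constant obstruction\<close>

definition moved_wedge :: "nat \<Rightarrow> nat \<Rightarrow> (nat \<Rightarrow> nat) \<Rightarrow> (nat \<Rightarrow> nat) \<Rightarrow> complex" where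
  "moved_wedge i j g h = moved g i * moved h j - moved g j * moved h i"

definition common_moved :: "nat \<Rightarrow> (nat \<Rightarrow> nat) \<Rightarrow> (nat \<Rightarrow> nat) \<Rightarrow> complex" where
  "common_moved n g h = (\<Sum>k<n. moved g k * moved h k)"

text \<open>With \<open>T\<^sub>i\<close> the sum of the 3-cycles that move \<open>i\<close>, this is the coefficient of \<open>f\<close> in
  \<open>[T\<^sub>i, T\<^sub>j] - \<Sum>\<^sub>h \<omega>\<^sub>h(e\<^sub>i, e\<^sub>j) (\<Sum>\<^sub>k T\<^sub>k) h\<close>, where \<open>h\<close> runs over the 3-cycles and \<open>k\<close> over the points
  moved by \<open>h\<close>.\<close>

definition commutator_defect :: "nat \<Rightarrow> (nat \<Rightarrow> nat) \<Rightarrow> nat \<Rightarrow> nat \<Rightarrow> complex" where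
  "commutator_defect n f i j =
     (\<Sum>(g, h)\<in>factorizations n f. moved_wedge i j g h - perm_form h i j * common_moved n g h)"

lemma common_moved_commute: "common_moved n g h = common_moved n h g"
  by (simp add: common_moved_def mult.commute)

lemma common_moved_conj:
  assumes p: "p \<in> Sym n"
  shows "common_moved n (p \<circ> g \<circ> inv p) (p \<circ> h \<circ> inv p) = common_moved n g h"
  unfolding common_moved_def moved_conj[OF p] by (subst sum_lessThan_permute[OF p]) (use p in simp)

lemma commutator_defect_alternating: "commutator_defect n f j i = - commutator_defect n f i j"
  unfolding commutator_defect_def sum_negf[symmetric] perm_form_alternating[of _ j i]
  by (intro sum.cong refl) (auto simp: moved_wedge_def)

lemma commutator_defect_conj:
  assumes "p \<in> Sym n"
  shows "commutator_defect n (p \<circ> f \<circ> inv p) (p i) (p j) = commutator_defect n f i j"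
  unfolding commutator_defect_def sum_factorizations_conj[OF assms] common_moved_conj[OF assms]
    perm_form_conj[OF assms] moved_wedge_def moved_conj[OF assms] Sym_inv_apply(1)[OF assms] ..

lemma sum_perm_form_common_moved:
  "(\<Sum>(g, h)\<in>factorizations n f. perm_form h i j * common_moved n g h)
    = (\<Sum>(g, h)\<in>factorizations n f. perm_form g i j * common_moved n g h)"
proof -
  have "common_moved n (g \<circ> h \<circ> inv g) g = common_moved n g h" if "(g, h) \<in> factorizations n f" for g h
  proof -
    have g: "g \<in> Sym n" using factorizationsD[OF that] by blast
    then have "common_moved n (g \<circ> h \<circ> inv g) g = common_moved n (g \<circ> h \<circ> inv g) (g \<circ> g \<circ> inv g)" by simp
    also have "\<dots> = common_moved n h g" by (rule common_moved_conj[OF g])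
    finally show ?thesis by (simp only: common_moved_commute)
  qed
  then show ?thesis
    by (subst sum_factorizations_rotate) (auto intro!: sum.cong)
qed

lemma commutator_defect_inv:
  assumes f: "f \<in> Sym n"
  shows "commutator_defect n (inv f) i j = - commutator_defect n f i j"
proof -
  have "commutator_defect n (inv f) i j = (\<Sum>(g, h)\<in>factorizations n f.
      moved_wedge i j (inv h) (inv g) - perm_form (inv g) i j * common_moved n (inv h) (inv g))"
    unfolding commutator_defect_def by (rule sum_factorizations_inv[OF f])
  also have "\<dots> = (\<Sum>(g, h)\<in>factorizations n f. perm_form g i j * common_moved n g h - moved_wedge i j g h)"
    by (intro sum.cong refl)
       (auto dest!: factorizationsD simp: moved_wedge_def perm_form_inv[of _ n] moved_inv[of _ n]
         common_moved_def mult.commute)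
  also have "\<dots> = (\<Sum>(g, h)\<in>factorizations n f. perm_form g i j * common_moved n g h)
      - (\<Sum>(g, h)\<in>factorizations n f. moved_wedge i j g h)"
    by (simp add: split_def sum_subtractf)
  also have "\<dots> = - commutator_defect n f i j"
    unfolding sum_perm_form_common_moved[symmetric]
    by (simp add: commutator_defect_def split_def sum_subtractf)
  finally show ?thesis .
qed

lemma common_moved_cyc3:
  assumes "p < n" "distinct [p, q, r, s, t]"
  shows "common_moved n (cyc3 p s t) (cyc3 p q r) = 1"
proof -
  have "distinct [p, q, r]" "distinct [p, s, t]" using assms(2) by auto
  then have "moved (cyc3 p s t) k * moved (cyc3 p q r) k = (if k = p then 1 else 0)" for k
    using assms(2) by (auto simp: moved_cyc3)
  then show ?thesis using assms(1) by (simp add: common_moved_def)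
qed

lemma commutator_defect_five_cycle:
  assumes f: "five_cycle n f"
  shows "commutator_defect n f i j = five_form f i j"
proof (cases "f i = i \<or> f j = j")
  case True
  have "moved_wedge i j g h - perm_form h i j * common_moved n g h = 0"
    if gh: "(g, h) \<in> factorizations n f" for g h
    using True five_cycle_factors_fixed[OF f gh] perm_form_fixed[of h n i j] factorizationsD[OF gh]
    by (auto simp: moved_wedge_def moved_def)
  then have "commutator_defect n f i j = 0"
    unfolding commutator_defect_def by (intro sum.neutral) auto
  then show ?thesis using five_form_fixed[OF kcycle_Sym[OF f] True] by simp
next
  case False
  then obtain q r s t where d: "distinct [i, q, r, s, t]"
    and less: "i < n" "q < n" "r < n" "s < n" "t < n"
    and f_eq: "f = cyc5 i q r s t"
    using five_cycle_from[OF f, of i] by blast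
  have j: "j \<in> {i, q, r, s, t}" using False cyc5_moved_iff[OF d, of j] f_eq by blast
  note rotations = distinct_five_rotations[OF d]
  show ?thesis
    unfolding commutator_defect_def f_eq sum_factorizations_cyc5[OF d less]
      common_moved_cyc3[OF less(1) d] common_moved_cyc3[OF less(2) rotations(1)]
      common_moved_cyc3[OF less(3) rotations(2)] common_moved_cyc3[OF less(4) rotations(3)]
      common_moved_cyc3[OF less(5) rotations(4)]
    using j
    by (elim insertE emptyE)
       (use d distinct_rev[THEN iffD2, OF d] in \<open>simp_all add: moved_wedge_def moved_cyc3
         perm_form_cyc3 five_form_def perm_form_def[of "cyc5 i q r s t"]
         perm_form_def[of "cyc5 i q r s t \<circ> cyc5 i q r s t"] cyc5_simps[OF d]\<close>)
qed

lemma commutator_defect_three_cycle_fixed: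
  assumes f: "three_cycle n f" and fixed: "f i = i \<or> f j = j"
  shows "commutator_defect n f i j = 0"
proof -
  obtain y where "f y \<noteq> y" using kcycle_moves[OF f] by auto
  then obtain x where x: "f x \<noteq> x" "f i \<noteq> i \<Longrightarrow> x = i" "f j \<noteq> j \<Longrightarrow> x = j"
    using fixed by metis
  note orbit = three_cycle_orbit[OF f x(1)]
  let ?p = "transpose (f x) (f (f x))"
  have p: "?p \<in> Sym n" using orbit(3) kcycle_Sym[OF f] by (intro Sym_transpose) simp_all
  have "f (f x) \<noteq> f x" "f (f (f x)) \<noteq> f (f x)" using x(1) kcycle_Sym[OF f] by simp_all
  moreover have "i \<noteq> y \<and> j \<noteq> y" if "f y \<noteq> y" "x \<noteq> y" for y using x(2,3) that by blast
  ultimately have "?p i = i" "?p j = j" using orbit(2) by (simp_all add: transpose_def)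
  moreover have "?p \<circ> f \<circ> inv ?p = inv f"
  proof -
    have "?p \<circ> cyc3 x (f x) (f (f x)) \<circ> inv ?p = cyc3 x (f (f x)) (f x)"
      unfolding cyc3_def using conjugation_of_cycle[OF orbit(2) Sym_bij[OF p]] orbit(2)
      by (simp add: transpose_def)
    also have "\<dots> = inv (cyc3 x (f x) (f (f x)))" by (rule cyc3_inv[OF orbit(2), symmetric])
    finally show ?thesis unfolding orbit(1)[symmetric] .
  qed
  ultimately have "commutator_defect n (inv f) i j = commutator_defect n f i j"
    using commutator_defect_conj[OF p, of f i j] by simp
  then show ?thesis using commutator_defect_inv[OF kcycle_Sym[OF f], of i j] by simp
qed

lemma commutator_defect_three_cycle:
  "\<exists>\<delta>. \<forall>f i j. three_cycle n f \<longrightarrow> commutator_defect n f i j = \<delta> * perm_form f i j"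
proof (cases "\<exists>f. three_cycle n f")
  case True
  then obtain f0 where three_f0: "three_cycle n f0" by blast
  obtain x0 where x0: "f0 x0 \<noteq> x0" using kcycle_moves[OF three_f0] by auto
  have "commutator_defect n f i j = commutator_defect n f0 x0 (f0 x0) * perm_form f i j"
    if f: "three_cycle n f" for f i j
  proof (rule three_cycle_form_eq[where B = "commutator_defect n f",
        OF f commutator_defect_alternating commutator_defect_three_cycle_fixed[OF f]])
    fix x assume "f x \<noteq> x"
    then obtain p where p: "p \<in> Sym n" "p \<circ> f0 \<circ> inv p = f" "p x0 = x"
      using three_cycles_conjugate[OF three_f0 x0 f, of x "[]" "[]"] by auto
    then have "p (f0 x0) = f x" by auto
    then show "commutator_defect n f x (f x) = commutator_defect n f0 x0 (f0 x0)"
      using commutator_defect_conj[OF p(1), of f0 x0 "f0 x0"] p by simp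
  qed
  then show ?thesis by blast
qed blast

lemma commutator_defect_eq_0:
  assumes f: "f \<in> Sym n" and not: "\<not> three_cycle n f" "\<not> five_cycle n f"
  shows "commutator_defect n f i j = 0"
proof (cases "f \<circ> f = id")
  case True
  then have "inv f = f" by (simp add: inv_unique_comp)
  then show ?thesis using commutator_defect_inv[OF f, of i j] by simp
next
  case False
  have disjoint: "g t = t \<or> h t = t" if "(g, h) \<in> factorizations n f" for g h t
    using three_cycle_comp_overlapping[of n g h t] factorizationsD[OF that] not False by auto
  have wedge: "moved_wedge i j g h - perm_form h i j * common_moved n g h = moved_wedge i j g h"
    if gh: "(g, h) \<in> factorizations n f" for g h
  proof -
    have "moved g k * moved h k = 0" for k using disjoint[OF gh, of k] by (auto simp: moved_def)
    then show ?thesis by (simp add: common_moved_def del: mult_eq_0_iff)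
  qed
  have "moved_wedge i j (g \<circ> h \<circ> inv g) g = - moved_wedge i j g h"
    if gh: "(g, h) \<in> factorizations n f" for g h
  proof -
    have Sym: "g \<in> Sym n" "h \<in> Sym n" using factorizationsD[OF gh] by auto
    have "g (h t) = h (g t)" for t
      using disjoint[OF gh, of t] disjoint[OF gh, of "g t"] disjoint[OF gh, of "h t"] Sym by auto
    then have "g \<circ> h = h \<circ> g" by (simp add: fun_eq_iff)
    then show ?thesis using Sym by (simp add: moved_wedge_def)
  qed
  then have "(\<Sum>(g, h)\<in>factorizations n f. moved_wedge i j g h)
      = - (\<Sum>(g, h)\<in>factorizations n f. moved_wedge i j g h)"
    by (subst sum_factorizations_rotate) (auto simp: sum_negf[symmetric] intro!: sum.cong)
  moreover have "commutator_defect n f i j = (\<Sum>(g, h)\<in>factorizations n f. moved_wedge i j g h)"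
    unfolding commutator_defect_def by (intro sum.cong refl) (auto simp: wedge)
  ultimately show ?thesis by simp
qed

definition three_cycle_sum :: "nat \<Rightarrow> nat \<Rightarrow> (nat \<Rightarrow> nat) \<Rightarrow> complex" where
  "three_cycle_sum n i g = (if three_cycle n g then moved g i else 0)"

definition rep :: "nat \<Rightarrow> complex \<Rightarrow> complex \<Rightarrow> nat \<Rightarrow> (nat \<Rightarrow> nat) \<Rightarrow> complex" where
  "rep n d z i g = d * three_cycle_sum n i g + z * of_bool (g = id)"

lemma equivariant_rep: "equivariant n (rep n d z)"
  unfolding equivariant_def
proof (intro ballI allI impI)
  fix h g k assume h: "h \<in> Sym n"
  have "h \<circ> g \<circ> inv h = id \<longleftrightarrow> g = id"
    using Sym_unconjugate(1)[OF h, of g] h by (metis Sym_inv_comp comp_id)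
  then show "rep n d z (h k) (h \<circ> g \<circ> inv h) = rep n d z k g"
    unfolding rep_def three_cycle_sum_def kcycle_conj_iff[OF h] moved_conj[OF h] using h by simp
qed

lemma convolve_rep_left:
  assumes "f \<in> Sym n"
  shows "convolve n (rep n d z i) y f = d * convolve n (three_cycle_sum n i) y f + z * y f"
proof -
  have "f \<circ> inv h = id \<longleftrightarrow> h = f" if "h \<in> Sym n" for h
    using that by (metis Sym_comp_inv_cancel(1) Sym_inv_comp(2) id_comp)
  then have "rep n d z i (f \<circ> inv h) * y h
      = d * (three_cycle_sum n i (f \<circ> inv h) * y h) + z * (of_bool (h = f) * y h)"
    if "h \<in> Sym n" for h
    using that by (simp add: rep_def algebra_simps)
  then show ?thesis
    using assms by (simp add: convolve_def sum.distrib sum_distrib_left[symmetric] sum_of_bool_delta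
      del: sum_of_bool_mult_eq)
qed

lemma convolve_rep_right:
  "convolve n x (rep n d z j) f = d * convolve n x (three_cycle_sum n j) f + z * x f"
proof -
  have "x (f \<circ> inv h) * rep n d z j h
      = d * (x (f \<circ> inv h) * three_cycle_sum n j h) + z * (of_bool (h = id) * x (f \<circ> inv h))" for h
    by (simp add: rep_def algebra_simps)
  then show ?thesis
    by (simp add: convolve_def sum.distrib sum_distrib_left[symmetric] sum_of_bool_delta
      del: sum_of_bool_mult_eq)
qed

lemma convolve_three_cycles:
  "convolve n (three_cycle_sum n i) (\<lambda>h. if three_cycle n h then y h else 0) f
      = (\<Sum>(g, h)\<in>factorizations n f. moved g i * y h)"
  unfolding sum_Sym_factorizations[symmetric] convolve_def three_cycle_sum_def
  by (intro sum.cong refl) simp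

lemma rep_commutator:
  assumes "f \<in> Sym n"
  shows "convolve n (rep n d z i) (rep n d z j) f - convolve n (rep n d z j) (rep n d z i) f
    = d^2 * (\<Sum>(g, h)\<in>factorizations n f. moved_wedge i j g h)"
proof -
  have "convolve n (three_cycle_sum n i) (three_cycle_sum n j) f
      = (\<Sum>(g, h)\<in>factorizations n f. moved g i * moved h j)" for i j
    unfolding convolve_three_cycles[symmetric] by (simp add: three_cycle_sum_def[abs_def])
  then show ?thesis
    using assms by (simp add: convolve_rep_left convolve_rep_right)
      (simp add: moved_wedge_def split_def sum_subtractf rep_def algebra_simps power2_eq_square)
qed

lemma sum_moved_three_cycle:
  assumes "three_cycle n h"
  shows "(\<Sum>k<n. moved h k) = 3"
proof -
  obtain p where "h p \<noteq> p" using kcycle_moves[OF assms] by auto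
  then obtain q r where d: "distinct [p, q, r]" "p < n" "q < n" "r < n" "h = cyc3 p q r"
    using three_cycle_from[OF assms] by metis
  have "(\<Sum>k<n. moved h k) = (\<Sum>k\<in>{p, q, r}. 1)"
    by (rule sum.mono_neutral_cong_right) (use d in \<open>auto simp: moved_cyc3\<close>)
  then show ?thesis using d by simp
qed

lemma sum_convolve_rep_family:
  assumes "f \<in> Sym n"
  shows "(\<Sum>k<n. convolve n (rep n d z k) (\<lambda>h. family_linear n d 0 h i j k) f)
    = d^2 * (\<Sum>(g, h)\<in>factorizations n f. perm_form h i j * common_moved n g h)
    + (if three_cycle n f then 3 * d * z * perm_form f i j else 0)"
proof -
  have linear: "family_linear n d 0 h i j k
      = (if three_cycle n h then d * perm_form h i j * moved h k else 0)" for h k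
    by (simp add: family_linear_def moved_def)
  have "(\<Sum>k<n. convolve n (rep n d z k) (\<lambda>h. family_linear n d 0 h i j k) f)
    = d * (\<Sum>k<n. \<Sum>(g, h)\<in>factorizations n f. moved g k * (d * perm_form h i j * moved h k))
      + z * (\<Sum>k<n. family_linear n d 0 f i j k)"
    using assms by (simp add: convolve_rep_left linear convolve_three_cycles sum.distrib sum_distrib_left)
  also have "(\<Sum>k<n. \<Sum>(g, h)\<in>factorizations n f. moved g k * (d * perm_form h i j * moved h k))
      = d * (\<Sum>(g, h)\<in>factorizations n f. perm_form h i j * common_moved n g h)"
    by (subst sum.swap) (simp add: common_moved_def split_def sum_distrib_left mult_ac)
  also have "(\<Sum>k<n. family_linear n d 0 f i j k)
      = (if three_cycle n f then 3 * d * perm_form f i j else 0)"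
    by (simp add: linear sum_distrib_left[symmetric] sum_moved_three_cycle)
  finally show ?thesis by (simp add: power2_eq_square mult_ac)
qed

lemma family_represents_rep:
  assumes "d \<noteq> 0"
  obtains z where "family.represents n d 0 c (rep n d z)"
proof -
  obtain \<delta> where \<delta>: "\<And>f i j. three_cycle n f \<Longrightarrow> commutator_defect n f i j = \<delta> * perm_form f i j"
    using commutator_defect_three_cycle[of n] by blast
  define z where "z = (d^2 * \<delta> - c) / (3 * d)"
  have z: "d^2 * \<delta> = 3 * d * z + c" using \<open>d \<noteq> 0\<close> by (simp add: z_def)
  have "d^2 * commutator_defect n f i j
      = (if three_cycle n f then 3 * d * z * perm_form f i j else 0) + family_const n d 0 c f i j"
    if "f \<in> Sym n" for f i j
  proof (cases "three_cycle n f")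
    case True
    then have "d^2 * commutator_defect n f i j = (3 * d * z + c) * perm_form f i j"
      by (simp add: \<delta> z[symmetric])
    then show ?thesis using True by (simp add: family_const_def distrib_right)
  next
    case False
    then show ?thesis
      using commutator_defect_five_cycle commutator_defect_eq_0[OF that] by (simp add: family_const_def)
  qed
  then have "family.represents n d 0 c (rep n d z)"
    unfolding family.represents_def
    by (simp add: equivariant_rep rep_commutator sum_convolve_rep_family commutator_defect_def split_def
        sum_subtractf right_diff_distrib)
       (simp add: algebra_simps)
  then show thesis by (rule that)
qed

text \<open>The linear parts with parameters \<open>a\<close>, \<open>b\<close> and \<open>a - b\<close>, \<open>0\<close> differ by a multiple of
  \<open>\<omega>\<^sub>g \<otimes> (e\<^sub>1 + \<dots> + e\<^sub>n)\<close>, and the constant part vanishes on \<open>e\<^sub>1 + \<dots> + e\<^sub>n\<close>.\<close>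

lemma family_lower_const_shift:
  assumes ijk: "i < n" "j < n" "k < n" and f: "f \<in> Sym n"
  shows "family.jacobi_lower n a b c i j k f [] = family.jacobi_lower n (a - b) 0 c i j k f []"
proof -
  have shift: "(\<Sum>m<n. family_linear n a b h i j m *
        (family_const n a b c g m (h k) + family_const n a b c g m k))
    = (\<Sum>m<n. family_linear n (a - b) 0 h i j m *
        (family_const n (a - b) 0 c g m (h k) + family_const n (a - b) 0 c g m k))"
    if "h \<in> Sym n" "g \<in> Sym n" "k < n" for h g i j k
  proof -
    let ?C = "\<lambda>m. family_const n a b c g m (h k) + family_const n a b c g m k"
    define B where "B = (if three_cycle n h then perm_form h i j * b else 0)"
    have "family_const n (a - b) 0 c g m x = family_const n a b c g m x" for m x
      by (simp add: family_const_def)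
    moreover have "family_linear n a b h i j m = family_linear n (a - b) 0 h i j m + B" for m
      by (simp add: family_linear_def B_def algebra_simps)
    moreover have "(\<Sum>m<n. B * ?C m) = 0"
      using that sum_family_const_eq_0[of g n "h k"] sum_family_const_eq_0[of g n k]
      by (simp add: sum_distrib_left[symmetric] sum.distrib)
    ultimately show ?thesis by (simp add: distrib_right sum.distrib)
  qed
  show ?thesis
    unfolding family.jacobi_lower_def using f ijk by (simp add: shift cong: sum.cong)
qed

lemma family_lower_const_eq_0:
  assumes ijk: "i < n" "j < n" "k < n" "distinct [i, j, k]" and f: "f \<in> Sym n"
  shows "family.jacobi_lower n a b c i j k f [] = 0"
proof (cases "a = b")
  case True
  have "family_linear n 0 0 h i j m = 0" for h i j m by (simp add: family_linear_def)
  with True show ?thesis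
    unfolding family_lower_const_shift[OF ijk(1-3) f, of a b c] by (simp add: family.jacobi_lower_def)
next
  case False
  then obtain z where "family.represents n (a - b) 0 c (rep n (a - b) z)"
    using family_represents_rep[of "a - b" n c] by auto
  then show ?thesis
    unfolding family_lower_const_shift[OF ijk(1-3) f, of a b c]
    by (rule family.represents_jacobi_lower_constant)
       (use ijk f in \<open>simp_all add: family_quadratic_antisym family_lower_linear_eq_0\<close>)
qed

theorem pbw_cochain_family: "pbw_cochain n (family n a b c)"
proof unfold_locales
  show "family.jacobi_lower n a b c i j k f w = 0"
    if "i < n" "j < n" "k < n" "distinct [i, j, k]" "f \<in> Sym n" "w \<in> short_words n" for i j k f w
    using that family_lower_const_eq_0 family_lower_linear_eq_0 by (auto simp: short_words_eq)
qed (rule family_invariant family_quadratic_antisym; assumption)+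

section \<open>Classification\<close>

locale closed_invariant_forms =
  fixes n :: nat and L :: "(nat \<Rightarrow> nat) \<Rightarrow> nat \<Rightarrow> nat \<Rightarrow> nat \<Rightarrow> complex"
  assumes alternating: "L g j i q = - L g i j q"
    and invariant: "\<lbrakk>p \<in> Sym n; g \<in> Sym n; i < n; j < n; q < n\<rbrakk>
      \<Longrightarrow> L (p \<circ> g \<circ> inv p) (p i) (p j) (p q) = L g i j q"
    and fixed_values: "\<lbrakk>g \<in> Sym n; i < n; j < n; q < n\<rbrakk> \<Longrightarrow> L g i j (g q) = L g i j q"
    and identity: "\<lbrakk>i < n; j < n; q < n\<rbrakk> \<Longrightarrow> L id i j q = 0"
    and closed: "\<lbrakk>g \<in> Sym n; i < n; j < n; k < n; l < n; q < n; distinct [i, j, k]\<rbrakk>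
      \<Longrightarrow> cyclic_sum (\<lambda>i j k. L g i j q * displacement g l k) i j k = 0"
begin

lemma diagonal: "L g i i q = 0"
  using alternating[of g i i q] by simp

lemma moved_points_if_nonzero:
  assumes g: "g \<in> Sym n" and less: "i < n" "j < n" "q < n" and nonzero: "L g i j q \<noteq> 0" and "g k \<noteq> k"
  shows "k \<in> {i, j, g i, g j}"
proof (rule ccontr)
  assume k: "k \<notin> {i, j, g i, g j}"
  have "i \<noteq> j" using nonzero diagonal by auto
  moreover have "k < n" using g \<open>g k \<noteq> k\<close> by (auto simp: Sym_def permutes_def)
  ultimately show False using closed[of g i j k k q] g less k nonzero \<open>g k \<noteq> k\<close> by auto
qed

lemma eq_0_if_two_cycle:
  assumes g: "g \<in> Sym n" and less: "i < n" "j < n" "q < n"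
    and swap: "g i \<noteq> i" "g (g i) = i" "g i \<noteq> j"
  shows "L g i j q = 0"
proof (cases "i = j")
  case True
  then show ?thesis by (simp add: diagonal)
next
  case ij: False
  let ?k = "g i" and ?t = "transpose i (g i)"
  have k: "?k < n" "?k \<noteq> g j" using g less ij by simp_all
  have t: "?t \<in> Sym n" using less(1) k(1) by (rule Sym_transpose)
  have "?t (g x) = g (?t x)" for x
  proof -
    consider "x = i" | "x = ?k" | "g x \<noteq> i" "g x \<noteq> ?k" "x \<noteq> i" "x \<noteq> ?k"
      using Sym_eq_iff[OF g, of x ?k] Sym_eq_iff[OF g, of x i] swap(2) by metis
    then show ?thesis by cases (use swap in simp_all)
  qed
  then have "?t \<circ> g \<circ> inv ?t = g" by (simp add: fun_eq_iff)
  then have "L g ?k j (?t q) = L g i j q"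
    using invariant[OF t g less] ij swap(3) by simp
  moreover have "L g ?k j (?t q) = L g ?k j q"
  proof -
    have "?t q = g q \<or> ?t q = q" using swap(2) by (auto simp: transpose_def)
    then show ?thesis using fixed_values[OF g k(1) less(2,3)] by auto
  qed
  moreover have "L g j ?k q = L g i j q"
    using closed[of g i j ?k ?k q] g less k ij swap by simp
  ultimately show ?thesis using alternating[of g ?k j q] by simp
qed

lemma eq_0_if_fixed_point:
  assumes g: "g \<in> Sym n" and less: "i < n" "j < n" "q < n" and fixed: "g i = i \<or> g j = j"
  shows "L g i j q = 0"
proof -
  have left: "L g i j q = 0" if less: "i < n" "j < n" and i: "g i = i" for i j
  proof (rule ccontr)
    assume nonzero: "L g i j q \<noteq> 0"
    note moved = moved_points_if_nonzero[OF g less \<open>q < n\<close> nonzero]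
    have ij: "i \<noteq> j" using nonzero diagonal by auto
    show False
    proof (cases "g j = j")
      case True
      then have "g x = x" for x using moved[of x] i by auto
      then have "g = id" by (simp add: fun_eq_iff)
      then show False using identity[OF less \<open>q < n\<close>] nonzero by simp
    next
      case False
      then have "g (g j) = j" "g j \<noteq> i" using moved[of "g (g j)"] i g ij Sym_eq_iff[OF g, of j i] by auto
      then have "L g j i q = 0" using eq_0_if_two_cycle[OF g less(2,1) \<open>q < n\<close>] False by blast
      then show False using nonzero alternating[of g i j q] by simp
    qed
  qed
  from fixed show ?thesis
    using left[OF less(1,2)] left[OF less(2,1)] alternating[of g i j q] by auto
qed

lemma eq_0_if_swapped:
  assumes g: "g \<in> Sym n" and less: "i < n" "j < n" "q < n" and swap: "g i = j" "g j = i"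
  shows "L g i j q = 0"
proof -
  have "L g j i (g q) = L g i j q" using invariant[OF g g less] g swap by simp
  then show ?thesis using fixed_values[OF g less(2,1,3)] alternating[of g j i q] by simp
qed

lemma three_cycle_if_nonzero_step:
  assumes g: "g \<in> Sym n" and less: "i < n" "j < n" "q < n"
    and nonzero: "L g i j q \<noteq> 0" and step: "g i = j"
  shows "three_cycle n g"
proof -
  have ij: "i \<noteq> j" using nonzero diagonal by auto
  have gj: "g j \<noteq> i" using eq_0_if_swapped[OF g less step] nonzero by blast
  have "g j \<noteq> j" using eq_0_if_fixed_point[OF g less] nonzero by blast
  note moved = moved_points_if_nonzero[OF g less nonzero, unfolded step]
  have distinct: "distinct [i, j, g j]" using ij gj \<open>g j \<noteq> j\<close> by auto
  have "g (g j) \<noteq> g j" "g (g j) \<noteq> j" "g (g (g j)) \<noteq> g (g j)"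
    using g \<open>g j \<noteq> j\<close> gj Sym_eq_iff[OF g, of "g j" i] step by auto
  then have "g (g j) = i" using moved[of "g (g j)"] by auto
  then have "g = cyc3 i j (g j)"
    using moved step by (auto simp: fun_eq_iff cyc3_apply[OF distinct])
  moreover have "three_cycle n (cyc3 i j (g j))"
    using distinct less g by (intro three_cycle_cyc3) simp_all
  ultimately show ?thesis by simp
qed

lemma three_cycle_if_nonzero:
  assumes g: "g \<in> Sym n" and less: "i < n" "j < n" "q < n" and nonzero: "L g i j q \<noteq> 0"
  shows "three_cycle n g"
proof -
  consider (forward) "g i = j" | (backward) "g j = i" | (neither) "g i \<noteq> j" "g j \<noteq> i" by blast
  then show ?thesis
  proof cases
    case forward
    then show ?thesis by (rule three_cycle_if_nonzero_step[OF g less nonzero])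
  next
    case backward
    moreover have "L g j i q \<noteq> 0" using nonzero alternating[of g j i q] by simp
    ultimately show ?thesis using three_cycle_if_nonzero_step[OF g less(2,1,3)] by blast
  next
    case neither
    let ?k = "g i"
    have ij: "i \<noteq> j" and gi: "g i \<noteq> i"
      using nonzero diagonal eq_0_if_fixed_point[OF g less] by auto
    have k: "?k < n" "?k \<noteq> g j" "g ?k \<noteq> ?k" "g ?k \<noteq> g j"
      using g less gi ij neither by simp_all
    have "g ?k \<noteq> i" using eq_0_if_two_cycle[OF g less gi _ neither(1)] nonzero by blast
    then have gk: "g ?k = j" using moved_points_if_nonzero[OF g less nonzero, of "g ?k"] k g by auto
    have "L g j ?k q = L g i j q"
      using closed[of g i j ?k ?k q] g less k ij gi neither by simp
    moreover have "L g j ?k q = 0"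
      using closed[of g i j ?k i q] g less k ij gi neither gk by simp
    ultimately show ?thesis using nonzero by simp
  qed
qed

lemma step_value_cong:
  assumes f: "three_cycle n f" "f x \<noteq> x" and g: "three_cycle n g" "g y \<noteq> y"
    and less: "q < n" "r < n" and moved: "f q \<noteq> q \<longleftrightarrow> g r \<noteq> r"
  shows "L f x (f x) q = L g y (g y) r"
proof -
  note f_Sym = kcycle_Sym[OF f(1)] and g_Sym = kcycle_Sym[OF g(1)]
  note orbit_f = three_cycle_orbit[OF f] and orbit_g = three_cycle_orbit[OF g]
  show ?thesis
  proof (cases "f q = q")
    case True
    then obtain p where p: "p \<in> Sym n" "p \<circ> f \<circ> inv p = g" "p x = y" "map p [q] = [r]"
      using three_cycles_conjugate[OF f g, of "[q]" "[r]"] moved less by auto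
    then have "p (f x) = g y" by auto
    then show ?thesis using invariant[OF p(1) f_Sym, of x "f x" q] p orbit_f(3) f_Sym less by simp
  next
    case False
    then have q: "q \<in> {x, f x, f (f x)}" and r: "r \<in> {y, g y, g (g y)}"
      using three_cycle_moved_iff[OF f] three_cycle_moved_iff[OF g] moved by blast+
    have "L f x (f x) q = L f x (f x) x"
      using q fixed_values[OF f_Sym, of x "f x" x] fixed_values[OF f_Sym, of x "f x" "f x"]
        orbit_f(3) f_Sym by auto
    moreover have "L g y (g y) r = L g y (g y) y"
      using r fixed_values[OF g_Sym, of y "g y" y] fixed_values[OF g_Sym, of y "g y" "g y"]
        orbit_g(3) g_Sym by auto
    moreover obtain p where p: "p \<in> Sym n" "p \<circ> f \<circ> inv p = g" "p x = y"
      using three_cycles_conjugate[OF f g, of "[]" "[]"] by auto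
    moreover from this have "p (f x) = g y" by auto
    ultimately show ?thesis using invariant[OF p(1) f_Sym, of x "f x" x] orbit_f(3) f_Sym by simp
  qed
qed

lemma step_values:
  "\<exists>a b. \<forall>g x q. three_cycle n g \<and> g x \<noteq> x \<and> q < n \<longrightarrow> L g x (g x) q = (if g q \<noteq> q then a else b)"
proof -
  have "\<exists>c. \<forall>g x q. three_cycle n g \<and> g x \<noteq> x \<and> q < n \<and> (g q \<noteq> q \<longleftrightarrow> s) \<longrightarrow> L g x (g x) q = c" for s
  proof (cases "\<exists>g x q. three_cycle n g \<and> g x \<noteq> x \<and> q < n \<and> (g q \<noteq> q \<longleftrightarrow> s)")
    case True
    then obtain f x q where f: "three_cycle n f" "f x \<noteq> x" "q < n" "f q \<noteq> q \<longleftrightarrow> s" by blast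
    then have "L g y (g y) r = L f x (f x) q"
      if "three_cycle n g" "g y \<noteq> y" "r < n" "g r \<noteq> r \<longleftrightarrow> s" for g y r
      using that by (intro step_value_cong) simp_all
    then show ?thesis by blast
  qed blast
  from this[of True] this[of False] obtain a b where
    "\<And>g x q. three_cycle n g \<Longrightarrow> g x \<noteq> x \<Longrightarrow> q < n \<Longrightarrow> g q \<noteq> q \<Longrightarrow> L g x (g x) q = a"
    "\<And>g x q. three_cycle n g \<Longrightarrow> g x \<noteq> x \<Longrightarrow> q < n \<Longrightarrow> g q = q \<Longrightarrow> L g x (g x) q = b"
    by auto
  then have "three_cycle n g \<and> g x \<noteq> x \<and> q < n \<longrightarrow> L g x (g x) q = (if g q \<noteq> q then a else b)" for g x q
    by simp
  then show ?thesis by blast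
qed

theorem eq_family_linear:
  "\<exists>a b. \<forall>g\<in>Sym n. \<forall>i<n. \<forall>j<n. \<forall>q<n. L g i j q = family_linear n a b g i j q"
proof -
  obtain a b where step: "\<And>g x q. three_cycle n g \<Longrightarrow> g x \<noteq> x \<Longrightarrow> q < n \<Longrightarrow>
      L g x (g x) q = (if g q \<noteq> q then a else b)"
    using step_values by blast
  have "L g i j q = family_linear n a b g i j q"
    if g: "g \<in> Sym n" and less: "i < n" "j < n" "q < n" for g i j q
  proof (cases "three_cycle n g")
    case True
    have "L g i j q = (if g q \<noteq> q then a else b) * perm_form g i j"
      using alternating eq_0_if_fixed_point[OF g less] step[OF True _ less(3)]
      by (intro three_cycle_form_eq[OF True])
    then show ?thesis using True by (simp add: family_linear_def)
  next
    case False
    then show ?thesis using three_cycle_if_nonzero[OF g less] by (auto simp: family_linear_def)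
  qed
  then show ?thesis by blast
qed

end

lemma sum_orbit_telescope:
  fixes m k :: nat
  assumes "h \<in> Sym n" "(h ^^ N) = id"
  shows "(\<Sum>t<N. displacement h ((h ^^ t) m) k) = (0 :: complex)"
proof (cases N)
  case (Suc M)
  define a where "a t = (of_bool ((h ^^ t) m = h k) :: complex)" for t
  have "of_bool ((h ^^ t) m = k) = a (Suc t)" for t
    using assms(1) by (simp add: a_def)
  then have "(\<Sum>t<N. displacement h ((h ^^ t) m) k) = (\<Sum>t<N. a t - a (Suc t))"
    by (simp add: a_def[symmetric])
  also have "\<dots> = a 0 - a N" by (simp add: sum_lessThan_telescope')
  also have "\<dots> = 0" using assms(2) by (simp add: a_def)
  finally show ?thesis .
qed simp

context pbw_cochain
begin

lemma linear_part_closed: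
  assumes fixed: "\<And>g i j q. \<lbrakk>g \<in> Sym n; i < n; j < n; q < n\<rbrakk> \<Longrightarrow> \<kappa> g i j [g q] = \<kappa> g i j [q]"
    and g: "g \<in> Sym n" and ijk: "i < n" "j < n" "k < n" "distinct [i, j, k]" and lq: "l < n" "q < n"
  shows "cyclic_sum (\<lambda>i j k. \<kappa> g i j [q] * displacement g l k) i j k = 0"
    (is "?V = 0")
proof -
  have "permutation g" using g by (auto simp: Sym_def permutation_permutes)
  then obtain N where N: "(g ^^ N) = id" "N > 0" by (rule permutation_is_nilpotent)
  define x where "x t = (g ^^ t) q" for t
  have x: "x t < n" for t using Sym_funpow[OF g, of t] lq by (simp add: x_def)
  have orbit: "\<kappa> g i j [x t] = \<kappa> g i j [q]" if "i < n" "j < n" for i j t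
    using fixed[OF g that x] by (induction t) (simp_all add: x_def)
  define W where "W t = cyclic_sum (\<lambda>i j k. \<kappa> g i j [l] * displacement g (x t) k) i j k" for t
  have "?V + W t = 0" for t
  proof -
    have "jacobi_quadratic i j k g (x t) l + jacobi_quadratic i j k g l (x t) = 0"
      using ijk g lq x by (intro jacobi_quadratic_antisym)
    then show ?thesis
      unfolding jacobi_quadratic_def W_def using ijk by (simp add: orbit algebra_simps)
  qed
  then have "0 = (\<Sum>t<N. ?V + W t)" by simp
  also have "\<dots> = of_nat N * ?V + (\<Sum>t<N. W t)" by (simp add: sum.distrib distrib_left)
  also have "(\<Sum>t<N. W t) = 0"
    unfolding W_def x_def sum.distrib sum_distrib_left[symmetric] sum_orbit_telescope[OF g N(1)] by simp
  finally show ?thesis using N(2) by simp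
qed

theorem linear_part_eq_family:
  assumes fixed: "\<And>g i j q. \<lbrakk>g \<in> Sym n; i < n; j < n; q < n\<rbrakk> \<Longrightarrow> \<kappa> g i j [g q] = \<kappa> g i j [q]"
    and off: "\<And>i j q. \<lbrakk>i < n; j < n; q < n\<rbrakk> \<Longrightarrow> \<kappa> id i j [q] = 0"
  shows "\<exists>a b. \<forall>g\<in>Sym n. \<forall>i<n. \<forall>j<n. \<forall>q<n. \<kappa> g i j [q] = family_linear n a b g i j q"
proof -
  interpret closed_invariant_forms n "\<lambda>g i j q. \<kappa> g i j [q]"
  proof
    show "\<kappa> g j i [q] = - \<kappa> g i j [q]" for g i j q by (rule alternating)
    show "\<kappa> (p \<circ> g \<circ> inv p) (p i) (p j) [p q] = \<kappa> g i j [q]"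
      if "p \<in> Sym n" "g \<in> Sym n" "i < n" "j < n" "q < n" for p g i j q
      using invariant[of p g i j "[q]"] that by simp
  qed (use fixed off linear_part_closed in auto)
  show ?thesis by (rule eq_family_linear)
qed

lemma constant_difference_closed:
  assumes linear: "\<And>g i j q. \<lbrakk>g \<in> Sym n; i < n; j < n; q < n\<rbrakk> \<Longrightarrow> \<kappa> g i j [q] = family_linear n a b g i j q"
    and g: "g \<in> Sym n" and ijk: "i < n" "j < n" "k < n" "distinct [i, j, k]" and l: "l < n"
  shows "cyclic_sum (\<lambda>i j k. (\<kappa> g i j [] - family_const n a b c g i j) * displacement g l k) i j k = 0"
    (is "?V = 0")
proof -
  let ?S = "\<lambda>\<kappa> i j k. \<Sum>h\<in>Sym n. \<Sum>m<n. \<kappa> h i j [m] * (\<kappa> (g \<circ> inv h) m (h k) [l] + \<kappa> (g \<circ> inv h) m k [l])"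
  have same: "?S \<kappa> i j k = ?S (family n a b c) i j k" if "i < n" "j < n" "k < n" for i j k
    using that g l by (intro sum.cong refl) (simp add: linear)
  have "2 * ?V = jacobi_lower i j k g [l] - family.jacobi_lower n a b c i j k g [l]"
    unfolding jacobi_lower_def family.jacobi_lower_def same[OF ijk(1-3)] same[OF ijk(2,3,1)]
      same[OF ijk(3,1,2)]
    by (simp add: algebra_simps)
  also have "\<dots> = 0"
    using jacobi_lower_eq_0[OF ijk g, of "[l]"] family_lower_linear_eq_0[OF ijk g] l by simp
  finally show ?thesis by (simp only: mult_eq_0_iff rel_simps simp_thms)
qed

text \<open>The difference of two admissible constant parts is viewed as a linear cochain with values in the
  line spanned by the invariant vector \<open>e\<^sub>1 + \<dots> + e\<^sub>n\<close>.\<close>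

theorem constant_part_eq_family:
  assumes linear: "\<And>g i j q. \<lbrakk>g \<in> Sym n; i < n; j < n; q < n\<rbrakk> \<Longrightarrow> \<kappa> g i j [q] = family_linear n a b g i j q"
  shows "\<exists>c. \<forall>g\<in>Sym n. \<forall>i<n. \<forall>j<n. \<kappa> g i j [] = family_const n a b c g i j"
proof -
  define D where "D g i j (q :: nat) = \<kappa> g i j [] - family_const n a b 0 g i j" for g i j q
  interpret D: closed_invariant_forms n D
  proof
    show D_alternating: "D g j i q = - D g i j q" for g i j q
      using alternating[of g j i "[]"] family.alternating[of n a b 0 g j i "[]"] by (simp add: D_def)
    show D_invariant: "D (p \<circ> g \<circ> inv p) (p i) (p j) (p q) = D g i j q"
      if "p \<in> Sym n" "g \<in> Sym n" "i < n" "j < n" for p g i j q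
      using invariant[OF that, of "[]"] family_invariant[OF that(1), of a b 0 g i j "[]"]
      by (simp add: D_def)
    show "D g i j (g q) = D g i j q" for g i j q by (simp add: D_def)
    show "D id i j q = 0" if "i < n" "j < n" for i j q
      using D_invariant[OF Sym_transpose[OF that] Sym_id that, of q] D_alternating[of id i j q]
      by (simp add: D_def)
    show "cyclic_sum (\<lambda>i j k. D g i j q * displacement g l k) i j k = 0"
      if "g \<in> Sym n" "i < n" "j < n" "k < n" "distinct [i, j, k]" "l < n" for g i j k l q
      unfolding D_def using linear that by (rule constant_difference_closed)
  qed
  obtain c b' where D: "\<And>g i j q. \<lbrakk>g \<in> Sym n; i < n; j < n; q < n\<rbrakk>
      \<Longrightarrow> D g i j q = family_linear n c b' g i j q"
    using D.eq_family_linear by blast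
  have "\<kappa> g i j [] = family_const n a b c g i j" if g: "g \<in> Sym n" and less: "i < n" "j < n" for g i j
  proof -
    have "family_linear n c b' g i j i = (if three_cycle n g then c * perm_form g i j else 0)"
      using perm_form_fixed[OF g, of i j] by (simp add: family_linear_def)
    then show ?thesis
      using D[OF g less less(1)] by (simp add: D_def family_const_def split: if_splits)
  qed
  then show ?thesis by blast
qed

end

section \<open>The cochains of the theorem\<close>

lemma sum_ind_cyc3:
  assumes ij: "i \<noteq> j" "i < n" "j < n"
  shows "(\<Sum>k\<in>{..<n} - {i, j}. w k * ind g (cyc3 i j k))
      = (if three_cycle n g \<and> g i = j then w (g j) else 0)"
proof (cases "three_cycle n g \<and> g i = j")
  case True
  then have step: "g = cyc3 i j (g j)" "distinct [i, j, g j]" "g j < n"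
    using three_cycle_step[of n g i j] ij by auto
  have "ind g (cyc3 i j k) = of_bool (k = g j)" if "k \<in> {..<n} - {i, j}" for k
  proof -
    have "cyc3 i j k j = k" using that ij by (simp add: cyc3_apply)
    then have "g = cyc3 i j k \<longleftrightarrow> k = g j" using step(1) by metis
    then show ?thesis by (simp add: ind_def)
  qed
  then have "(\<Sum>k\<in>{..<n} - {i, j}. w k * ind g (cyc3 i j k))
      = (\<Sum>k\<in>{..<n} - {i, j}. of_bool (k = g j) * w k)"
    by (intro sum.cong refl) (simp add: mult.commute)
  also have "\<dots> = w (g j)" using step by (intro sum_of_bool_delta) auto
  finally show ?thesis using True by simp
next
  case False
  have "ind g (cyc3 i j k) = 0" if "k \<in> {..<n} - {i, j}" for k
  proof -
    have "three_cycle n (cyc3 i j k)" "cyc3 i j k i = j" using that ij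
      by (auto simp: cyc3_apply intro!: three_cycle_cyc3)
    then show ?thesis using False by (auto simp: ind_def)
  qed
  then show ?thesis using False by auto
qed

lemma kapL_eq_family_linear:
  assumes ij: "i \<noteq> j" "i < n" "j < n"
  shows "kapL n a b g i j k = family_linear n a b g i j k"
proof -
  let ?w = "\<lambda>k'. if k \<in> {i, j, k'} then a else b" and ?u = "if g k \<noteq> k then a else b"
  have "kapL n a b g i j k = (\<Sum>k'\<in>{..<n} - {i, j}. ?w k' * ind g (cyc3 i j k'))
      - (\<Sum>k'\<in>{..<n} - {j, i}. ?w k' * ind g (cyc3 j i k'))"
    unfolding kapL_def sum_subtractf[symmetric] insert_commute[of j i]
  proof (intro sum.cong refl)
    fix k' assume "k' \<in> {..<n} - {i, j}"
    then have "cyc3 k' j i = cyc3 j i k'" using cyc3_rotate[of k' j i] ij by auto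
    then show "?w k' * (ind g (cyc3 i j k') - ind g (cyc3 k' j i))
        = ?w k' * ind g (cyc3 i j k') - ?w k' * ind g (cyc3 j i k')"
      by (simp only: right_diff_distrib)
  qed
  also have "\<dots> = (if three_cycle n g \<and> g i = j then ?w (g j) else 0)
      - (if three_cycle n g \<and> g j = i then ?w (g i) else 0)"
    unfolding sum_ind_cyc3[OF ij] using ij by (subst sum_ind_cyc3) auto
  also have "\<dots> = (if three_cycle n g then perm_form g i j * ?u else 0)"
  proof -
    have "?w (g j) = ?u" if "three_cycle n g" "g i = j"
      using three_cycle_moved_iff[of n g i k] that ij by auto
    moreover have "?w (g i) = ?u" if "three_cycle n g" "g j = i"
      using three_cycle_moved_iff[of n g j k] that ij by auto
    ultimately show ?thesis by (auto simp: perm_form_def)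
  qed
  finally show ?thesis by (simp add: family_linear_def)
qed

lemma sum_ind_inv:
  assumes g: "g \<in> Sym n"
  shows "(\<Sum>\<sigma>\<in>{\<sigma> \<in> Sym n. R \<sigma>}. ind g \<sigma> - ind g (inv \<sigma>)) = of_bool (R g) - of_bool (R (inv g))"
proof -
  have "(\<Sum>\<sigma>\<in>{\<sigma> \<in> Sym n. R \<sigma>}. ind g \<sigma> - ind g (inv \<sigma>))
      = (\<Sum>\<sigma>\<in>{\<sigma> \<in> Sym n. R \<sigma>}. (if \<sigma> = g then 1 else 0) - (if \<sigma> = inv g then 1 else 0))"
    using g by (intro sum.cong refl) (auto simp: ind_def)
  then show ?thesis using g by (simp add: sum_subtractf)
qed

lemma kapC_eq_family_const:
  assumes ij: "i \<noteq> j" "i < n" "j < n" and g: "g \<in> Sym n"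
  shows "kapC n a b c g i j = family_const n a b c g i j"
proof -
  have three: "(\<Sum>k\<in>{..<n} - {i, j}. ind g (cyc3 i j k) - ind g (cyc3 k j i))
      = (if three_cycle n g then perm_form g i j else 0)"
    using kapL_eq_family_linear[OF ij, of 1 1 g 0] by (simp add: kapL_def family_linear_def)
  have inv: "inv g (inv g i) = j \<longleftrightarrow> g (g j) = i" "inv g i = j \<longleftrightarrow> g j = i"
    using g by (auto simp: Sym_inv_eq_iff)
  have five: "(\<Sum>\<sigma>\<in>{\<sigma> \<in> Sym n. five_cycle n \<sigma> \<and> \<sigma> (\<sigma> i) = j}. 2 * (ind g \<sigma> - ind g (inv \<sigma>)))
      = 2 * (of_bool (five_cycle n g \<and> g (g i) = j) - of_bool (five_cycle n g \<and> g (g j) = i))"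
    "(\<Sum>\<sigma>\<in>{\<sigma> \<in> Sym n. five_cycle n \<sigma> \<and> \<sigma> i = j}. ind g \<sigma> - ind g (inv \<sigma>))
      = of_bool (five_cycle n g \<and> g i = j) - of_bool (five_cycle n g \<and> g j = i)"
    unfolding sum_distrib_left[symmetric] sum_ind_inv[OF g] kcycle_inv_iff[OF g] inv by (rule refl)+
  show ?thesis
    unfolding kapC_def three five family_const_def five_form_def perm_form_def
    using five_cycle_not_three_cycle[of n g] by (cases "five_cycle n g"; cases "three_cycle n g") auto
qed

lemma fixed_image_kapL: "fixed_image n (kapL n a b)"
  unfolding fixed_image_def by (auto simp: kapL_eq_family_linear family_linear_def)

lemma off_identity_kapL: "off_identity n (kapL n a b)"
proof -
  have "\<not> three_cycle n id" using kcycle_moves[of n 3 id] by auto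
  then show ?thesis
    unfolding off_identity_def by (auto simp: kapL_eq_family_linear family_linear_def)
qed

lemma DOA_cong:
  assumes "\<And>g i j. g \<in> Sym n \<Longrightarrow> i < j \<Longrightarrow> j < n \<Longrightarrow> (\<forall>k<n. kL g i j k = kL' g i j k) \<and> kC g i j = kC' g i j"
  shows "DOA n kL kC \<longleftrightarrow> DOA n kL' kC'"
proof -
  have "rel n kL kC i j = rel n kL' kC' i j" if "i < j" "j < n" for i j
    unfolding rel_def using assms[OF _ that] by (intro ext arg_cong2[where f = "(-)"] sum.cong) simp_all
  then have "{rel n kL kC i j | i j. i < j \<and> j < n} = {rel n kL' kC' i j | i j. i < j \<and> j < n}"
    by metis
  then show ?thesis by (simp add: DOA_def rel_ideal_def)
qed

theorem DOA_kap: "DOA n (kapL n a b) (kapC n a b c)"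
  using pbw_cochain.DOA[OF pbw_cochain_family[of n a b c]]
  by (subst DOA_cong[where kL' = "family_linear n a b" and kC' = "family_const n a b c"])
     (simp_all add: kapL_eq_family_linear kapC_eq_family_const)

definition alternating_extension :: "((nat \<Rightarrow> nat) \<Rightarrow> nat \<Rightarrow> nat \<Rightarrow> nat \<Rightarrow> complex)
    \<Rightarrow> ((nat \<Rightarrow> nat) \<Rightarrow> nat \<Rightarrow> nat \<Rightarrow> complex) \<Rightarrow> cochain" where
  "alternating_extension kL kC g i j w =
     (let \<kappa> = \<lambda>i j. case w of [] \<Rightarrow> kC g i j | k # _ \<Rightarrow> kL g i j k
      in if i < j then \<kappa> i j else if j < i then - \<kappa> j i else 0)"

theorem DOA_eq_kap:
  assumes DOA: "DOA n kL kC" and fixed: "fixed_image n kL" and off: "off_identity n kL"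
  shows "\<exists>a b c. \<forall>g\<in>Sym n. \<forall>i j. i < j \<and> j < n \<longrightarrow>
     (\<forall>k<n. kL g i j k = kapL n a b g i j k) \<and> kC g i j = kapC n a b c g i j"
proof -
  let ?\<kappa> = "alternating_extension kL kC"
  have \<kappa>: "?\<kappa> g i j [k] = kL g i j k" "?\<kappa> g i j [] = kC g i j" if "i < j" for g i j k
    using that by (simp_all add: alternating_extension_def)
  interpret alternating_cochain n ?\<kappa>
    by unfold_locales (simp add: alternating_extension_def Let_def)
  have "DOA n (\<lambda>g i j k. ?\<kappa> g i j [k]) (\<lambda>g i j. ?\<kappa> g i j [])"
    using DOA by (subst DOA_cong[of n _ kL _ kC]) (simp_all add: \<kappa>)
  then interpret pbw_cochain n ?\<kappa> unfolding DOA_iff_pbw_cochain .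
  have fixed': "?\<kappa> g i j [g q] = ?\<kappa> g i j [q]" if "g \<in> Sym n" "i < n" "j < n" "q < n" for g i j q
    using fixed that by (simp add: fixed_image_def alternating_extension_def Let_def)
  have off': "?\<kappa> id i j [q] = 0" if "i < n" "j < n" "q < n" for i j q
    using off that by (simp add: off_identity_def alternating_extension_def Let_def)
  obtain a b where linear: "\<And>g i j q. \<lbrakk>g \<in> Sym n; i < n; j < n; q < n\<rbrakk> \<Longrightarrow>
      ?\<kappa> g i j [q] = family_linear n a b g i j q"
    using linear_part_eq_family[OF fixed' off'] by blast
  obtain c where const: "\<And>g i j. \<lbrakk>g \<in> Sym n; i < n; j < n\<rbrakk> \<Longrightarrow> ?\<kappa> g i j [] = family_const n a b c g i j"
    using constant_part_eq_family[OF linear] by blast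
  have "(\<forall>k<n. kL g i j k = kapL n a b g i j k) \<and> kC g i j = kapC n a b c g i j"
    if "g \<in> Sym n" "i < j" "j < n" for g i j
    using that linear[of g i j] const[of g i j] \<kappa>[OF that(2), of g]
    by (simp add: kapL_eq_family_linear kapC_eq_family_const)
  then show ?thesis by blast
qed

theorem theorem3p2:
  fixes n :: nat
  assumes "n \<ge> 3"
  shows "(\<forall>a b c. DOA n (kapL n a b) (kapC n a b c))
       \<and> (\<forall>a b. fixed_image n (kapL n a b) \<and> off_identity n (kapL n a b))
       \<and> (\<forall>kL kC. DOA n kL kC \<and> fixed_image n kL \<and> off_identity n kL \<longrightarrow>
            (\<exists>a b c. \<forall>g\<in>Sym n. \<forall>i j. i < j \<and> j < n \<longrightarrow>
                 (\<forall>k<n. kL g i j k = kapL n a b g i j k) \<and> kC g i j = kapC n a b c g i j))"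
proof (intro conjI allI impI)
  fix a b c
  show "DOA n (kapL n a b) (kapC n a b c)" by (rule DOA_kap)
  show "fixed_image n (kapL n a b)" by (rule fixed_image_kapL)
  show "off_identity n (kapL n a b)" by (rule off_identity_kapL)
next
  fix kL kC assume "DOA n kL kC \<and> fixed_image n kL \<and> off_identity n kL"
  then show "\<exists>a b c. \<forall>g\<in>Sym n. \<forall>i j. i < j \<and> j < n \<longrightarrow>
      (\<forall>k<n. kL g i j k = kapL n a b g i j k) \<and> kC g i j = kapC n a b c g i j"
    by (intro DOA_eq_kap) simp_all
qed

end
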